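(* Let $p\in[1,+\infty[$ and $\nu,\beta\in]0,+\infty[$. Let $\mathbf X$ be the Hunt process on $E$ with semigroup kernel $p_t(x,y)$ described in the context, and suppose that the life time condition, the Bishop type inequality, and the upper and lower heat kernel estimates described in the context all hold. Then $S_K^{\,p}=K_{\nu,\beta}^{\,p}$ and $S_D^{\,p}=D_{\nu,\beta}^{\,p}$. Moreover, $\mu\in K_{\nu,\beta}^{\,p}$ implies that $$\sup_{x\in E}\mu(B_R(x))<+\infty\quad\text{for all } R>0. \qquad ( * )$$ For $\nu<\beta$, we have $S_D^{\,p}=K_{\nu,\beta}^{\,p}=S_D^{\,1}=K_{\nu,\beta}^{\,1}$, and (for a positive Borel measure $\mu$ on $E$) $\mu\in K_{\nu,\beta}^{\,p}$ is equivalent to $( * )$.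
   Context: Notation: $]a,b[$ denotes an open interval, $a\lor b=\max\{a,b\}$; "increasing" and "decreasing" are in the wide (non-strict) sense. Setting. $(E,d)$ is a locally compact separable metric space, $\mathfrak m$ is a positive Radon measure on $E$ with full support, $B_r(x)=\{y\in E: d(x,y)<r\}$. $(\mathscr E,\mathscr F)$ is a symmetric regular Dirichlet form on $L^2(E;\mathfrak m)$, and $\mathbf X=(\Omega,X_t,\zeta,\mathbf P_x)$ is an associated Hunt process with life time $\zeta=\inf\{t\ge 0: X_t=\partial\}$ ($\partial$ the cemetery point of the one-point compactification). It is assumed that there is a jointly measurable nonnegative function $p_t(x,y)$, $(t,x,y)\in]0,+\infty[\times E\times E$ (semigroup kernel, or heat kernel) with $\mathbf E_x[u(X_t)]=\int_E p_t(x,y)u(y)\,\mathfrak m(dy)$ for all $x\in E$, $t>0$ and bounded Borel $u$; moreover $p_{t+s}(x,y)=\int_E p_s(x,z)p_t(z,y)\,\mathfrak m(dz)$ for all $x,y\in E$, $s,t>0$, and $\int_E p_t(x,y)\,\mathfrak m(dy)\le 1$. Assumptions. Fix $\nu,\beta\in]0,+\infty[$, $t_0\in]0,+\infty]$, and an increasing positive function $V$ on $]0,+\infty[$. - Life time condition: $\lim_{t\to0}\sup_{x\in E}\mathbf P_x(\zeta\le t)\in[0,1[$. - Bishop type inequality: $r\mapsto V(r)/r^\nu$ is increasing or bounded, and $\sup_{x\in E}\mathfrak m(B_r(x))\le V(r)$ for all $r>0$. - Upper and lower heat kernel estimates: there are positive decreasing functions $\Phi_1,\Phi_2$ on $[0,+\infty[$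 (possibly depending on $t_0$ if $t_0<+\infty$) with $\int_1^\infty \frac{(V(t)\lor t^\nu)\Phi_2(t)}{t}\,dt<+\infty$ and, for all $x,y\in E$, $t\in]0,t_0[$, $$\frac{1}{t^{\nu/\beta}}\Phi_1\Big(\frac{d(x,y)}{t^{1/\beta}}\Big)\le p_t(x,y)\le \frac{1}{t^{\nu/\beta}}\Phi_2\Big(\frac{d(x,y)}{t^{1/\beta}}\Big).$$ Classes of measures, $p\in[1,+\infty[$. - $S_K^{\,p}$ is the set of positive Radon measures $\mu$ on $E$ with $\lim_{t\to0}\sup_{x\in E}\int_E\big(\int_0^tp_s(x,y)\,ds\big)^p\mu(dy)=0$. - $S_D^{\,p}$ is the set of positive Radon measures $\mu$ on $E$ with $\sup_{x\in E}\int_E\big(\int_0^tp_s(x,y)\,ds\big)^p\mu(dy)<+\infty$ for some $t>0$. - Put $G(r)=r^{\beta-\nu}$ for $r\in]0,+\infty[$ if $\nu>\beta$, $G(r)=\log(r^{-1})$ for $r\in]0,1[$ if $\nu=\beta$, $G(0)=+\infty$, and $G(x,y)=G(d(x,y))$. $D_{\nu,\beta}^{\,p}$ is the set of positive Borel measures $\mu$ on $E$ such that: if $\nu\ge\beta$, $\sup_{x\in E}\int_{d(x,y)<r}G(x,y)^p\mu(dy)<+\infty$ for some $r>0$ ($r<1$ if $\nu=\beta$); if $\nu<\beta$, $\sup_{x\in E}\int_{d(x,y)\le1}\mu(dy)<+\infty$. - $K_{\nu,\beta}^{\,p}$ is the set of positive Borel measures $\mu$ on $E$ such that: if $\nu\ge\beta$,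 $\lim_{r\to0}\sup_{x\in E}\int_{d(x,y)<r}G(x,y)^p\mu(dy)=0$; if $\nu<\beta$, $\sup_{x\in E}\int_{d(x,y)\le1}\mu(dy)<+\infty$. *)

theory Defs
  imports "HOL-Probability.Probability"
begin

text \<open>
  The state space \<open>E\<close> is the universe of a type \<open>'a\<close>. In a metric space separability and second
  countability agree, and the class \<open>second_countable_topology\<close> is the one for which the
  library knows that the Borel sets of a product are the product of the Borel sets.
\<close>


section \<open>Measures on the state space\<close>

definition radon_measure :: "'a::topological_space measure \<Rightarrow> bool" where
  "radon_measure \<mu> \<longleftrightarrow>
     sets \<mu> = sets borel \<and>
     (\<forall>K. compact K \<longrightarrow> emeasure \<mu> K < \<infinity>) \<and>
     (\<forall>A\<in>sets borel. emeasure \<mu> A = (SUP K\<in>{K. compact K \<and> K \<subseteq> A}. emeasure \<mu> K))"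

definition full_support :: "'a::topological_space measure \<Rightarrow> bool" where
  "full_support \<mu> \<longleftrightarrow> (\<forall>U. open U \<and> U \<noteq> {} \<longrightarrow> 0 < emeasure \<mu> U)"


section \<open>Symmetric regular Dirichlet forms\<close>

text \<open>
  Elements of \<open>L\<^sup>2(E; m)\<close> are represented by square integrable functions. The domain \<open>D\<close> of a form
  is a set of such functions, saturated with respect to equality almost everywhere, and the form
  \<open>\<E>\<close> does not depend on the representative; only its values on \<open>D\<close> matter.
\<close>

definition L2 :: "'a measure \<Rightarrow> ('a \<Rightarrow> real) set" where
  "L2 m = {u \<in> borel_measurable m. integrable m (\<lambda>x. (u x)\<^sup>2)}"

definition form1 :: "'a measure \<Rightarrow> (('a \<Rightarrow> real) \<Rightarrow> ('a \<Rightarrow> real) \<Rightarrow> real) \<Rightarrow> ('a \<Rightarrow> real) \<Rightarrow> real" where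
  "form1 m \<E> u = \<E> u u + (\<integral>x. (u x)\<^sup>2 \<partial>m)"

locale dirichlet_form =
  fixes m :: "'a measure"
    and D :: "('a \<Rightarrow> real) set"
    and \<E> :: "('a \<Rightarrow> real) \<Rightarrow> ('a \<Rightarrow> real) \<Rightarrow> real"
  assumes domain_L2: "D \<subseteq> L2 m"
    and domain_AE: "\<And>u v. \<lbrakk>u \<in> D; v \<in> borel_measurable m; AE x in m. u x = v x\<rbrakk> \<Longrightarrow> v \<in> D"
    and form_AE: "\<And>u v w. \<lbrakk>u \<in> D; v \<in> D; w \<in> D; AE x in m. u x = v x\<rbrakk> \<Longrightarrow> \<E> u w = \<E> v w"
    and domain_zero: "(\<lambda>x. 0) \<in> D"
    and domain_add: "\<And>u v. \<lbrakk>u \<in> D; v \<in> D\<rbrakk> \<Longrightarrow> (\<lambda>x. u x + v x) \<in> D"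
    and domain_scale: "\<And>c u. u \<in> D \<Longrightarrow> (\<lambda>x. c * u x) \<in> D"
    and domain_dense: "\<And>u e. \<lbrakk>u \<in> L2 m; 0 < e\<rbrakk> \<Longrightarrow> \<exists>v\<in>D. (\<integral>x. (u x - v x)\<^sup>2 \<partial>m) < e"
    and form_add: "\<And>u v w. \<lbrakk>u \<in> D; v \<in> D; w \<in> D\<rbrakk> \<Longrightarrow> \<E> (\<lambda>x. u x + v x) w = \<E> u w + \<E> v w"
    and form_scale: "\<And>c u w. \<lbrakk>u \<in> D; w \<in> D\<rbrakk> \<Longrightarrow> \<E> (\<lambda>x. c * u x) w = c * \<E> u w"
    and form_sym: "\<And>u v. \<lbrakk>u \<in> D; v \<in> D\<rbrakk> \<Longrightarrow> \<E> u v = \<E> v u"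
    and form_nonneg: "\<And>u. u \<in> D \<Longrightarrow> 0 \<le> \<E> u u"
    and form_closed: "\<And>u :: nat \<Rightarrow> 'a \<Rightarrow> real.
      \<lbrakk>\<And>n. u n \<in> D;
       \<forall>e>0. \<exists>N. \<forall>i\<ge>N. \<forall>j\<ge>N. form1 m \<E> (\<lambda>x. u i x - u j x) < e\<rbrakk>
      \<Longrightarrow> \<exists>v\<in>D. (\<lambda>n. form1 m \<E> (\<lambda>x. u n x - v x)) \<longlonglongrightarrow> 0"
    and domain_contraction: "\<And>u. u \<in> D \<Longrightarrow> (\<lambda>x. min (max (u x) 0) 1) \<in> D"
    and form_contraction:
      "\<And>u. u \<in> D \<Longrightarrow> \<E> (\<lambda>x. min (max (u x) 0) 1) (\<lambda>x. min (max (u x) 0) 1) \<le> \<E> u u"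

definition C_c :: "('a::topological_space \<Rightarrow> real) set" where
  "C_c = {u. continuous_on UNIV u \<and> compact (closure {x. u x \<noteq> 0})}"

locale regular_dirichlet_form = dirichlet_form m D \<E>
  for m :: "'a::topological_space measure" and D \<E> +
  assumes core_dense_domain:
      "\<And>u e. \<lbrakk>u \<in> D; 0 < e\<rbrakk> \<Longrightarrow> \<exists>v\<in>D \<inter> C_c. form1 m \<E> (\<lambda>x. u x - v x) < e"
    and core_dense_C_c:
      "\<And>u e. \<lbrakk>u \<in> C_c; 0 < e\<rbrakk> \<Longrightarrow> \<exists>v\<in>D \<inter> C_c. \<forall>x. \<bar>u x - v x\<bar> < e"


section \<open>Hunt processes\<close>

text \<open>
  \<open>E \<union> {\<partial>}\<close> is \<open>'a option\<close> with \<open>\<partial> = None\<close>. For compact \<open>E\<close> the library's Alexandroff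
  compactification has \<open>None\<close> as an isolated point, which is the usual convention.
\<close>

abbreviation cemetery_top :: "'a::topological_space option topology" where
  "cemetery_top \<equiv> Alexandroff_compactification euclidean"

definition cemetery_borel :: "'a::topological_space option measure" where
  "cemetery_borel = sigma UNIV {U. openin cemetery_top U}"

text \<open>
  The law of the process with initial distribution \<open>\<mu>\<close>. The completion of \<open>\<mu>\<close> occurs because the
  functions \<open>x \<mapsto> P x A\<close> are in general only universally measurable.
\<close>

definition initial_law :: "'w measure \<Rightarrow> ('s \<Rightarrow> 'w measure) \<Rightarrow> 's measure \<Rightarrow> 'w measure" where
  "initial_law M P \<mu> =
     measure_of (space M) (sets M) (\<lambda>A. \<integral>\<^sup>+x. emeasure (P x) A \<partial>completion \<mu>)"

definition lifetime :: "(ennreal \<Rightarrow> 'w \<Rightarrow> 'a option) \<Rightarrow> 'w \<Rightarrow> ennreal" where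
  "lifetime X \<omega> = Inf {t. X t \<omega> = None}"

text \<open>
  Time runs through \<open>[0, \<infinity>]\<close>, with \<open>X \<infinity> = \<partial>\<close>. The Markov property is the case of constant \<open>\<sigma>\<close> of
  the strong Markov property.
\<close>

locale hunt_process = filtration "space M" \<F>
  for M :: "'w measure"
    and \<F> :: "ennreal \<Rightarrow> 'w measure"
    and X :: "ennreal \<Rightarrow> 'w \<Rightarrow> 'a::{metric_space, second_countable_topology} option"
    and P :: "'a option \<Rightarrow> 'w measure" +
  assumes prob_P: "\<And>x. prob_space (P x)"
    and sets_P: "\<And>x. sets (P x) = sets M"
    and universally_measurable_P: "\<And>\<mu> A. \<lbrakk>prob_space \<mu>; sets \<mu> = sets cemetery_borel; A \<in> sets M\<rbrakk>
          \<Longrightarrow> (\<lambda>x. emeasure (P x) A) \<in> borel_measurable (completion \<mu>)"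
    and sub_filtration: "\<And>t. sets (\<F> t) \<subseteq> sets M"
    and right_continuous_filtration:
      "\<And>t. t < \<infinity> \<Longrightarrow> sets (\<F> t) = (\<Inter>s\<in>{t<..}. sets (\<F> s))"
    and adapted: "\<And>t. X t \<in> \<F> t \<rightarrow>\<^sub>M cemetery_borel"
    and borel_transition: "\<And>t B. B \<in> sets cemetery_borel \<Longrightarrow>
          (\<lambda>x. emeasure (P x) {\<omega> \<in> space M. X t \<omega> \<in> B}) \<in> borel_measurable cemetery_borel"
    and normal: "\<And>x. AE \<omega> in P x. X 0 \<omega> = x"
    and cemetery_trap: "\<And>t. AE \<omega> in P None. X t \<omega> = None"
    and at_infinity_cemetery: "\<And>\<omega>. \<omega> \<in> space M \<Longrightarrow> X \<infinity> \<omega> = None"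
    and after_lifetime: "\<And>\<omega> t. \<lbrakk>\<omega> \<in> space M; lifetime X \<omega> \<le> t\<rbrakk> \<Longrightarrow> X t \<omega> = None"
    and shift: "\<exists>\<theta>. \<forall>t<\<infinity>. \<theta> t \<in> space M \<rightarrow> space M \<and>
          (\<forall>\<omega>\<in>space M. \<forall>s. X s (\<theta> t \<omega>) = X (s + t) \<omega>)"
    and right_continuous: "\<And>\<omega> t. \<lbrakk>\<omega> \<in> space M; t < \<infinity>\<rbrakk> \<Longrightarrow>
          limitin cemetery_top (\<lambda>s. X s \<omega>) (X t \<omega>) (at_right t)"
    and left_limits: "\<And>\<omega> t. \<lbrakk>\<omega> \<in> space M; 0 < t; t < \<infinity>\<rbrakk> \<Longrightarrow>
          \<exists>l. limitin cemetery_top (\<lambda>s. X s \<omega>) l (at_left t)"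
    and strong_markov: "\<And>\<mu> \<sigma> s B.
          \<lbrakk>prob_space \<mu>; sets \<mu> = sets cemetery_borel; stopping_time \<F> \<sigma>; B \<in> sets cemetery_borel\<rbrakk> \<Longrightarrow>
          AE \<omega> in initial_law M P \<mu>.
            real_cond_exp (initial_law M P \<mu>) (pre_sigma \<sigma>)
              (indicator {\<omega> \<in> space M. X (\<sigma> \<omega> + s) \<omega> \<in> B}) \<omega>
            = measure (P (X (\<sigma> \<omega>) \<omega>)) {\<omega>' \<in> space M. X s \<omega>' \<in> B}"
    and quasi_left_continuous: "\<And>\<mu> \<sigma>n \<sigma>.
          \<lbrakk>prob_space \<mu>; sets \<mu> = sets cemetery_borel; \<And>n::nat. stopping_time \<F> (\<sigma>n n); stopping_time \<F> \<sigma>;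
           \<And>\<omega>. \<omega> \<in> space M \<Longrightarrow> incseq (\<lambda>n. \<sigma>n n \<omega>);
           \<And>\<omega>. \<omega> \<in> space M \<Longrightarrow> (SUP n. \<sigma>n n \<omega>) = \<sigma> \<omega>\<rbrakk> \<Longrightarrow>
          AE \<omega> in initial_law M P \<mu>. \<sigma> \<omega> < \<infinity> \<longrightarrow>
            limitin cemetery_top (\<lambda>n. X (\<sigma>n n \<omega>) \<omega>) (X (\<sigma> \<omega>) \<omega>) sequentially"

text \<open>\<open>E\<^sub>x[u(X\<^sub>t)]\<close>, with functions on \<open>E\<close> extended by \<open>u(\<partial>) = 0\<close>.\<close>

definition transition ::
    "(ennreal \<Rightarrow> 'w \<Rightarrow> 'a option) \<Rightarrow> ('a option \<Rightarrow> 'w measure) \<Rightarrow> real \<Rightarrow> ('a \<Rightarrow> real) \<Rightarrow> 'a \<Rightarrow> real" where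
  "transition X P t u x = (\<integral>\<omega>. case_option 0 u (X (ennreal t) \<omega>) \<partial>P (Some x))"

definition nn_transition ::
    "(ennreal \<Rightarrow> 'w \<Rightarrow> 'a option) \<Rightarrow> ('a option \<Rightarrow> 'w measure) \<Rightarrow> real \<Rightarrow> ('a \<Rightarrow> ennreal) \<Rightarrow> 'a \<Rightarrow> ennreal"
  where
  "nn_transition X P t u x = (\<integral>\<^sup>+\<omega>. case_option 0 u (X (ennreal t) \<omega>) \<partial>P (Some x))"

text \<open>
  The process is associated with \<open>(\<E>, D)\<close> if it is \<open>m\<close>-symmetric and \<open>(\<E>, D)\<close> is the form of its
  transition semigroup: with \<open>\<E>\<^sub>t(u, v) = (u - P\<^sub>t u, v) / t\<close>, the domain consists of those \<open>u\<close> in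
  \<open>L\<^sup>2(E; m)\<close> for which \<open>\<E>\<^sub>t(u, u)\<close>, which increases as \<open>t\<close> decreases to 0, has a finite limit, and
  \<open>\<E>\<close> is the limit of \<open>\<E>\<^sub>t\<close>.
\<close>

definition semigroup_form ::
    "'a measure \<Rightarrow> (ennreal \<Rightarrow> 'w \<Rightarrow> 'a option) \<Rightarrow> ('a option \<Rightarrow> 'w measure) \<Rightarrow> real
     \<Rightarrow> ('a \<Rightarrow> real) \<Rightarrow> ('a \<Rightarrow> real) \<Rightarrow> real" where
  "semigroup_form m X P t u v = (\<integral>x. (u x - transition X P t u x) * v x \<partial>m) / t"

definition associated ::
    "'a::topological_space measure \<Rightarrow> ('a \<Rightarrow> real) set \<Rightarrow> (('a \<Rightarrow> real) \<Rightarrow> ('a \<Rightarrow> real) \<Rightarrow> real)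
     \<Rightarrow> (ennreal \<Rightarrow> 'w \<Rightarrow> 'a option) \<Rightarrow> ('a option \<Rightarrow> 'w measure) \<Rightarrow> bool" where
  "associated m D \<E> X P \<longleftrightarrow>
     (\<forall>t>0. \<forall>u\<in>borel_measurable borel. \<forall>v\<in>borel_measurable borel.
        (\<integral>\<^sup>+x. nn_transition X P t u x * v x \<partial>m) = (\<integral>\<^sup>+x. u x * nn_transition X P t v x \<partial>m)) \<and>
     D = {u \<in> L2 m. \<exists>c. ((\<lambda>t. semigroup_form m X P t u u) \<longlongrightarrow> c) (at_right 0)} \<and>
     (\<forall>u\<in>D. \<forall>v\<in>D. ((\<lambda>t. semigroup_form m X P t u v) \<longlongrightarrow> \<E> u v) (at_right 0))"

definition semigroup_kernel ::
    "'a::topological_space measure \<Rightarrow> (ennreal \<Rightarrow> 'w \<Rightarrow> 'a option) \<Rightarrow> ('a option \<Rightarrow> 'w measure)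
     \<Rightarrow> (real \<Rightarrow> 'a \<Rightarrow> 'a \<Rightarrow> real) \<Rightarrow> bool" where
  "semigroup_kernel m X P k \<longleftrightarrow>
     (\<lambda>(t, x, y). k t x y) \<in>
       borel_measurable (restrict_space (borel \<Otimes>\<^sub>M borel \<Otimes>\<^sub>M borel) ({0<..} \<times> UNIV \<times> UNIV)) \<and>
     (\<forall>t>0. \<forall>x y. 0 \<le> k t x y) \<and>
     (\<forall>t>0. \<forall>x. \<forall>u\<in>borel_measurable borel. bounded (range u) \<longrightarrow>
        transition X P t u x = (\<integral>y. k t x y * u y \<partial>m)) \<and>
     (\<forall>s>0. \<forall>t>0. \<forall>x y. ennreal (k (t + s) x y) = (\<integral>\<^sup>+z. ennreal (k s x z * k t z y) \<partial>m)) \<and>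
     (\<forall>t>0. \<forall>x. (\<integral>\<^sup>+y. ennreal (k t x y) \<partial>m) \<le> 1)"


section \<open>The assumptions on the process\<close>

definition life_time_condition ::
    "'w measure \<Rightarrow> (ennreal \<Rightarrow> 'w \<Rightarrow> 'a option) \<Rightarrow> ('a option \<Rightarrow> 'w measure) \<Rightarrow> bool" where
  "life_time_condition M X P \<longleftrightarrow>
     (\<exists>c\<in>{0..<1}. ((\<lambda>t. SUP x. measure (P (Some x)) {\<omega> \<in> space M. lifetime X \<omega> \<le> ennreal t})
                     \<longlongrightarrow> c) (at_right 0))"

definition bishop_inequality :: "'a::metric_space measure \<Rightarrow> real \<Rightarrow> (real \<Rightarrow> real) \<Rightarrow> bool" where
  "bishop_inequality m \<nu> V \<longleftrightarrow>
     (mono_on {0<..} (\<lambda>r. V r / r powr \<nu>) \<or> bounded ((\<lambda>r. V r / r powr \<nu>) ` {0<..})) \<and>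
     (\<forall>r>0. (SUP x. emeasure m (ball x r)) \<le> ennreal (V r))"

definition heat_kernel_estimates ::
    "real \<Rightarrow> real \<Rightarrow> ennreal \<Rightarrow> (real \<Rightarrow> real) \<Rightarrow> (real \<Rightarrow> 'a::metric_space \<Rightarrow> 'a \<Rightarrow> real) \<Rightarrow> bool" where
  "heat_kernel_estimates \<nu> \<beta> t\<^sub>0 V k \<longleftrightarrow>
     (\<exists>\<Phi>\<^sub>1 \<Phi>\<^sub>2 :: real \<Rightarrow> real.
        (\<forall>s\<ge>0. 0 < \<Phi>\<^sub>1 s) \<and> antimono_on {0..} \<Phi>\<^sub>1 \<and>
        (\<forall>s\<ge>0. 0 < \<Phi>\<^sub>2 s) \<and> antimono_on {0..} \<Phi>\<^sub>2 \<and>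
        (\<integral>\<^sup>+t\<in>{1..}. ennreal (max (V t) (t powr \<nu>) * \<Phi>\<^sub>2 t / t) \<partial>lborel) < \<infinity> \<and>
        (\<forall>x y t. 0 < t \<and> ennreal t < t\<^sub>0 \<longrightarrow>
           1 / t powr (\<nu> / \<beta>) * \<Phi>\<^sub>1 (dist x y / t powr (1 / \<beta>)) \<le> k t x y \<and>
           k t x y \<le> 1 / t powr (\<nu> / \<beta>) * \<Phi>\<^sub>2 (dist x y / t powr (1 / \<beta>))))"


section \<open>Classes of measures\<close>

text \<open>Only used for exponents \<open>a > 0\<close>.\<close>

definition ennpowr :: "ennreal \<Rightarrow> real \<Rightarrow> ennreal" where
  "ennpowr c a = (if c = \<infinity> then \<infinity> else ennreal (enn2real c powr a))"

definition kernel_potential ::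
    "(real \<Rightarrow> 'a \<Rightarrow> 'a \<Rightarrow> real) \<Rightarrow> real \<Rightarrow> 'a \<Rightarrow> 'a \<Rightarrow> ennreal" where
  "kernel_potential k t x y = (\<integral>\<^sup>+s\<in>{0<..<t}. ennreal (k s x y) \<partial>lborel)"

definition S_K :: "(real \<Rightarrow> 'a::topological_space \<Rightarrow> 'a \<Rightarrow> real) \<Rightarrow> real \<Rightarrow> 'a measure set" where
  "S_K k p = {\<mu>. radon_measure \<mu> \<and>
     ((\<lambda>t. SUP x. \<integral>\<^sup>+y. ennpowr (kernel_potential k t x y) p \<partial>\<mu>) \<longlongrightarrow> 0) (at_right 0)}"

definition S_D :: "(real \<Rightarrow> 'a::topological_space \<Rightarrow> 'a \<Rightarrow> real) \<Rightarrow> real \<Rightarrow> 'a measure set" where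
  "S_D k p = {\<mu>. radon_measure \<mu> \<and>
     (\<exists>t>0. (SUP x. \<integral>\<^sup>+y. ennpowr (kernel_potential k t x y) p \<partial>\<mu>) < \<infinity>)}"

text \<open>
  For \<open>\<nu> = \<beta>\<close> only the values at \<open>0 \<le> r < 1\<close>, where the logarithm is positive, are meaningful; for
  \<open>\<nu> < \<beta>\<close> the function is not used.
\<close>

definition G :: "real \<Rightarrow> real \<Rightarrow> real \<Rightarrow> ennreal" where
  "G \<nu> \<beta> r =
     (if r = 0 then \<infinity>
      else if \<nu> > \<beta> then ennreal (r powr (\<beta> - \<nu>))
      else ennreal (ln (1 / r)))"

definition D_class :: "real \<Rightarrow> real \<Rightarrow> real \<Rightarrow> 'a::metric_space measure set" where
  "D_class \<nu> \<beta> p = {\<mu>. sets \<mu> = sets borel \<and>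
     (if \<nu> \<ge> \<beta>
      then \<exists>r>0. (\<nu> = \<beta> \<longrightarrow> r < 1) \<and>
             (SUP x. \<integral>\<^sup>+y\<in>ball x r. ennpowr (G \<nu> \<beta> (dist x y)) p \<partial>\<mu>) < \<infinity>
      else (SUP x. emeasure \<mu> (cball x 1)) < \<infinity>)}"

definition K_class :: "real \<Rightarrow> real \<Rightarrow> real \<Rightarrow> 'a::metric_space measure set" where
  "K_class \<nu> \<beta> p = {\<mu>. sets \<mu> = sets borel \<and>
     (if \<nu> \<ge> \<beta>
      then ((\<lambda>r. SUP x. \<integral>\<^sup>+y\<in>ball x r. ennpowr (G \<nu> \<beta> (dist x y)) p \<partial>\<mu>) \<longlongrightarrow> 0) (at_right 0)
      else (SUP x. emeasure \<mu> (cball x 1)) < \<infinity>)}"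

definition uniformly_finite_on_balls :: "'a::metric_space measure \<Rightarrow> bool" where
  "uniformly_finite_on_balls \<mu> \<longleftrightarrow> (\<forall>R>0. (SUP x. emeasure \<mu> (ball x R)) < \<infinity>)"

end

theory Submission
  imports Defs
begin

text \<open>
  Both descriptions of a class integrate the same function up to constants. By the heat kernel
  estimates the time integral of the kernel up to \<open>t\<close> lies between the two radial potentials
  \<open>\<integral>\<^sub>0\<^sup>t s powr (-\<nu>/\<beta>) * \<Phi> (d / s powr (1/\<beta>)) ds\<close>, where \<open>d\<close> is the distance and \<open>\<Phi>\<close> is the lower or
  the upper profile. The integrand changes its behaviour at \<open>s = d powr \<beta>\<close>. For \<open>\<nu> \<ge> \<beta>\<close> and small \<open>d\<close>
  the potential is therefore comparable with \<open>G d\<close>: from below (\<open>G_le_radial_potential\<close>) it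
  suffices to look at times near or above \<open>d powr \<beta>\<close>; from above (\<open>radial_potential_le_G\<close>) one uses
  that \<open>u powr \<nu> * \<Phi> u\<close> is bounded, which follows from monotonicity and the integrability of
  the upper profile. For \<open>\<nu> < \<beta>\<close> the potential is bounded by a multiple of \<open>t powr (1 - \<nu>/\<beta>)\<close> and,
  for \<open>d \<le> 1\<close>, bounded away from 0.

  The lower bound alone gives that a measure with small (or finite) kernel potentials is in the
  class \<open>K\<close> (or \<open>D\<close>). For the converse the part of the integral far from the diagonal has to be
  controlled, and this needs that balls of one radius having uniformly bounded measure implies a
  bound \<open>\<mu> (B\<^sub>R(x)) \<le> A * V (2 * R)\<close> for all larger radii (\<open>ball_growth\<close>). It holds because a ball
  of radius \<open>R\<close> contains only boundedly many points at mutual distance \<open>r\<close>: the volume of a ball of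
  radius \<open>R\<close> is at most \<open>V R\<close>, and small balls have volume bounded from below uniformly in the centre.
  The last fact (\<open>volume_lower\<close>) is where the life time condition enters. The mass of the kernel
  at time \<open>t\<close> is the probability of being alive at \<open>t\<close>, hence at least some \<open>c\<^sub>0 > 0\<close> for small
  \<open>t\<close>, whereas the mass outside a fixed ball tends to 0 as \<open>t\<close> does, so that a fixed amount
  remains inside the ball, where the density is bounded.

  Both the estimate of the escaping mass and that of the far part of the potential
  (\<open>radial_potential_far\<close>) split the space into dyadic annuli and compare the resulting series with
  the integral of \<open>max (V t) (t powr \<nu>) * \<Phi> t / t\<close>. The alternative in the Bishop inequality
  enters through the scaling bound \<open>V_scaling\<close>, which holds in both of its cases. The far part of the potential is \<open>O(t)\<close>, so it is harmless
  for both classes. Finally, ball growth makes every measure of the class \<open>D\<close> finite on balls,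
  hence a Radon measure, since the space is locally compact with countable base; and for \<open>\<nu> < \<beta>\<close> it
  identifies the classes with the measures that are uniformly finite on balls.
\<close>


section \<open>Real powers of extended nonnegative reals\<close>

lemma ennpowr_mono: "c \<le> d \<Longrightarrow> 0 < a \<Longrightarrow> ennpowr c a \<le> ennpowr d a"
  by (auto simp: ennpowr_def top_unique enn2real_mono less_top intro!: ennreal_leI powr_mono2)

lemma ennpowr_ennreal: "0 \<le> c \<Longrightarrow> ennpowr (ennreal c) a = ennreal (c powr a)"
  by (simp add: ennpowr_def)

lemma ennpowr_cmult:
  assumes "0 < C"
  shows "ennpowr (ennreal C * c) a = ennreal (C powr a) * ennpowr c a"
proof (cases c)
  case (real r)
  with assms show ?thesis
    by (simp add: ennpowr_ennreal powr_mult flip: ennreal_mult)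
next
  case top
  with assms show ?thesis
    by (simp add: ennpowr_def ennreal_mult_top)
qed

lemma ennpowr_le_self:
  assumes "c \<le> 1" "1 \<le> a"
  shows "ennpowr c a \<le> c"
proof (cases c)
  case (real r)
  then have "r \<le> 1" using assms by simp
  then have "r powr a \<le> r powr 1"
    using real assms by (cases "r = 0") (simp_all add: powr_le_one_le)
  with real show ?thesis by (simp add: ennpowr_ennreal ennreal_leI)
qed (use assms in auto)

lemma measurable_ennpowr [measurable]:
  assumes [measurable]: "f \<in> borel_measurable M"
  shows "(\<lambda>x. ennpowr (f x) a) \<in> borel_measurable M"
  unfolding ennpowr_def by measurable

section \<open>Borel measures that are finite on balls are Radon measures\<close>

text \<open>
  For a finite measure on a metric space, the sets approximated from inside by closed sets together
  with their complements form a \<open>\<sigma>\<close>-algebra. Keeping only inner approximation makes countable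
  unions and countable intersections the two operations to be checked.
\<close>

definition closed_inner_regular :: "'a::topological_space measure \<Rightarrow> 'a set \<Rightarrow> bool" where
  "closed_inner_regular N A \<longleftrightarrow> (\<forall>e>0. \<exists>F. closed F \<and> F \<subseteq> A \<and> measure N (A - F) < e)"

lemma closed_inner_regular_Union_Inter:
  fixes N :: "'a::topological_space measure" and A :: "nat \<Rightarrow> 'a set"
  assumes "finite_measure N" and [measurable_cong]: "sets N = sets borel"
    and A [measurable]: "\<And>i. A i \<in> sets borel" and reg: "\<And>i. closed_inner_regular N (A i)"
  shows "closed_inner_regular N (\<Union>i. A i)" "closed_inner_regular N (\<Inter>i. A i)"
proof -
  interpret finite_measure N by fact
  have *: "\<exists>F. (\<forall>i. closed (F i) \<and> F i \<subseteq> A i) \<and> measure N (\<Union>i. A i - F i) < e" if "0 < e" for e :: real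
  proof -
    have "\<forall>i. \<exists>F. closed F \<and> F \<subseteq> A i \<and> measure N (A i - F) < (e/2) * (1/2)^Suc i"
      using reg that unfolding closed_inner_regular_def
      by (metis half_gt_zero mult_pos_pos zero_less_one zero_less_power)
    then obtain F where F: "\<And>i. closed (F i)" "\<And>i. F i \<subseteq> A i"
      "\<And>i. measure N (A i - F i) < (e/2) * (1/2)^Suc i" by metis
    have [measurable]: "F i \<in> sets borel" for i using F(1) by simp
    have s: "(\<lambda>i. (e/2) * (1/2)^Suc i) sums ((e/2) * 1)"
      by (rule sums_mult) (rule power_half_series)
    have sm: "summable (\<lambda>i. measure N (A i - F i))"
    proof (rule summable_comparison_test'[OF sums_summable[OF s], of 0])
      show "norm (measure N (A i - F i)) \<le> (e/2) * (1/2)^Suc i" for i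
        using less_imp_le[OF F(3)[of i]] unfolding real_norm_def abs_of_nonneg[OF measure_nonneg] .
    qed
    have "measure N (\<Union>i. A i - F i) \<le> (\<Sum>i. measure N (A i - F i))"
      by (rule finite_measure_subadditive_countably[OF _ sm]) auto
    also have "\<dots> \<le> e/2"
      using suminf_le[OF _ sm sums_summable[OF s]] F(3) sums_unique[OF s] by (metis less_imp_le mult.right_neutral)
    also have "\<dots> < e" using that by simp
    finally show ?thesis using F by blast
  qed
  show "closed_inner_regular N (\<Union>i. A i)"
    unfolding closed_inner_regular_def
  proof (intro allI impI)
    fix e :: real assume "0 < e"
    with *[of e] obtain F where F: "\<And>i. closed (F i)" "\<And>i. F i \<subseteq> A i" "measure N (\<Union>i. A i - F i) < e" by blast
    have [measurable]: "F i \<in> sets borel" for i using F(1) by simp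
    \<comment> \<open>The union of all \<open>F i\<close> need not be closed, but finitely many of them exhaust it up to small measure.\<close>
    define D where "D n = (\<Union>i. A i) - (\<Union>i\<le>n. F i)" for n
    have "(\<lambda>n. measure N (D n)) \<longlonglongrightarrow> measure N (\<Inter>n. D n)"
    proof (rule finite_Lim_measure_decseq)
      show "range D \<subseteq> sets N" unfolding D_def by auto
      show "decseq D" unfolding D_def decseq_def by (fastforce intro: order_trans)
    qed
    moreover have "measure N (\<Inter>n. D n) \<le> measure N (\<Union>i. A i - F i)"
      by (rule finite_measure_mono) (auto simp: D_def)
    ultimately have "eventually (\<lambda>n. measure N (D n) < e) sequentially"
      using order_tendstoD(2) le_less_trans F(3) by blast
    then obtain n where "measure N (D n) < e" by (auto simp: eventually_sequentially)
    then show "\<exists>C. closed C \<and> C \<subseteq> (\<Union>i. A i) \<and> measure N ((\<Union>i. A i) - C) < e"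
      using F by (intro exI[of _ "\<Union>i\<le>n. F i"]) (auto simp: D_def)
  qed
  show "closed_inner_regular N (\<Inter>i. A i)"
    unfolding closed_inner_regular_def
  proof (intro allI impI)
    fix e :: real assume "0 < e"
    with *[of e] obtain F where F: "\<And>i. closed (F i)" "\<And>i. F i \<subseteq> A i" "measure N (\<Union>i. A i - F i) < e" by blast
    have [measurable]: "F i \<in> sets borel" for i using F(1) by simp
    have "measure N ((\<Inter>i. A i) - (\<Inter>i. F i)) \<le> measure N (\<Union>i. A i - F i)"
      by (rule finite_measure_mono) auto
    with F show "\<exists>C. closed C \<and> C \<subseteq> (\<Inter>i. A i) \<and> measure N ((\<Inter>i. A i) - C) < e"
      by (intro exI[of _ "\<Inter>i. F i"]) auto
  qed
qed

lemma closed_inner_regular_closed: "closed A \<Longrightarrow> closed_inner_regular N A"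
  unfolding closed_inner_regular_def by (intro allI impI exI[of _ A]) simp

text \<open>
  Open subsets of a metric space are countable unions of closed sets, so the open sets and their
  complements both belong to the system.
\<close>

lemma borel_closed_inner_regular:
  fixes N :: "'a::metric_space measure"
  assumes N: "finite_measure N" "sets N = sets borel" and "A \<in> sets borel"
  shows "closed_inner_regular N A"
proof -
  have "A \<in> sigma_sets UNIV {S. open S}"
    using assms(3) unfolding borel_def by (subst (asm) sets_measure_of) simp_all
  then have "closed_inner_regular N A \<and> closed_inner_regular N (- A)"
  proof (induction rule: sigma_sets.induct)
    case (Basic U)
    then have "open U" by simp
    have "fsigma_in euclidean U"
      using \<open>open U\<close> by (intro open_imp_fsigma_in metrizable_space_euclidean) simp
    then have "\<exists>C. (\<forall>n. closedin euclidean (C n)) \<and> (\<forall>n. C n \<subseteq> C (Suc n)) \<and> \<Union> (range C) = U"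
      by (rule fsigma_in_ascending[THEN iffD1])
    then obtain C where C': "(\<forall>n. closedin euclidean (C n)) \<and> (\<forall>n. C n \<subseteq> C (Suc n)) \<and> \<Union> (range C) = U" ..
    then have C: "closed (C n)" for n by simp
    have CU: "\<Union> (range C) = U" using C' by (elim conjE)
    have "closed_inner_regular N U"
      unfolding CU[symmetric]
      using C by (intro closed_inner_regular_Union_Inter[OF N] closed_inner_regular_closed borel_closed)
    with \<open>open U\<close> show ?case by (simp add: closed_inner_regular_closed closed_Compl)
  next
    case Empty
    show ?case by (simp add: closed_inner_regular_closed)
  next
    case (Compl A)
    have "UNIV - A = - A" "- (- A) = A" by auto
    with Compl.IH show ?case by argo
  next
    case (Union A)
    have A: "A i \<in> sets borel" for i
      using Union.hyps[of i] unfolding borel_def by (subst sets_measure_of) simp_all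
    have A': "- A i \<in> sets borel" for i
      using A[of i] by (rule borel_comp)
    have "closed_inner_regular N (\<Union>i. A i)"
      using A Union.IH by (intro closed_inner_regular_Union_Inter[OF N]) blast+
    moreover have "closed_inner_regular N (\<Inter>i. - A i)"
      using A' Union.IH by (intro closed_inner_regular_Union_Inter[OF N]) blast+
    moreover have "- (\<Union>i. A i) = (\<Inter>i. - A i)" by blast
    ultimately show ?case by simp
  qed
  then show ?thesis ..
qed

lemma locally_compact_sigma_compact:
  assumes "locally_compact_space (euclidean :: 'a::second_countable_topology topology)"
  obtains C :: "nat \<Rightarrow> 'a::second_countable_topology set" where "\<And>n. compact (C n)" "incseq C" "(\<Union>n. C n) = UNIV"
proof -
  have "\<exists>U K. open U \<and> compact K \<and> x \<in> U \<and> U \<subseteq> K" for x :: 'a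
    using assms by (auto simp: locally_compact_space_def)
  then obtain U K where UK: "\<And>x::'a. open (U x)" "\<And>x::'a. compact (K x)" "\<And>x::'a. x \<in> U x" "\<And>x::'a. U x \<subseteq> K x"
    by metis
  obtain \<U> where \<U>: "\<U> \<subseteq> range U" "countable \<U>" "\<Union>\<U> = \<Union>(range U)"
    using Lindelof[of "range U"] UK(1) by blast
  have full: "\<Union>\<U> = UNIV" using \<U>(3) UK(3) by blast
  then have "\<U> \<noteq> {}" by auto
  define B where "B n = from_nat_into \<U> n" for n
  have B: "range B = \<U>" unfolding B_def using \<U>(2) \<open>\<U> \<noteq> {}\<close> by simp
  have "\<forall>n. \<exists>x. B n = U x" using B \<U>(1) by blast
  then obtain c where c: "\<And>n. B n = U (c n)" by metis
  show ?thesis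
  proof
    show "compact (\<Union>i\<le>n. K (c i))" for n by (intro compact_UN) (auto simp: UK)
    show "incseq (\<lambda>n. \<Union>i\<le>n. K (c i))" unfolding incseq_def by (fastforce intro: order_trans)
    have "x \<in> (\<Union>n. \<Union>i\<le>n. K (c i))" for x
    proof -
      obtain n where "x \<in> B n" using full B by blast
      then show ?thesis using c UK(4) by blast
    qed
    then show "(\<Union>n. \<Union>i\<le>n. K (c i)) = UNIV" by blast
  qed
qed

text \<open>
  A closed set intersected with a member of a compact exhaustion is compact, so closed inner
  regularity of the restriction to each member yields compact inner regularity. Finiteness of the
  restrictions is what finiteness on balls provides.
\<close>

lemma radon_measure_if_finite_on_balls:
  fixes \<mu> :: "'a::{metric_space, second_countable_topology} measure"
  assumes lc: "locally_compact_space (euclidean :: 'a topology)"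
    and sets [measurable_cong]: "sets \<mu> = sets borel" and fin: "\<And>x R. 0 < R \<Longrightarrow> emeasure \<mu> (ball x R) < \<infinity>"
  shows "radon_measure \<mu>"
proof -
  have cfin: "emeasure \<mu> K < \<infinity>" if K: "compact K" for K
  proof -
    obtain R and x :: 'a where "0 < R" "K \<subseteq> ball x R"
      using bounded_subset_ballD[OF compact_imp_bounded[OF K]] by blast
    then have "emeasure \<mu> K \<le> emeasure \<mu> (ball x R)"
      using sets by (intro emeasure_mono) simp_all
    also have "\<dots> < \<infinity>" using fin \<open>0 < R\<close> .
    finally show ?thesis .
  qed
  obtain C :: "nat \<Rightarrow> 'a set" where C: "\<And>n. compact (C n)" "incseq C" "(\<Union>n. C n) = UNIV"
    by (rule locally_compact_sigma_compact[OF lc]) (rule that)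
  have Cs [measurable]: "C n \<in> sets borel" for n using C(1)[of n] by (intro borel_closed compact_imp_closed)
  have inner: "emeasure \<mu> A = (SUP K\<in>{K. compact K \<and> K \<subseteq> A}. emeasure \<mu> K)" (is "_ = ?S")
    if A [measurable]: "A \<in> sets borel" for A
  proof (rule antisym)
    have "emeasure \<mu> (A \<inter> C n) \<le> ?S" for n
    proof (rule ennreal_le_epsilon)
      fix e :: real assume "0 < e"
      define N where "N = density \<mu> (indicator (C n))"
      have N: "emeasure N B = emeasure \<mu> (C n \<inter> B)" if "B \<in> sets borel" for B
        unfolding N_def using that sets by (simp add: emeasure_restricted)
      have "sets N = sets borel" by (simp add: N_def sets)
      have "space N = UNIV" using sets_eq_imp_space_eq[OF \<open>sets N = sets borel\<close>] by simp
      have finN: "finite_measure N"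
        using N[of UNIV] cfin[OF C(1)[of n]] \<open>space N = UNIV\<close> by (intro finite_measureI) simp
      obtain F where F: "closed F" "F \<subseteq> A" "measure N (A - F) < e"
        using borel_closed_inner_regular[OF finN \<open>sets N = sets borel\<close> A] \<open>0 < e\<close>
        unfolding closed_inner_regular_def by blast
      have "emeasure N (A - F) \<le> ennreal e"
        using F(3) by (simp add: finite_measure.emeasure_eq_measure[OF finN] ennreal_leI)
      then have e: "emeasure \<mu> (C n \<inter> (A - F)) \<le> ennreal e"
        using N[of "A - F"] F(1) by simp
      have [measurable]: "F \<in> sets borel" using F(1) by simp
      have "A \<inter> C n = (C n \<inter> F) \<union> (C n \<inter> (A - F))" using F(2) by blast
      then have "emeasure \<mu> (A \<inter> C n) \<le> emeasure \<mu> (C n \<inter> F) + emeasure \<mu> (C n \<inter> (A - F))"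
        by (simp add: emeasure_subadditive)
      also have "\<dots> \<le> ?S + ennreal e"
      proof (intro add_mono e SUP_upper)
        show "C n \<inter> F \<in> {K. compact K \<and> K \<subseteq> A}"
          using compact_Int_closed[OF C(1) F(1)] F(2) by blast
      qed
      finally show "emeasure \<mu> (A \<inter> C n) \<le> ?S + ennreal e" .
    qed
    moreover have "(SUP n. emeasure \<mu> (A \<inter> C n)) = emeasure \<mu> (\<Union>n. A \<inter> C n)"
      using sets C(2) by (intro SUP_emeasure_incseq) (auto simp: incseq_def)
    moreover have "(\<Union>n. A \<inter> C n) = A" using C(3) by auto
    ultimately show "emeasure \<mu> A \<le> ?S"
      using SUP_least[of UNIV "\<lambda>n. emeasure \<mu> (A \<inter> C n)" ?S] by simp
    show "?S \<le> emeasure \<mu> A"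
      by (rule SUP_least, rule emeasure_mono) simp_all
  qed
  show ?thesis
    unfolding radon_measure_def by (intro conjI allI impI ballI sets cfin inner)
qed

section \<open>Time integrals of radial kernels: bounds from below\<close>

lemma eventually_at_right_0D:
  assumes "eventually P (at_right (0::real))" "0 < b"
  obtains r where "0 < r" "r < b" "P r"
proof -
  have "eventually (\<lambda>r. P r \<and> r \<in> {0<..<b}) (at_right 0)"
    using assms by (intro eventually_conj eventually_at_right_real)
  from eventually_happens'[OF trivial_limit_at_right_real this] show ?thesis
    by (elim exE conjE) (rule that, simp_all)
qed

text \<open>
  The potential of a kernel \<open>s powr (-\<nu>/\<beta>) * \<Phi> (d / s powr (1/\<beta>))\<close> with the scaling of the heat kernel
  estimates, as a function of the distance \<open>d\<close>.
\<close>

definition radial_potential :: "(real \<Rightarrow> real) \<Rightarrow> real \<Rightarrow> real \<Rightarrow> real \<Rightarrow> real \<Rightarrow> ennreal" where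
  "radial_potential \<Phi> \<nu> \<beta> t d =
     (\<integral>\<^sup>+s\<in>{0<..<t}. ennreal (\<Phi> (d / s powr (1/\<beta>)) / s powr (\<nu>/\<beta>)) \<partial>lborel)"

text \<open>
  The truncation makes the profile monotone on the whole line, hence measurable.
\<close>

lemma borel_measurable_antimono_on_nonneg:
  fixes \<Phi> :: "real \<Rightarrow> real"
  assumes "antimono_on {0..} \<Phi>"
  shows "(\<lambda>u. \<Phi> (max 0 u)) \<in> borel_measurable borel"
proof -
  have "mono (\<lambda>u. - \<Phi> (max 0 u))"
    using assms by (intro monoI) (auto simp: monotone_on_def)
  from borel_measurable_uminus[OF borel_measurable_mono[OF this]] show ?thesis by simp
qed

lemma measurable_radial_kernel:
  fixes \<Phi> :: "real \<Rightarrow> real"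
  assumes \<Phi>: "antimono_on {0..} \<Phi>" and "0 \<le> d"
  shows "(\<lambda>s. \<Phi> (d / s powr (1/\<beta>)) / s powr (\<nu>/\<beta>)) \<in> borel_measurable borel"
proof -
  have "(\<lambda>s. \<Phi> (max 0 (d / s powr (1/\<beta>)))) \<in> borel_measurable borel"
    by (rule measurable_compose[OF _ borel_measurable_antimono_on_nonneg[OF \<Phi>]]) measurable
  moreover have "max 0 (d / s powr (1/\<beta>)) = d / s powr (1/\<beta>)" for s
    using assms(2) by (simp add: max_def)
  ultimately have [measurable]: "(\<lambda>s. \<Phi> (d / s powr (1/\<beta>))) \<in> borel_measurable borel" by simp
  show ?thesis by measurable
qed

lemma radial_potential_antimono:
  assumes "antimono_on {0..} \<Phi>" "0 \<le> d" "d \<le> d'"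
  shows "radial_potential \<Phi> \<nu> \<beta> t d' \<le> radial_potential \<Phi> \<nu> \<beta> t d"
  unfolding radial_potential_def
proof (rule nn_integral_mono)
  fix s :: real
  have "d / s powr (1/\<beta>) \<le> d' / s powr (1/\<beta>)"
    using assms by (intro divide_right_mono) auto
  then have "\<Phi> (d' / s powr (1/\<beta>)) \<le> \<Phi> (d / s powr (1/\<beta>))"
    using assms by (auto simp: monotone_on_def)
  then show "ennreal (\<Phi> (d' / s powr (1/\<beta>)) / s powr (\<nu>/\<beta>)) * indicator {0<..<t} s
    \<le> ennreal (\<Phi> (d / s powr (1/\<beta>)) / s powr (\<nu>/\<beta>)) * indicator {0<..<t} s"
    by (intro mult_right_mono ennreal_leI divide_right_mono) auto
qed

lemma nn_integral_const_Ioo: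
  assumes "0 \<le> c" "a \<le> b"
  shows "(\<integral>\<^sup>+s\<in>{a<..<b}. ennreal c \<partial>lborel) = ennreal (c * (b - a))"
proof -
  have "(\<integral>\<^sup>+s\<in>{a<..<b}. ennreal c \<partial>lborel) = ennreal c * ennreal (b - a)"
    using assms by (subst nn_integral_cmult_indicator) simp_all
  also have "\<dots> = ennreal (c * (b - a))"
    using assms(1) by (rule ennreal_mult'[symmetric])
  finally show ?thesis .
qed

lemma nn_integral_inverse_Icc:
  fixes a b :: real
  assumes "0 < a" "a \<le> b"
  shows "(\<integral>\<^sup>+s\<in>{a..b}. ennreal (1 / s) \<partial>lborel) = ennreal (ln b - ln a)"
  using assms by (intro nn_integral_FTC_Icc) (auto intro!: derivative_eq_intros simp: divide_simps)

lemma nn_integral_powr_Icc_1_le: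
  fixes a q :: real
  assumes "0 < a" "a \<le> 1" "1 < q"
  shows "(\<integral>\<^sup>+s\<in>{a..1}. ennreal (1 / s powr q) \<partial>lborel) \<le> ennreal (a powr (1 - q) / (q - 1))"
proof -
  have "(\<integral>\<^sup>+s\<in>{a..1}. ennreal (1 / s powr q) \<partial>lborel) =
    ennreal (- (1 powr (1 - q) / (q - 1)) - - (a powr (1 - q) / (q - 1)))"
  proof (rule nn_integral_FTC_Icc)
    fix s :: real assume "s \<in> {a..1}"
    then have "((\<lambda>s. - (s powr (1 - q) / (q - 1))) has_real_derivative - ((1 - q) * s powr (1 - q - 1) / (q - 1))) (at s)"
      using assms by (auto intro!: derivative_eq_intros)
    moreover have "- ((1 - q) * s powr (1 - q - 1) / (q - 1)) = 1 / s powr q"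
    proof -
      have "1 - q = - (q - 1)" by simp
      then have "- ((1 - q) * s powr (- q) / (q - 1)) = s powr (- q)"
        using assms(3) by (metis (no_types, lifting) divide_minus_left mult_minus_left minus_minus nonzero_mult_div_cancel_left diff_gt_0_iff_gt less_irrefl)
      then show ?thesis by (simp add: powr_minus divide_inverse)
    qed
    ultimately show "((\<lambda>s. - (s powr (1 - q) / (q - 1))) has_real_derivative 1 / s powr q) (at s)" by simp
  qed (use assms in auto)
  also have "\<dots> \<le> ennreal (a powr (1 - q) / (q - 1))"
    using assms by (intro ennreal_leI) simp
  finally show ?thesis .
qed

lemma nn_integral_powr_Ioo_0:
  fixes t q :: real
  assumes "0 \<le> t" "q < 1"
  shows "(\<integral>\<^sup>+s\<in>{0<..<t}. ennreal (1 / s powr q) \<partial>lborel) \<le> ennreal (t powr (1 - q) / (1 - q))"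
proof -
  have "((\<lambda>s. s powr (- q)) has_integral t powr (- q + 1) / (- q + 1)) {0..t}"
    using assms by (intro has_integral_powr_from_0) auto
  then have "((\<lambda>s. if s \<in> {0..t} then s powr (- q) else 0) has_integral t powr (- q + 1) / (- q + 1)) UNIV"
    by (subst has_integral_restrict_UNIV)
  then have "(\<integral>\<^sup>+s. ennreal (if s \<in> {0..t} then s powr (- q) else 0) \<partial>lborel) = ennreal (t powr (- q + 1) / (- q + 1))"
    by (intro nn_integral_has_integral_lborel) auto
  moreover have "(\<integral>\<^sup>+s\<in>{0<..<t}. ennreal (1 / s powr q) \<partial>lborel)
     \<le> (\<integral>\<^sup>+s. ennreal (if s \<in> {0..t} then s powr (- q) else 0) \<partial>lborel)"
    by (intro nn_integral_mono) (auto simp: powr_minus divide_inverse split: split_indicator)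
  ultimately show ?thesis by (simp add: add.commute)
qed

lemma G_antimono:
  assumes "\<beta> \<le> \<nu>" "0 \<le> d" "d \<le> d'"
  shows "G \<nu> \<beta> d' \<le> G \<nu> \<beta> d"
  using assms unfolding G_def by (auto intro!: ennreal_leI powr_mono2' simp: frac_le)

text \<open>
  On the time interval from \<open>d powr \<beta> / 2\<close> to \<open>d powr \<beta>\<close> the kernel is at least a constant times
  \<open>d powr (-\<nu>)\<close>, and the interval has length of order \<open>d powr \<beta>\<close>.
\<close>

lemma G_le_radial_potential_power:
  assumes \<nu>\<beta>: "0 < \<beta>" "\<beta> < \<nu>" and \<Phi>: "\<And>s. 0 \<le> s \<Longrightarrow> 0 < \<Phi> s" "antimono_on {0..} \<Phi>"
    and d: "0 < d" "d powr \<beta> \<le> t"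
  shows "ennreal (\<Phi> (2 powr (1/\<beta>)) / 2) * G \<nu> \<beta> d \<le> radial_potential \<Phi> \<nu> \<beta> t d"
proof -
  let ?a = "d powr \<beta>" and ?c = "\<Phi> (2 powr (1/\<beta>)) / d powr \<nu>"
  have a: "0 < ?a" using d by simp
  have c: "0 \<le> ?c" using \<Phi>(1)[of "2 powr (1/\<beta>)"] by simp
  have "ennreal (\<Phi> (2 powr (1/\<beta>)) / 2) * G \<nu> \<beta> d = ennreal (\<Phi> (2 powr (1/\<beta>)) / 2 * d powr (\<beta> - \<nu>))"
    using d \<nu>\<beta> \<Phi>(1)[of "2 powr (1/\<beta>)"] by (subst ennreal_mult) (simp_all add: G_def)
  also have "\<Phi> (2 powr (1/\<beta>)) / 2 * d powr (\<beta> - \<nu>) = ?c * (?a - ?a / 2)"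
    by (simp add: powr_diff)
  also have "ennreal \<dots> = (\<integral>\<^sup>+s\<in>{?a/2<..<?a}. ennreal ?c \<partial>lborel)"
    using a c by (subst nn_integral_const_Ioo) simp_all
  also have "\<dots> \<le> radial_potential \<Phi> \<nu> \<beta> t d"
    unfolding radial_potential_def
  proof (rule nn_integral_mono)
    fix s :: real
    have "?c \<le> \<Phi> (d / s powr (1/\<beta>)) / s powr (\<nu>/\<beta>)" if s: "?a/2 < s" "s < ?a"
    proof (rule frac_le)
      have "0 < s" using s(1) a by linarith
      have "s powr (\<nu>/\<beta>) \<le> ?a powr (\<nu>/\<beta>)"
        using s \<open>0 < s\<close> \<nu>\<beta> by (intro powr_mono2) auto
      then show "s powr (\<nu>/\<beta>) \<le> d powr \<nu>" using \<nu>\<beta> by (simp add: powr_powr)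
      show "0 < s powr (\<nu>/\<beta>)" using \<open>0 < s\<close> by simp
      have "(?a / 2) powr (1/\<beta>) \<le> s powr (1/\<beta>)"
        using s a \<nu>\<beta> by (intro powr_mono2) auto
      then have "d \<le> 2 powr (1/\<beta>) * s powr (1/\<beta>)"
        using \<nu>\<beta> d by (simp add: powr_divide powr_powr field_simps)
      then have "d / s powr (1/\<beta>) \<le> 2 powr (1/\<beta>)"
        using \<open>0 < s\<close> by (simp add: divide_le_eq)
      then show "\<Phi> (2 powr (1/\<beta>)) \<le> \<Phi> (d / s powr (1/\<beta>))"
        using \<Phi>(2) d by (auto simp: monotone_on_def)
      show "0 \<le> \<Phi> (d / s powr (1/\<beta>))" 
        using less_imp_le[OF \<Phi>(1)[of "d / s powr (1/\<beta>)"]] d by simp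
    qed
    then show "ennreal ?c * indicator {?a/2<..<?a} s
      \<le> ennreal (\<Phi> (d / s powr (1/\<beta>)) / s powr (\<nu>/\<beta>)) * indicator {0<..<t} s"
      using a d by (auto split: split_indicator intro!: ennreal_leI)
  qed
  finally show ?thesis .
qed

text \<open>
  For times above \<open>d powr \<beta>\<close> the kernel is at least \<open>\<Phi> 1 / s\<close>. Integration up to \<open>t/2\<close> gives
  \<open>ln (t/2) - \<beta> * ln d\<close>; the assumption on \<open>d\<close> bounds \<open>ln (t/2)\<close> from below by half of
  \<open>\<beta> * ln d\<close>, which leaves half of the logarithm independently of \<open>t\<close>.
\<close>

lemma G_le_radial_potential_log:
  assumes \<beta>: "0 < \<beta>" and \<Phi>: "\<And>s. 0 \<le> s \<Longrightarrow> 0 < \<Phi> s" "antimono_on {0..} \<Phi>"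
    and t: "0 < t" "t < 1" and d: "0 < d" "d powr (\<beta>/2) \<le> t/2"
  shows "ennreal (\<Phi> 1 * \<beta> / 2) * G \<beta> \<beta> d \<le> radial_potential \<Phi> \<beta> \<beta> t d"
proof -
  let ?a = "d powr \<beta>"
  have aa: "?a = d powr (\<beta>/2) * d powr (\<beta>/2)" using d by (simp flip: powr_add)
  have a: "0 < ?a" using d by simp
  have le1: "d powr (\<beta>/2) * d powr (\<beta>/2) \<le> d powr (\<beta>/2) * 1"
    using d t by (intro mult_left_mono) auto
  then have at: "?a \<le> t/2" using aa d(2) by linarith
  have "ln (d powr (\<beta>/2)) \<le> ln (t/2)" using d t by (intro ln_mono) auto
  then have lnt: "\<beta> / 2 * ln d \<le> ln (t/2)" using d by (simp add: ln_powr)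
  have "ennreal (\<Phi> 1 * \<beta> / 2) * G \<beta> \<beta> d = ennreal (\<Phi> 1) * ennreal (\<beta> / 2 * ln (1/d))"
    using d \<beta> \<Phi>(1)[of 1] by (simp add: G_def ennreal_mult' mult.assoc flip: ennreal_mult')
  also have "\<dots> \<le> ennreal (\<Phi> 1) * ennreal (ln (t/2) - ln ?a)"
  proof (intro mult_left_mono ennreal_leI)
    show "\<beta> / 2 * ln (1/d) \<le> ln (t/2) - ln ?a"
      using lnt d by (simp add: ln_powr ln_div)
  qed simp
  also have "\<dots> = ennreal (\<Phi> 1) * (\<integral>\<^sup>+s\<in>{?a..t/2}. ennreal (1 / s) \<partial>lborel)"
    using nn_integral_inverse_Icc[OF a at] by simp
  also have "\<dots> = (\<integral>\<^sup>+s. ennreal (\<Phi> 1) * (ennreal (1 / s) * indicator {?a..t/2} s) \<partial>lborel)"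
    by (rule nn_integral_cmult[symmetric]) measurable
  also have "\<dots> \<le> radial_potential \<Phi> \<beta> \<beta> t d"
    unfolding radial_potential_def
  proof (rule nn_integral_mono)
    fix s :: real
    have "\<Phi> 1 * (1 / s) \<le> \<Phi> (d / s powr (1/\<beta>)) / s powr (\<beta>/\<beta>)" if s: "?a \<le> s"
    proof -
      have "0 < s" using s a by linarith
      have "?a powr (1/\<beta>) \<le> s powr (1/\<beta>)" using s a \<beta> by (intro powr_mono2) auto
      then have "d / s powr (1/\<beta>) \<le> 1" using \<beta> d \<open>0 < s\<close> by (simp add: powr_powr)
      then have "\<Phi> 1 \<le> \<Phi> (d / s powr (1/\<beta>))"
        using \<Phi>(2) d by (auto simp: monotone_on_def)
      then show ?thesis using \<open>0 < s\<close> \<beta> by (simp add: divide_right_mono)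
    qed
    moreover have "0 \<le> \<Phi> 1" using \<Phi>(1)[of 1] by simp
    moreover have "ennreal (\<Phi> 1) * ennreal (1 / s) = ennreal (\<Phi> 1 * (1 / s))"
      using \<open>0 \<le> \<Phi> 1\<close> by (rule ennreal_mult'[symmetric])
    moreover have "0 < s \<and> s < t" if "?a \<le> s" "s \<le> t/2" using that a t by linarith
    ultimately show "ennreal (\<Phi> 1) * (ennreal (1 / s) * indicator {?a..t/2} s)
      \<le> ennreal (\<Phi> (d / s powr (1/\<beta>)) / s powr (\<beta>/\<beta>)) * indicator {0<..<t} s"
      by (auto split: split_indicator intro!: ennreal_leI)
  qed
  finally show ?thesis .
qed

text \<open>
  On the diagonal the potential has to be infinite as \<open>G 0\<close> is. By antimonotonicity it dominates
  the values at all positive distances, and these are unbounded.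
\<close>

lemma infinite_if_above_G_near_0:
  assumes "\<beta> \<le> \<nu>" "0 < c" and L: "\<And>d. 0 < d \<Longrightarrow> d < \<rho> \<Longrightarrow> ennreal c * G \<nu> \<beta> d \<le> L" and "0 < \<rho>"
  shows "L = \<infinity>"
proof (rule ccontr)
  assume "L \<noteq> \<infinity>"
  then obtain l where l: "L = ennreal l" "0 \<le> l" by (cases L) auto
  define g where "g d = (if \<beta> < \<nu> then d powr (\<beta> - \<nu>) else ln (1 / d))" for d :: real
  have "filterlim g at_top (at_right 0)"
  proof (cases "\<beta> < \<nu>")
    case True
    have "filterlim (\<lambda>d::real. d powr (\<beta> - \<nu>)) at_top (at_right 0)"
      using True by real_asymp
    with True show ?thesis unfolding g_def by simp
  next
    case False
    have "filterlim (\<lambda>d::real. ln (1 / d)) at_top (at_right 0)" by real_asymp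
    with False show ?thesis unfolding g_def by simp
  qed
  then have "eventually (\<lambda>d. l / c + 1 \<le> g d) (at_right 0)"
    by (simp add: filterlim_at_top)
  then obtain d where d: "0 < d" "d < \<rho>" "l / c + 1 \<le> g d"
    using \<open>0 < \<rho>\<close> by (rule eventually_at_right_0D)
  have "ennreal c * G \<nu> \<beta> d = ennreal (c * g d)"
    using d \<open>0 < c\<close> by (simp add: G_def g_def ennreal_mult')
  then have "c * g d \<le> l" using L[OF d(1,2)] l by simp
  moreover have "l + c \<le> c * g d" using d(3) \<open>0 < c\<close> by (simp add: field_simps)
  ultimately show False using \<open>0 < c\<close> by simp
qed

text \<open>
  The constant does not depend on \<open>t\<close>, only the radius of validity does; the limit \<open>t \<rightarrow> 0\<close> in the
  definition of the Kato class needs exactly this.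
\<close>

lemma G_le_radial_potential:
  assumes \<nu>\<beta>: "0 < \<beta>" "\<beta> \<le> \<nu>" and \<Phi>: "\<And>s. 0 \<le> s \<Longrightarrow> 0 < \<Phi> s" "antimono_on {0..} \<Phi>"
  obtains c where "0 < c"
    "\<And>t. 0 < t \<Longrightarrow> t < 1 \<Longrightarrow> \<exists>\<rho>>0. \<forall>d. 0 \<le> d \<and> d < \<rho> \<longrightarrow> ennreal c * G \<nu> \<beta> d \<le> radial_potential \<Phi> \<nu> \<beta> t d"
proof -
  define c where "c = (if \<beta> < \<nu> then \<Phi> (2 powr (1/\<beta>)) / 2 else \<Phi> 1 * \<beta> / 2)"
  have c: "0 < c" unfolding c_def using \<Phi>(1)[of 1] \<Phi>(1)[of "2 powr (1/\<beta>)"] \<nu>\<beta> by simp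
  have "\<exists>\<rho>>0. \<forall>d. 0 \<le> d \<and> d < \<rho> \<longrightarrow> ennreal c * G \<nu> \<beta> d \<le> radial_potential \<Phi> \<nu> \<beta> t d"
    if t: "0 < t" "t < 1" for t
  proof -
    define \<rho> where "\<rho> = (if \<beta> < \<nu> then t powr (1/\<beta>) else (t/2) powr (2/\<beta>))"
    have \<rho>: "0 < \<rho>" using t unfolding \<rho>_def by simp
    have pos: "ennreal c * G \<nu> \<beta> d \<le> radial_potential \<Phi> \<nu> \<beta> t d" if d: "0 < d" "d < \<rho>" for d
    proof (cases "\<beta> < \<nu>")
      case True
      have "d powr \<beta> \<le> \<rho> powr \<beta>" using d \<nu>\<beta> by (intro powr_mono2) auto
      then have "d powr \<beta> \<le> t" using True \<nu>\<beta> t unfolding \<rho>_def by (simp add: powr_powr)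
      from G_le_radial_potential_power[OF \<nu>\<beta>(1) True \<Phi> d(1) this] True show ?thesis
        by (simp add: c_def)
    next
      case False
      then have eq: "\<nu> = \<beta>" using \<nu>\<beta> by simp
      have "d powr (\<beta>/2) \<le> \<rho> powr (\<beta>/2)" using d \<nu>\<beta> by (intro powr_mono2) auto
      then have "d powr (\<beta>/2) \<le> t/2" using False \<nu>\<beta> t unfolding \<rho>_def by (simp add: powr_powr)
      from G_le_radial_potential_log[OF \<nu>\<beta>(1) \<Phi> t d(1) this] False show ?thesis
        by (simp add: c_def eq)
    qed
    have "radial_potential \<Phi> \<nu> \<beta> t 0 = \<infinity>"
    proof (rule infinite_if_above_G_near_0[OF \<nu>\<beta>(2) c _ \<rho>])
      fix d assume "0 < d" "d < \<rho>"
      with pos[of d] radial_potential_antimono[OF \<Phi>(2), of 0 d \<nu> \<beta> t]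
      show "ennreal c * G \<nu> \<beta> d \<le> radial_potential \<Phi> \<nu> \<beta> t 0" by (auto intro: order_trans)
    qed
    then have "ennreal c * G \<nu> \<beta> 0 \<le> radial_potential \<Phi> \<nu> \<beta> t 0" by simp
    with pos \<rho> show ?thesis by (intro exI[of _ \<rho>]) (metis less_eq_real_def)
  qed
  with c show ?thesis by (rule that)
qed

section \<open>Time integrals of radial kernels: bounds from above\<close>

text \<open>
  Volume function and upper heat kernel profile, separated from the metric measure space.
\<close>

locale radial_profile =
  fixes \<nu> \<beta> :: real and V \<Phi> :: "real \<Rightarrow> real"
  assumes \<nu>: "0 < \<nu>" and \<beta>: "0 < \<beta>"
    and V_mono: "mono_on {0<..} V" and V_pos: "\<And>r. 0 < r \<Longrightarrow> 0 < V r"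
    and V_growth: "mono_on {0<..} (\<lambda>r. V r / r powr \<nu>) \<or> bounded ((\<lambda>r. V r / r powr \<nu>) ` {0<..})"
    and \<Phi>_pos: "\<And>s. 0 \<le> s \<Longrightarrow> 0 < \<Phi> s" and \<Phi>_antimono: "antimono_on {0..} \<Phi>"
    and \<Phi>_integral: "(\<integral>\<^sup>+t\<in>{1..}. ennreal (max (V t) (t powr \<nu>) * \<Phi> t / t) \<partial>lborel) < \<infinity>"
begin

definition W :: "real \<Rightarrow> real" where
  "W u = max (V u) (u powr \<nu>)"

text \<open>
  The integrability assumption on the profile says that a measure on \<open>[1, \<infinity>[\<close> is finite. As the
  volume function is unrestricted at nonpositive arguments, the density is frozen to the left of 1.
\<close>

definition profile_measure :: "real measure" where
  "profile_measure = density lborel (\<lambda>u. ennreal (W (max 1 u) * \<Phi> (max 1 u) / max 1 u))"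

definition tail :: "real \<Rightarrow> ennreal" where
  "tail A = emeasure profile_measure {A..}"

lemma \<Phi>_le: "0 \<le> u \<Longrightarrow> u \<le> v \<Longrightarrow> \<Phi> v \<le> \<Phi> u"
  using \<Phi>_antimono by (auto simp: monotone_on_def)

lemma \<Phi>_nonneg: "0 \<le> u \<Longrightarrow> 0 \<le> \<Phi> u"
  using \<Phi>_pos[of u] by simp

lemma W_pos: "0 < u \<Longrightarrow> 0 < W u"
  unfolding W_def by (simp add: less_max_iff_disj)

lemma W_mono: "0 < u \<Longrightarrow> u \<le> v \<Longrightarrow> W u \<le> W v"
  using \<nu> mono_onD[OF V_mono, of u v] unfolding W_def by (intro max.mono powr_mono2) auto

lemma measurable_profile_density:
  "(\<lambda>u. ennreal (W (max 1 u) * \<Phi> (max 1 u) / max 1 u)) \<in> borel_measurable borel"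
proof -
  have [measurable]: "(\<lambda>u. W (max 1 u)) \<in> borel_measurable borel"
    by (intro borel_measurable_mono monoI W_mono) auto
  have "(\<lambda>u. \<Phi> (max 0 (max 1 u))) \<in> borel_measurable borel"
    by (rule measurable_compose[OF _ borel_measurable_antimono_on_nonneg[OF \<Phi>_antimono]]) measurable
  moreover have "max 0 (max 1 u) = max 1 u" for u :: real by simp
  ultimately have [measurable]: "(\<lambda>u. \<Phi> (max 1 u)) \<in> borel_measurable borel" by simp
  show ?thesis by measurable
qed

lemma sets_profile_measure [simp]: "sets profile_measure = sets borel"
  by (simp add: profile_measure_def)

lemma emeasure_profile_measure:
  assumes "S \<in> sets borel" "S \<subseteq> {1..}"
  shows "emeasure profile_measure S = (\<integral>\<^sup>+u\<in>S. ennreal (W u * \<Phi> u / u) \<partial>lborel)"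
proof -
  have "emeasure profile_measure S = (\<integral>\<^sup>+u\<in>S. ennreal (W (max 1 u) * \<Phi> (max 1 u) / max 1 u) \<partial>lborel)"
    unfolding profile_measure_def using assms measurable_profile_density by (subst emeasure_density) simp_all
  also have "\<dots> = (\<integral>\<^sup>+u\<in>S. ennreal (W u * \<Phi> u / u) \<partial>lborel)"
    using assms by (intro nn_integral_cong) (auto split: split_indicator simp: max_def)
  finally show ?thesis .
qed

lemma tail_antimono: "A \<le> B \<Longrightarrow> tail B \<le> tail A"
  unfolding tail_def by (intro emeasure_mono) auto

lemma tail_1_finite: "tail 1 < \<infinity>"
  unfolding tail_def using \<Phi>_integral by (subst emeasure_profile_measure) (simp_all add: W_def)

lemma tail_tendsto_0:
  assumes "0 < e"
  obtains A where "1 \<le> A" "tail A < e"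
proof -
  have "(\<lambda>n. emeasure profile_measure {real (Suc n)..}) \<longlonglongrightarrow> emeasure profile_measure (\<Inter>n. {real (Suc n)..})"
  proof (rule Lim_emeasure_decseq)
    fix n
    have "emeasure profile_measure {real (Suc n)..} \<le> tail 1" unfolding tail_def[symmetric] by (rule tail_antimono) simp
    then show "emeasure profile_measure {real (Suc n)..} \<noteq> \<infinity>" using tail_1_finite by (auto simp: top_unique)
  qed (auto simp: decseq_def)
  moreover have "(\<Inter>n. {real (Suc n)..}) = {}"
  proof (rule equals0I)
    fix x assume x: "x \<in> (\<Inter>n. {real (Suc n)..})"
    obtain n where "x < real n" using reals_Archimedean2 by blast
    moreover have "real (Suc n) \<le> x" using INT_D[OF x, of n] by simp
    ultimately show False by simp
  qed
  ultimately have "(\<lambda>n. tail (real (Suc n))) \<longlonglongrightarrow> 0" by (simp add: tail_def)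
  then have "eventually (\<lambda>n. tail (real (Suc n)) < e) sequentially"
    using assms by (rule order_tendstoD)
  then obtain n where "tail (real (Suc n)) < e" by (auto simp: eventually_sequentially)
  then show ?thesis by (intro that[of "real (Suc n)"]) auto
qed

text \<open>
  \<open>W\<close> increases and \<open>\<Phi>\<close> decreases, so on a dyadic block both are compared with the endpoint values
  that occur in the annulus estimates.
\<close>

lemma dyadic_block_le:
  assumes "1 \<le> A"
  shows "ennreal (W A * \<Phi> (2 * A) / 2) \<le> emeasure profile_measure {A..<2 * A}"
proof -
  let ?c = "W A * \<Phi> (2 * A) / (2 * A)"
  have c: "0 \<le> ?c" using assms W_pos[of A] \<Phi>_pos[of "2 * A"] by simp
  have "W A * \<Phi> (2 * A) / 2 = ?c * (2 * A - A)" using assms by simp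
  also have "ennreal \<dots> = (\<integral>\<^sup>+s\<in>{A<..<2 * A}. ennreal ?c \<partial>lborel)"
    using assms c by (subst nn_integral_const_Ioo) simp_all
  also have "\<dots> \<le> (\<integral>\<^sup>+u\<in>{A..<2 * A}. ennreal (W u * \<Phi> u / u) \<partial>lborel)"
  proof (rule nn_integral_mono)
    fix u :: real
    have "?c \<le> W u * \<Phi> u / u" if "A < u" "u < 2 * A"
      using that assms W_pos[of u] \<Phi>_nonneg[of "2 * A"] \<Phi>_nonneg[of u]
      by (intro frac_le mult_mono W_mono \<Phi>_le mult_nonneg_nonneg) auto
    then show "ennreal ?c * indicator {A<..<2 * A} u \<le> ennreal (W u * \<Phi> u / u) * indicator {A..<2 * A} u"
      by (auto split: split_indicator intro!: ennreal_leI)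
  qed
  also have "\<dots> = emeasure profile_measure {A..<2 * A}"
    using assms by (subst emeasure_profile_measure) auto
  finally show ?thesis .
qed

lemma dyadic_sum_le_tail:
  assumes "1 \<le> A"
  shows "(\<Sum>j. ennreal (W (2^j * A) * \<Phi> (2 * (2^j * A)) / 2)) \<le> tail A"
proof -
  let ?I = "\<lambda>j::nat. {2^j * A..<2 * (2^j * A)}"
  have le: "2 * (2^i * A) \<le> 2^j * A" if "i < j" for i j :: nat
  proof -
    have "(2::real)^Suc i \<le> 2^j" using that by (intro power_increasing) auto
    then show ?thesis using assms by (simp add: mult_right_mono flip: mult.assoc)
  qed
  have ge: "A \<le> 2^j * A" for j :: nat using assms by simp
  have "(\<Sum>j. ennreal (W (2^j * A) * \<Phi> (2 * (2^j * A)) / 2)) \<le> (\<Sum>j. emeasure profile_measure (?I j))"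
    using assms ge by (intro suminf_le dyadic_block_le) (auto intro: order_trans)
  also have "\<dots> = emeasure profile_measure (\<Union>j. ?I j)"
  proof (rule suminf_emeasure)
    show "disjoint_family ?I"
      unfolding disjoint_family_on_def
    proof (intro ballI impI)
      fix i j :: nat assume "i \<noteq> j"
      then show "?I i \<inter> ?I j = {}"
        using le[of i j] le[of j i] by (cases "i < j") auto
    qed
  qed auto
  also have "\<dots> \<le> tail A"
    unfolding tail_def
  proof (intro emeasure_mono UN_least subsetI)
    fix j x assume "x \<in> ?I j"
    then show "x \<in> {A..}" using ge[of j] by simp
  qed simp
  finally show ?thesis .
qed

text \<open>
  If \<open>V r / r powr \<nu>\<close> is increasing, then \<open>V r \<le> a powr \<nu> * V (r / a)\<close>; if it is bounded, \<open>V r\<close> is at most a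
  multiple of \<open>a powr \<nu> * (r / a) powr \<nu>\<close>. The maximum \<open>W\<close> covers both alternatives of the Bishop
  inequality.
\<close>

lemma V_scaling:
  obtains C where "0 < C" "\<And>r a. 0 < r \<Longrightarrow> 0 < a \<Longrightarrow> a \<le> 1 \<Longrightarrow> V r \<le> C * a powr \<nu> * W (r / a)"
  using V_growth
proof
  assume mono: "mono_on {0<..} (\<lambda>r. V r / r powr \<nu>)"
  show ?thesis
  proof (rule that[of 1])
    fix r a :: real assume ra: "0 < r" "0 < a" "a \<le> 1"
    then have "r \<le> r / a" by (simp add: field_simps)
    then have "V r / r powr \<nu> \<le> V (r / a) / (r / a) powr \<nu>"
      using ra by (intro mono_onD[OF mono]) auto
    then have "V r \<le> a powr \<nu> * V (r / a)"
      using ra by (simp add: powr_divide field_simps)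
    also have "\<dots> \<le> a powr \<nu> * W (r / a)"
      unfolding W_def by (intro mult_left_mono) auto
    finally show "V r \<le> 1 * a powr \<nu> * W (r / a)" by simp
  qed simp
next
  assume "bounded ((\<lambda>r. V r / r powr \<nu>) ` {0<..})"
  then obtain K where K: "0 < K" "\<And>r. 0 < r \<Longrightarrow> \<bar>V r / r powr \<nu>\<bar> \<le> K"
    unfolding bounded_pos by auto
  show ?thesis
  proof (rule that[of K])
    fix r a :: real assume ra: "0 < r" "0 < a" "a \<le> 1"
    have "V r \<le> K * r powr \<nu>" using K(2)[OF ra(1)] ra by (simp add: field_simps abs_le_iff)
    also have "\<dots> = K * a powr \<nu> * (r / a) powr \<nu>" using ra by (simp add: powr_divide)
    also have "\<dots> \<le> K * a powr \<nu> * W (r / a)"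
      unfolding W_def using K by (intro mult_left_mono) auto
    finally show "V r \<le> K * a powr \<nu> * W (r / a)" .
  qed (rule K)
qed

text \<open>
  The terms are bounds for the mass that a kernel at time \<open>\<sigma> powr \<beta>\<close> gives to the dyadic annuli
  around a point. Scaling by \<open>a = 2 * b * \<sigma>\<close> turns the \<open>j\<close>-th term into a bound for the dyadic block
  starting at \<open>2^j * r / (2 * \<sigma>)\<close>. The conditions on \<open>\<sigma>\<close> ensure \<open>a \<le> 1\<close> and that the blocks
  lie in \<open>[1, \<infinity>[\<close>.
\<close>

lemma annulus_sum_le_tail:
  assumes "1 \<le> b"
  obtains C where "0 < C"
    "\<And>\<sigma> r. 0 < \<sigma> \<Longrightarrow> 2 * b * \<sigma> \<le> 1 \<Longrightarrow> 2 * \<sigma> \<le> r \<Longrightarrow>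
       (\<Sum>j. ennreal (\<Phi> (2^j * r / \<sigma>) / \<sigma> powr \<nu> * V (b * (2^j * r)))) \<le> ennreal C * tail (r / (2 * \<sigma>))"
proof -
  obtain C where C: "0 < C" "\<And>r a. 0 < r \<Longrightarrow> 0 < a \<Longrightarrow> a \<le> 1 \<Longrightarrow> V r \<le> C * a powr \<nu> * W (r / a)"
    using V_scaling by blast
  show ?thesis
  proof (rule that[of "2 * C * (2 * b) powr \<nu>"])
    fix \<sigma> r :: real assume \<sigma>: "0 < \<sigma>" "2 * b * \<sigma> \<le> 1" "2 * \<sigma> \<le> r"
    define A where "A = r / (2 * \<sigma>)"
    have A: "1 \<le> A" unfolding A_def using \<sigma> by simp
    have r: "r = 2 * \<sigma> * A" unfolding A_def using \<sigma> by simp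
    let ?D = "2 * C * (2 * b) powr \<nu>"
    have "\<Phi> (2^j * r / \<sigma>) / \<sigma> powr \<nu> * V (b * (2^j * r)) \<le> ?D * (W (2^j * A) * \<Phi> (2 * (2^j * A)) / 2)" for j
    proof -
      have "V (b * (2^j * r)) \<le> C * (2 * b * \<sigma>) powr \<nu> * W (b * (2^j * r) / (2 * b * \<sigma>))"
        using \<sigma> assms by (intro C(2)) auto
      also have "b * (2^j * r) / (2 * b * \<sigma>) = 2^j * A"
        using \<sigma> assms by (simp add: r field_simps)
      finally have V: "V (b * (2^j * r)) \<le> C * (2 * b * \<sigma>) powr \<nu> * W (2^j * A)" .
      have u: "2^j * r / \<sigma> = 2 * (2^j * A)" using \<sigma> by (simp add: r)
      have "\<Phi> (2 * (2^j * A)) / \<sigma> powr \<nu> * V (b * (2^j * r))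
          \<le> \<Phi> (2 * (2^j * A)) / \<sigma> powr \<nu> * (C * (2 * b * \<sigma>) powr \<nu> * W (2^j * A))"
        using \<Phi>_nonneg[of "2 * (2^j * A)"] A by (intro mult_left_mono V) simp
      also have "\<dots> = ?D * (W (2^j * A) * \<Phi> (2 * (2^j * A)) / 2)"
        using \<sigma> assms by (simp add: powr_mult)
      finally show ?thesis unfolding u .
    qed
    then have "(\<Sum>j. ennreal (\<Phi> (2^j * r / \<sigma>) / \<sigma> powr \<nu> * V (b * (2^j * r))))
       \<le> (\<Sum>j. ennreal (?D * (W (2^j * A) * \<Phi> (2 * (2^j * A)) / 2)))"
      by (intro suminf_le ennreal_leI) auto
    also have "\<dots> = (\<Sum>j. ennreal ?D * ennreal (W (2^j * A) * \<Phi> (2 * (2^j * A)) / 2))"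
      using C(1) by (subst ennreal_mult') simp_all
    also have "\<dots> = ennreal ?D * (\<Sum>j. ennreal (W (2^j * A) * \<Phi> (2 * (2^j * A)) / 2))"
      by (rule ennreal_suminf_cmult)
    also have "\<dots> \<le> ennreal ?D * tail A"
      by (intro mult_left_mono dyadic_sum_le_tail A) simp
    finally show "(\<Sum>j. ennreal (\<Phi> (2^j * r / \<sigma>) / \<sigma> powr \<nu> * V (b * (2^j * r)))) \<le> ennreal ?D * tail (r / (2 * \<sigma>))"
      by (simp add: A_def)
  qed (use C assms in simp)
qed

text \<open>
  For \<open>u \<ge> 2\<close> a single dyadic block, the one ending at \<open>u\<close>, already gives the bound.
\<close>

lemma powr_times_profile_bounded:
  obtains K where "0 < K" "\<And>u. 0 \<le> u \<Longrightarrow> u powr \<nu> * \<Phi> u \<le> K"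
proof -
  obtain T where T: "tail 1 = ennreal T" "0 \<le> T" using tail_1_finite by (cases "tail 1") auto
  define K where "K = max (2 powr \<nu> * \<Phi> 0) (2 powr \<nu> * 2 * T)"
  have "0 < K" unfolding K_def using \<Phi>_pos[of 0] by (simp add: less_max_iff_disj)
  moreover have "u powr \<nu> * \<Phi> u \<le> K" if "0 \<le> u" for u
  proof (cases "u \<le> 2")
    case True
    have "u powr \<nu> * \<Phi> u \<le> 2 powr \<nu> * \<Phi> 0"
      using True that \<nu> \<Phi>_pos[of u] by (intro mult_mono powr_mono2 \<Phi>_le) auto
    then show ?thesis unfolding K_def by simp
  next
    case False
    have "ennreal (W (u / 2) * \<Phi> u / 2) \<le> emeasure profile_measure {u / 2..<u}"
      using dyadic_block_le[of "u / 2"] False by simp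
    also have "\<dots> \<le> tail 1" unfolding tail_def using False by (intro emeasure_mono) auto
    finally have "W (u / 2) * \<Phi> u / 2 \<le> T" using T by simp
    moreover have "(u / 2) powr \<nu> * \<Phi> u \<le> W (u / 2) * \<Phi> u"
      unfolding W_def using that \<Phi>_pos[of u] by (intro mult_right_mono) auto
    ultimately have "(u / 2) powr \<nu> * \<Phi> u \<le> 2 * T" by simp
    then have "2 powr \<nu> * ((u / 2) powr \<nu> * \<Phi> u) \<le> 2 powr \<nu> * (2 * T)"
      by (intro mult_left_mono) auto
    also have "2 powr \<nu> * ((u / 2) powr \<nu> * \<Phi> u) = u powr \<nu> * \<Phi> u"
      using that by (simp add: powr_divide)
    finally show ?thesis unfolding K_def by (simp add: mult.assoc)
  qed
  ultimately show ?thesis by (rule that)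
qed

abbreviation h :: "real \<Rightarrow> real \<Rightarrow> ennreal" where
  "h \<equiv> radial_potential \<Phi> \<nu> \<beta>"

text \<open>
  Integrating the annulus bound in time yields a bound linear in \<open>t\<close>, since the tail is bounded
  by its finite value at 1. The term for \<open>j = 0\<close> of the same series shows that the potential at
  distance \<open>r\<close> becomes small; bounding it by 1 allows replacing its \<open>p\<close>-th power by itself.
\<close>

lemma radial_potential_far:
  assumes b: "1 \<le> b" and r: "0 < r"
  obtains B t\<^sub>1 where "0 < B" "0 < t\<^sub>1"
    "\<And>t. 0 < t \<Longrightarrow> t < t\<^sub>1 \<Longrightarrow> (\<Sum>j. h t (2^j * r) * ennreal (V (b * (2^j * r)))) \<le> ennreal (B * t)"
    "\<And>t. 0 < t \<Longrightarrow> t < t\<^sub>1 \<Longrightarrow> h t r \<le> 1"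
proof -
  obtain C where C: "0 < C"
    "\<And>\<sigma> r. 0 < \<sigma> \<Longrightarrow> 2 * b * \<sigma> \<le> 1 \<Longrightarrow> 2 * \<sigma> \<le> r \<Longrightarrow>
       (\<Sum>j. ennreal (\<Phi> (2^j * r / \<sigma>) / \<sigma> powr \<nu> * V (b * (2^j * r)))) \<le> ennreal C * tail (r / (2 * \<sigma>))"
    using annulus_sum_le_tail[OF b] by blast
  obtain T where T: "tail 1 = ennreal T" "0 \<le> T" using tail_1_finite by (cases "tail 1") auto
  define B where "B = C * T + 1"
  have B: "0 < B" unfolding B_def using C(1) T by (simp add: add_nonneg_pos)
  define \<sigma>\<^sub>0 where "\<sigma>\<^sub>0 = min (1 / (2 * b)) (r / 2)"
  have \<sigma>\<^sub>0: "0 < \<sigma>\<^sub>0" unfolding \<sigma>\<^sub>0_def using b r by simp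
  have Vbr: "0 < V (b * r)" using b r by (intro V_pos) simp
  define t\<^sub>1 where "t\<^sub>1 = min (\<sigma>\<^sub>0 powr \<beta>) (V (b * r) / B)"
  have t1: "0 < t\<^sub>1" unfolding t\<^sub>1_def using \<sigma>\<^sub>0 B Vbr by simp
  have sum: "(\<Sum>j. h t (2^j * r) * ennreal (V (b * (2^j * r)))) \<le> ennreal (B * t)" if t: "0 < t" "t < t\<^sub>1" for t
  proof -
    define \<kappa> where "\<kappa> j s = \<Phi> (2^j * r / s powr (1/\<beta>)) / s powr (\<nu>/\<beta>)" for j :: nat and s
    let ?f = "\<lambda>j s. ennreal (\<kappa> j s * V (b * (2^j * r))) * indicator {0<..<t} s"
    have V0: "0 \<le> V (b * (2^j * r))" for j using V_pos[of "b * (2^j * r)"] b r by simp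
    have [measurable]: "\<kappa> j \<in> borel_measurable borel" for j
      unfolding \<kappa>_def using r by (intro measurable_radial_kernel[OF \<Phi>_antimono]) simp
    have "h t (2^j * r) * ennreal (V (b * (2^j * r))) = (\<integral>\<^sup>+s. ?f j s \<partial>lborel)" for j
      unfolding radial_potential_def \<kappa>_def[symmetric]
      by (subst nn_integral_multc[symmetric], measurable)
        (intro nn_integral_cong, subst ennreal_mult''[OF V0], simp add: mult_ac)
    then have "(\<Sum>j. h t (2^j * r) * ennreal (V (b * (2^j * r)))) = (\<Sum>j. \<integral>\<^sup>+s. ?f j s \<partial>lborel)" by simp
    also have "\<dots> = (\<integral>\<^sup>+s. (\<Sum>j. ?f j s) \<partial>lborel)"
      by (rule nn_integral_suminf[symmetric]) simp
    also have "\<dots> \<le> (\<integral>\<^sup>+s\<in>{0<..<t}. ennreal B \<partial>lborel)"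
    proof (rule nn_integral_mono)
      fix s :: real
      show "(\<Sum>j. ?f j s) \<le> ennreal B * indicator {0<..<t} s"
      proof (cases "s \<in> {0<..<t}")
        case True
        define \<sigma> where "\<sigma> = s powr (1/\<beta>)"
        have "s < \<sigma>\<^sub>0 powr \<beta>" using True t unfolding t\<^sub>1_def by simp
        then have "\<sigma> \<le> (\<sigma>\<^sub>0 powr \<beta>) powr (1/\<beta>)"
          unfolding \<sigma>_def using True \<beta> by (intro powr_mono2) auto
        then have "\<sigma> \<le> \<sigma>\<^sub>0" using \<sigma>\<^sub>0 \<beta> by (simp add: powr_powr)
        then have \<sigma>: "0 < \<sigma>" "2 * b * \<sigma> \<le> 1" "2 * \<sigma> \<le> r"
          using True b unfolding \<sigma>_def \<sigma>\<^sub>0_def by (auto simp: field_simps)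
        have "(\<Sum>j. ?f j s) = (\<Sum>j. ennreal (\<Phi> (2^j * r / \<sigma>) / \<sigma> powr \<nu> * V (b * (2^j * r))))"
          using True \<beta> by (simp add: \<sigma>_def \<kappa>_def powr_powr)
        also have "\<dots> \<le> ennreal C * tail (r / (2 * \<sigma>))" by (rule C(2)[OF \<sigma>])
        also have "\<dots> \<le> ennreal C * tail 1"
          using \<sigma> by (intro mult_left_mono tail_antimono) auto
        also have "\<dots> = ennreal (C * T)" using T C(1) by (simp add: ennreal_mult')
        also have "\<dots> \<le> ennreal B" unfolding B_def by (intro ennreal_leI) simp
        finally show ?thesis using True by simp
      qed simp
    qed
    also have "\<dots> = ennreal (B * t)" using B t by (subst nn_integral_const_Ioo) simp_all
    finally show ?thesis .
  qed
  have "h t r \<le> 1" if t: "0 < t" "t < t\<^sub>1" for t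
  proof -
    let ?g = "\<lambda>j. h t (2^j * r) * ennreal (V (b * (2^j * r)))"
    have "h t r * ennreal (V (b * r)) = sum ?g {0}" by simp
    also have "\<dots> \<le> (\<Sum>j. ?g j)" by (rule sum_le_suminf) auto
    also have "\<dots> \<le> ennreal (B * t)" by (rule sum[OF t])
    also have "\<dots> \<le> ennreal (V (b * r))"
      using t B unfolding t\<^sub>1_def by (intro ennreal_leI) (simp add: field_simps)
    finally have le: "h t r * ennreal (V (b * r)) \<le> 1 * ennreal (V (b * r))" by simp
    show ?thesis
      using mult_right_mono[OF le, of "ennreal (1 / V (b * r))"] Vbr
      by (simp add: mult.assoc flip: ennreal_mult')
  qed
  from that[OF B t1 sum this] show ?thesis .
qed

text \<open>
  Before time \<open>d powr \<beta>\<close> the boundedness of \<open>u powr \<nu> * \<Phi> u\<close> bounds the kernel by a multiple of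
  \<open>d powr (-\<nu>)\<close>; afterwards \<open>\<Phi>\<close> is bounded by \<open>\<Phi> 0\<close>. The first part contributes a multiple of
  \<open>d powr (\<beta> - \<nu>)\<close>, which for \<open>\<nu> = \<beta>\<close> is a constant and is absorbed in the logarithm because
  \<open>d \<le> 1/2\<close>.
\<close>

lemma radial_potential_le_G:
  assumes \<beta>\<nu>: "\<beta> \<le> \<nu>"
  obtains C where "0 < C"
    "\<And>t d. 0 < t \<Longrightarrow> t \<le> 1 \<Longrightarrow> 0 \<le> d \<Longrightarrow> d \<le> 1/2 \<Longrightarrow> h t d \<le> ennreal C * G \<nu> \<beta> d"
proof -
  obtain K where K: "0 < K" "\<And>u. 0 \<le> u \<Longrightarrow> u powr \<nu> * \<Phi> u \<le> K"
    using powr_times_profile_bounded by blast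
  have \<Phi>0: "0 < \<Phi> 0" by (rule \<Phi>_pos) simp
  have split: "h t d \<le> ennreal (K * d powr (\<beta> - \<nu>)) + ennreal (\<Phi> 0) * (\<integral>\<^sup>+s\<in>{d powr \<beta>..1}. ennreal (1 / s powr (\<nu>/\<beta>)) \<partial>lborel)"
    if t: "t \<le> 1" and d: "0 < d" for t d
  proof -
    let ?a = "d powr \<beta>"
    have a: "0 < ?a" using d by simp
    have "h t d \<le> (\<integral>\<^sup>+s. ennreal (K / d powr \<nu>) * indicator {0<..<?a} s
        + ennreal (\<Phi> 0) * (ennreal (1 / s powr (\<nu>/\<beta>)) * indicator {?a..1} s) \<partial>lborel)"
      unfolding radial_potential_def
    proof (rule nn_integral_mono)
      fix s :: real
      show "ennreal (\<Phi> (d / s powr (1/\<beta>)) / s powr (\<nu>/\<beta>)) * indicator {0<..<t} s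
        \<le> ennreal (K / d powr \<nu>) * indicator {0<..<?a} s
          + ennreal (\<Phi> 0) * (ennreal (1 / s powr (\<nu>/\<beta>)) * indicator {?a..1} s)"
      proof (cases "0 < s \<and> s < t")
        case s: True
        let ?u = "d / s powr (1/\<beta>)"
        show ?thesis
        proof (cases "s < ?a")
          case True
          have "?u powr \<nu> = d powr \<nu> / s powr (\<nu>/\<beta>)"
            using s d by (simp add: powr_divide powr_powr)
          then have "\<Phi> ?u / s powr (\<nu>/\<beta>) = ?u powr \<nu> * \<Phi> ?u / d powr \<nu>" using d by simp
          also have "\<dots> \<le> K / d powr \<nu>"
            using d by (intro divide_right_mono K) auto
          finally have "ennreal (\<Phi> ?u / s powr (\<nu>/\<beta>)) \<le> ennreal (K / d powr \<nu>)" by (rule ennreal_leI)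
          then show ?thesis using s True by simp
        next
          case False
          have "\<Phi> ?u / s powr (\<nu>/\<beta>) \<le> \<Phi> 0 * (1 / s powr (\<nu>/\<beta>))"
            using d \<Phi>_le[of 0 ?u] by (simp add: divide_right_mono)
          then have "ennreal (\<Phi> ?u / s powr (\<nu>/\<beta>)) \<le> ennreal (\<Phi> 0 * (1 / s powr (\<nu>/\<beta>)))"
            by (rule ennreal_leI)
          also have "\<dots> = ennreal (\<Phi> 0) * ennreal (1 / s powr (\<nu>/\<beta>))"
            using \<Phi>0 by (intro ennreal_mult') simp
          finally show ?thesis using s t False by simp
        qed
      qed (auto simp: indicator_def)
    qed
    also have "\<dots> = (\<integral>\<^sup>+s\<in>{0<..<?a}. ennreal (K / d powr \<nu>) \<partial>lborel)
       + (\<integral>\<^sup>+s. ennreal (\<Phi> 0) * (ennreal (1 / s powr (\<nu>/\<beta>)) * indicator {?a..1} s) \<partial>lborel)"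
      by (rule nn_integral_add) measurable
    also have "(\<integral>\<^sup>+s\<in>{0<..<?a}. ennreal (K / d powr \<nu>) \<partial>lborel) = ennreal (K * d powr (\<beta> - \<nu>))"
      using K(1) a by (subst nn_integral_const_Ioo) (simp_all add: powr_diff)
    also have "(\<integral>\<^sup>+s. ennreal (\<Phi> 0) * (ennreal (1 / s powr (\<nu>/\<beta>)) * indicator {?a..1} s) \<partial>lborel)
       = ennreal (\<Phi> 0) * (\<integral>\<^sup>+s\<in>{?a..1}. ennreal (1 / s powr (\<nu>/\<beta>)) \<partial>lborel)"
      by (rule nn_integral_cmult) measurable
    finally show ?thesis .
  qed
  define C where "C = (if \<beta> < \<nu> then K + \<Phi> 0 / (\<nu>/\<beta> - 1) else K / ln 2 + \<Phi> 0 * \<beta>)"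
  have C: "0 < C" unfolding C_def using K \<Phi>0 \<beta> by (auto intro!: add_pos_pos divide_pos_pos)
  have "h t d \<le> ennreal C * G \<nu> \<beta> d" if td: "0 < t" "t \<le> 1" "0 \<le> d" "d \<le> 1/2" for t d
  proof (cases "d = 0")
    case True
    then show ?thesis using C by (simp add: G_def ennreal_mult_top)
  next
    case False
    then have d: "0 < d" using td by simp
    have a: "0 < d powr \<beta>" "d powr \<beta> \<le> 1"
      using d td \<beta> by (auto intro: powr_le1)
    note split[OF td(2) d]
    also have "ennreal (K * d powr (\<beta> - \<nu>)) + ennreal (\<Phi> 0) * (\<integral>\<^sup>+s\<in>{d powr \<beta>..1}. ennreal (1 / s powr (\<nu>/\<beta>)) \<partial>lborel)
      \<le> ennreal C * G \<nu> \<beta> d"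
    proof (cases "\<beta> < \<nu>")
      case True
      let ?q = "\<nu>/\<beta>"
      have q: "1 < ?q" using True \<beta> by simp
      have "\<beta> * (1 - ?q) = \<beta> - \<nu>" using \<beta> by (simp add: field_simps)
      then have pw: "(d powr \<beta>) powr (1 - ?q) = d powr (\<beta> - \<nu>)" by (simp add: powr_powr)
      have "ennreal (\<Phi> 0) * (\<integral>\<^sup>+s\<in>{d powr \<beta>..1}. ennreal (1 / s powr ?q) \<partial>lborel)
        \<le> ennreal (\<Phi> 0) * ennreal (d powr (\<beta> - \<nu>) / (?q - 1))"
        using nn_integral_powr_Icc_1_le[OF a q] by (intro mult_left_mono) (simp_all add: pw)
      also have "\<dots> = ennreal (\<Phi> 0 * (d powr (\<beta> - \<nu>) / (?q - 1)))"
        using \<Phi>0 by (intro ennreal_mult'[symmetric]) simp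
      finally have "ennreal (K * d powr (\<beta> - \<nu>)) + ennreal (\<Phi> 0) * (\<integral>\<^sup>+s\<in>{d powr \<beta>..1}. ennreal (1 / s powr ?q) \<partial>lborel)
        \<le> ennreal (K * d powr (\<beta> - \<nu>)) + ennreal (\<Phi> 0 * (d powr (\<beta> - \<nu>) / (?q - 1)))"
        by (rule add_left_mono)
      also have "\<dots> = ennreal (K * d powr (\<beta> - \<nu>) + \<Phi> 0 * (d powr (\<beta> - \<nu>) / (?q - 1)))"
        using K \<Phi>0 q by (intro ennreal_plus[symmetric]) auto
      also have "K * d powr (\<beta> - \<nu>) + \<Phi> 0 * (d powr (\<beta> - \<nu>) / (?q - 1)) = C * d powr (\<beta> - \<nu>)"
        using True by (simp add: C_def algebra_simps)
      also have "ennreal (C * d powr (\<beta> - \<nu>)) = ennreal C * G \<nu> \<beta> d"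
        using True d C by (simp add: G_def ennreal_mult')
      finally show ?thesis .
    next
      case eq: False
      then have nb: "\<nu> = \<beta>" using \<beta>\<nu> by simp
      have l2: "ln 2 \<le> ln (1/d)" using d td by (intro ln_mono) (auto simp: field_simps)
      have "(\<integral>\<^sup>+s\<in>{d powr \<beta>..1}. ennreal (1 / s powr (\<nu>/\<beta>)) \<partial>lborel)
        = (\<integral>\<^sup>+s\<in>{d powr \<beta>..1}. ennreal (1 / s) \<partial>lborel)"
      proof (rule nn_integral_cong)
        fix s :: real
        have "s powr (\<nu>/\<beta>) = s" if "d powr \<beta> \<le> s"
          using less_le_trans[OF a(1) that] \<beta> nb by simp
        then show "ennreal (1 / s powr (\<nu>/\<beta>)) * indicator {d powr \<beta>..1} s = ennreal (1 / s) * indicator {d powr \<beta>..1} s"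
          by (auto split: split_indicator)
      qed
      also have "\<dots> = ennreal (ln 1 - ln (d powr \<beta>))"
        by (rule nn_integral_inverse_Icc[OF a])
      also have "ln 1 - ln (d powr \<beta>) = \<beta> * ln (1/d)" using d by (simp add: ln_powr ln_div)
      finally have "ennreal (\<Phi> 0) * (\<integral>\<^sup>+s\<in>{d powr \<beta>..1}. ennreal (1 / s powr (\<nu>/\<beta>)) \<partial>lborel)
        = ennreal (\<Phi> 0 * (\<beta> * ln (1/d)))"
        using \<Phi>0 by (simp add: ennreal_mult')
      then have "ennreal (K * d powr (\<beta> - \<nu>)) + ennreal (\<Phi> 0) * (\<integral>\<^sup>+s\<in>{d powr \<beta>..1}. ennreal (1 / s powr (\<nu>/\<beta>)) \<partial>lborel)
        = ennreal K + ennreal (\<Phi> 0 * (\<beta> * ln (1/d)))"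
        using nb d by simp
      also have "\<dots> = ennreal (K + \<Phi> 0 * (\<beta> * ln (1/d)))"
      proof (rule ennreal_plus[symmetric])
        show "0 \<le> \<Phi> 0 * (\<beta> * ln (1/d))"
          using \<Phi>0 \<beta> order_trans[OF _ l2, of 0] by (intro mult_nonneg_nonneg) auto
      qed (use K in simp)
      also have "\<dots> \<le> ennreal (C * ln (1/d))"
      proof (rule ennreal_leI)
        have "K * ln 2 \<le> K * ln (1/d)" using K l2 by (intro mult_left_mono) auto
        then have "K \<le> K / ln 2 * ln (1/d)" using ln_gt_zero[of "2::real"] by (simp add: field_simps)
        then show "K + \<Phi> 0 * (\<beta> * ln (1/d)) \<le> C * ln (1/d)"
          unfolding C_def using eq by (simp add: distrib_right)
      qed
      also have "\<dots> = ennreal C * G \<nu> \<beta> d"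
        using eq d C by (simp add: G_def ennreal_mult')
      finally show ?thesis .
    qed
    finally show ?thesis .
  qed
  with C show ?thesis by (rule that)
qed

lemma radial_potential_le_subcritical:
  assumes "\<nu> < \<beta>" "0 < t" "0 \<le> d"
  shows "h t d \<le> ennreal (\<Phi> 0 / (1 - \<nu>/\<beta>) * t powr (1 - \<nu>/\<beta>))"
proof -
  have \<Phi>0: "0 < \<Phi> 0" by (rule \<Phi>_pos) simp
  have "h t d \<le> (\<integral>\<^sup>+s. ennreal (\<Phi> 0) * (ennreal (1 / s powr (\<nu>/\<beta>)) * indicator {0<..<t} s) \<partial>lborel)"
    unfolding radial_potential_def
  proof (rule nn_integral_mono)
    fix s :: real
    have "\<Phi> (d / s powr (1/\<beta>)) / s powr (\<nu>/\<beta>) \<le> \<Phi> 0 * (1 / s powr (\<nu>/\<beta>))"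
      using assms \<Phi>_le[of 0 "d / s powr (1/\<beta>)"] by (simp add: divide_right_mono)
    then have "ennreal (\<Phi> (d / s powr (1/\<beta>)) / s powr (\<nu>/\<beta>)) \<le> ennreal (\<Phi> 0) * ennreal (1 / s powr (\<nu>/\<beta>))"
      using \<Phi>0 by (subst ennreal_mult'[symmetric]) (auto intro: ennreal_leI)
    then show "ennreal (\<Phi> (d / s powr (1/\<beta>)) / s powr (\<nu>/\<beta>)) * indicator {0<..<t} s
      \<le> ennreal (\<Phi> 0) * (ennreal (1 / s powr (\<nu>/\<beta>)) * indicator {0<..<t} s)"
      by (auto split: split_indicator)
  qed
  also have "\<dots> = ennreal (\<Phi> 0) * (\<integral>\<^sup>+s\<in>{0<..<t}. ennreal (1 / s powr (\<nu>/\<beta>)) \<partial>lborel)"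
    by (rule nn_integral_cmult) measurable
  also have "\<dots> \<le> ennreal (\<Phi> 0) * ennreal (t powr (1 - \<nu>/\<beta>) / (1 - \<nu>/\<beta>))"
    using assms \<beta> by (intro mult_left_mono nn_integral_powr_Ioo_0) auto
  also have "\<dots> = ennreal (\<Phi> 0 / (1 - \<nu>/\<beta>) * t powr (1 - \<nu>/\<beta>))"
    using \<Phi>0 by (subst ennreal_mult'[symmetric]) (auto simp: mult_ac)
  finally show ?thesis .
qed

end

section \<open>Dyadic annuli and packings of balls\<close>

text \<open>
  The term for the annulus that contains \<open>d\<close> suffices.
\<close>

lemma le_dyadic_sum:
  fixes f :: "real \<Rightarrow> ennreal"
  assumes f: "\<And>u v. 0 \<le> u \<Longrightarrow> u \<le> v \<Longrightarrow> f v \<le> f u" and r: "0 < r" "r \<le> d"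
  shows "f d \<le> (\<Sum>j. f (2^j * r) * indicator {..<2 * (2^j * r)} d)"
proof -
  define n where "n = (LEAST n. d < 2 * (2^n * r))"
  obtain n\<^sub>0 where "d / r < 2^n\<^sub>0" using real_arch_pow[of 2 "d / r"] by auto
  then have "d < 2^n\<^sub>0 * r" using r by (simp add: pos_divide_less_eq)
  moreover have "0 < 2^n\<^sub>0 * r" using r by simp
  ultimately have "d < 2 * (2^n\<^sub>0 * r)" by linarith
  then have n: "d < 2 * (2^n * r)" unfolding n_def by (rule LeastI)
  have le: "2^n * r \<le> d"
  proof (cases n)
    case 0
    then show ?thesis using r by simp
  next
    case (Suc i)
    then have "\<not> d < 2 * (2^i * r)" unfolding n_def by (intro not_less_Least) simp
    with Suc show ?thesis by (simp add: mult.assoc)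
  qed
  let ?g = "\<lambda>j. f (2^j * r) * indicator {..<2 * (2^j * r)} d"
  have "f d \<le> f (2^n * r)" using le r by (intro f) simp_all
  also have "\<dots> = sum ?g {n}" using n by simp
  also have "\<dots> \<le> (\<Sum>j. ?g j)" by (rule sum_le_suminf) auto
  finally show ?thesis .
qed

lemma nn_integral_ball_series:
  fixes \<mu> :: "'a::metric_space measure"
  assumes [measurable_cong]: "sets \<mu> = sets borel" and [measurable]: "F \<in> borel_measurable borel"
  shows "(\<integral>\<^sup>+y. F y * indicator (ball x r) y + (\<Sum>j. a j * indicator (ball x (\<rho> j)) y) \<partial>\<mu>)
    = (\<integral>\<^sup>+y\<in>ball x r. F y \<partial>\<mu>) + (\<Sum>j. a j * emeasure \<mu> (ball x (\<rho> j)))"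
proof -
  have [measurable]: "ball x s \<in> sets borel" for s by simp
  have "(\<integral>\<^sup>+y. (\<Sum>j. a j * indicator (ball x (\<rho> j)) y) \<partial>\<mu>) = (\<Sum>j. \<integral>\<^sup>+y. a j * indicator (ball x (\<rho> j)) y \<partial>\<mu>)"
    by (rule nn_integral_suminf) measurable
  also have "\<dots> = (\<Sum>j. a j * emeasure \<mu> (ball x (\<rho> j)))"
    using assms(1) by (intro suminf_cong nn_integral_cmult_indicator) simp
  finally have series: "(\<integral>\<^sup>+y. (\<Sum>j. a j * indicator (ball x (\<rho> j)) y) \<partial>\<mu>) = (\<Sum>j. a j * emeasure \<mu> (ball x (\<rho> j)))" .
  show ?thesis
    unfolding series[symmetric] by (rule nn_integral_add) measurable
qed

text \<open>
  A maximal subset of the ball with mutual distances at least \<open>r\<close> is an \<open>r\<close>-net, and its cardinality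
  is bounded since the balls of radius \<open>r/2\<close> around its points are disjoint and each has
  \<open>m\<close>-measure at least \<open>c\<close>.
\<close>

lemma ball_measure_le_packing:
  fixes m \<mu> :: "'a::metric_space measure"
  assumes [simp]: "sets m = sets borel" "sets \<mu> = sets borel" and r: "0 < r" and c: "0 < c" and v: "0 \<le> v"
    and lower: "\<And>y. ennreal c \<le> emeasure m (ball y (r/2))"
    and upper: "emeasure m (ball x (R + r/2)) \<le> ennreal v"
    and Q: "\<And>y. emeasure \<mu> (ball y r) \<le> Q"
  shows "emeasure \<mu> (ball x R) \<le> ennreal (v / c) * Q"
proof -
  define separated where
    "separated S \<longleftrightarrow> finite S \<and> S \<subseteq> ball x R \<and> (\<forall>s\<in>S. \<forall>t\<in>S. s \<noteq> t \<longrightarrow> r \<le> dist s t)" for S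
  have card: "real (card S) \<le> v / c" if S: "separated S" for S
  proof -
    have "ennreal (real (card S) * c) = (\<Sum>s\<in>S. ennreal c)"
      using c by (simp add: ennreal_mult' ennreal_of_nat_eq_real_of_nat)
    also have "\<dots> \<le> (\<Sum>s\<in>S. emeasure m (ball s (r/2)))" by (intro sum_mono lower)
    also have "\<dots> = emeasure m (\<Union>s\<in>S. ball s (r/2))"
    proof (rule sum_emeasure)
      show "disjoint_family_on (\<lambda>s. ball s (r/2)) S"
        unfolding disjoint_family_on_def
      proof (intro ballI impI)
        fix s t assume "s \<in> S" "t \<in> S" "s \<noteq> t"
        then have "r \<le> dist s t" using S unfolding separated_def by simp
        then show "ball s (r/2) \<inter> ball t (r/2) = {}" by (intro disjoint_ballI) simp
      qed
    qed (use S in \<open>auto simp: separated_def\<close>)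
    also have "\<dots> \<le> emeasure m (ball x (R + r/2))"
    proof (intro emeasure_mono UN_least subsetI)
      fix s y assume "s \<in> S" "y \<in> ball s (r/2)"
      moreover have "dist x s < R" using S \<open>s \<in> S\<close> unfolding separated_def by auto
      ultimately show "y \<in> ball x (R + r/2)" using dist_triangle[of x y s] by simp
    qed simp
    also have "\<dots> \<le> ennreal v" by (rule upper)
    finally have "real (card S) * c \<le> v" using v by simp
    then show ?thesis using c by (simp add: pos_le_divide_eq)
  qed
  have "separated {}" by (simp add: separated_def)
  moreover have "\<forall>S. separated S \<longrightarrow> card S < Suc (nat \<lfloor>v / c\<rfloor>)"
    using card by (auto simp: less_Suc_eq_le le_nat_floor)
  ultimately obtain S where S: "separated S" "\<And>S'. separated S' \<Longrightarrow> card S' \<le> card S"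
    using ex_has_greatest_nat[of separated "{}" card] by blast
  have "ball x R \<subseteq> (\<Union>s\<in>S. ball s r)"
  proof (rule ccontr)
    assume "\<not> ball x R \<subseteq> (\<Union>s\<in>S. ball s r)"
    then obtain y where y: "y \<in> ball x R" "\<And>s. s \<in> S \<Longrightarrow> r \<le> dist s y" by (auto simp: subset_iff not_less)
    have "y \<notin> S" using y(2)[of y] r by auto
    have "separated (insert y S)"
      using S(1) y unfolding separated_def by (auto simp: dist_commute)
    from S(2)[OF this] \<open>y \<notin> S\<close> S(1) show False by (simp add: separated_def)
  qed
  then have "emeasure \<mu> (ball x R) \<le> emeasure \<mu> (\<Union>s\<in>S. ball s r)"
    by (intro emeasure_mono) (simp_all add: borel_open open_UN)
  also have "\<dots> \<le> (\<Sum>s\<in>S. emeasure \<mu> (ball s r))"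
    using S(1) by (intro emeasure_subadditive_finite) (auto simp: separated_def)
  also have "\<dots> \<le> (\<Sum>s\<in>S. Q)" by (intro sum_mono Q)
  also have "\<dots> = ennreal (real (card S)) * Q" by (simp add: ennreal_of_nat_eq_real_of_nat)
  also have "\<dots> \<le> ennreal (v / c) * Q"
    by (intro mult_right_mono ennreal_leI card S(1)) simp
  finally show ?thesis .
qed

section \<open>Uniform ball growth under heat kernel bounds\<close>

text \<open>
  The analytic content of the assumptions on the process: two-sided kernel bounds for times below
  \<open>T\<close>, the volume bound, and the lower bound \<open>c\<^sub>0\<close> for the mass of the kernel. The bound \<open>T \<le> 1\<close> keeps
  times in the range where logarithms have the right sign.
\<close>

locale heat_kernel_bounds = radial_profile \<nu> \<beta> V \<Phi> for \<nu> \<beta> V \<Phi> +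
  fixes m :: "'a::{metric_space, second_countable_topology} measure"
    and k :: "real \<Rightarrow> 'a \<Rightarrow> 'a \<Rightarrow> real" and \<Psi> :: "real \<Rightarrow> real" and T c\<^sub>0 :: real
  assumes lc: "locally_compact_space (euclidean :: 'a topology)"
    and sets_m [measurable_cong, simp]: "sets m = sets borel"
    and volume_upper: "\<And>x r. 0 < r \<Longrightarrow> emeasure m (ball x r) \<le> ennreal (V r)"
    and \<Psi>_pos: "\<And>s. 0 \<le> s \<Longrightarrow> 0 < \<Psi> s" and \<Psi>_antimono: "antimono_on {0..} \<Psi>"
    and T: "0 < T" "T \<le> 1"
    and kernel_lower: "\<And>t x y. 0 < t \<Longrightarrow> t < T \<Longrightarrow> \<Psi> (dist x y / t powr (1/\<beta>)) / t powr (\<nu>/\<beta>) \<le> k t x y"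
    and kernel_upper: "\<And>t x y. 0 < t \<Longrightarrow> t < T \<Longrightarrow> k t x y \<le> \<Phi> (dist x y / t powr (1/\<beta>)) / t powr (\<nu>/\<beta>)"
    and c\<^sub>0: "0 < c\<^sub>0"
    and mass_lower: "\<And>t x. 0 < t \<Longrightarrow> t < T \<Longrightarrow> ennreal c\<^sub>0 \<le> (\<integral>\<^sup>+y. ennreal (k t x y) \<partial>m)"
begin

text \<open>
  Choose a time so small that at most \<open>c\<^sub>0 / 2\<close> of the mass lies outside the ball. The remaining
  \<open>c\<^sub>0 / 2\<close> lies inside, where the density is at most \<open>\<Phi> 0 / \<sigma> powr \<nu>\<close>.
\<close>

lemma volume_lower:
  assumes r: "0 < r"
  obtains c where "0 < c" "\<And>x. ennreal c \<le> emeasure m (ball x r)"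
proof -
  obtain C where C: "0 < C"
    "\<And>\<sigma> r. 0 < \<sigma> \<Longrightarrow> 2 * 2 * \<sigma> \<le> 1 \<Longrightarrow> 2 * \<sigma> \<le> r \<Longrightarrow>
       (\<Sum>j. ennreal (\<Phi> (2^j * r / \<sigma>) / \<sigma> powr \<nu> * V (2 * (2^j * r)))) \<le> ennreal C * tail (r / (2 * \<sigma>))"
    using annulus_sum_le_tail[of 2] by auto
  obtain A where A: "1 \<le> A" "tail A < ennreal (c\<^sub>0 / 2 / C)"
    using tail_tendsto_0[of "ennreal (c\<^sub>0 / 2 / C)"] C c\<^sub>0 by auto
  \<comment> \<open>The three bounds make the annulus estimate applicable, push the tail beyond \<open>A\<close>, and keep the time \<open>\<sigma> powr \<beta>\<close> below \<open>T\<close>.\<close>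
  define \<sigma> where "\<sigma> = min (min (1/4) (r / (2 * A))) ((T/2) powr (1/\<beta>))"
  have \<sigma>: "0 < \<sigma>" using r A T unfolding \<sigma>_def by simp
  have \<sigma>4: "2 * 2 * \<sigma> \<le> 1" unfolding \<sigma>_def by simp
  have "\<sigma> \<le> r / (2 * A)" unfolding \<sigma>_def by simp
  then have \<sigma>A: "2 * \<sigma> * A \<le> r" using A by (simp add: field_simps)
  moreover have "2 * \<sigma> * 1 \<le> 2 * \<sigma> * A" using A \<sigma> by (intro mult_left_mono) auto
  ultimately have \<sigma>r: "2 * \<sigma> \<le> r" by simp
  have "A \<le> r / (2 * \<sigma>)" using \<sigma>A \<sigma> by (simp add: field_simps)
  then have "ennreal C * tail (r / (2 * \<sigma>)) \<le> ennreal C * tail A" by (intro mult_left_mono tail_antimono) auto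
  also have "\<dots> \<le> ennreal C * ennreal (c\<^sub>0 / 2 / C)" using A(2) by (intro mult_left_mono) auto
  also have "\<dots> = ennreal (c\<^sub>0 / 2)" using C(1) by (simp flip: ennreal_mult')
  finally have far: "(\<Sum>j. ennreal (\<Phi> (2^j * r / \<sigma>) / \<sigma> powr \<nu> * V (2 * (2^j * r)))) \<le> ennreal (c\<^sub>0 / 2)"
    using C(2)[OF \<sigma> \<sigma>4 \<sigma>r] by (rule order_trans[rotated])
  define t where "t = \<sigma> powr \<beta>"
  have "t \<le> ((T/2) powr (1/\<beta>)) powr \<beta>"
    unfolding t_def using \<sigma> \<beta> by (intro powr_mono2) (auto simp: \<sigma>_def)
  then have t: "0 < t" "t < T" using T \<beta> \<sigma> by (simp_all add: powr_powr t_def)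
  have pw: "t powr (1/\<beta>) = \<sigma>" "t powr (\<nu>/\<beta>) = \<sigma> powr \<nu>"
    unfolding t_def using \<sigma> \<beta> by (simp_all add: powr_powr)
  let ?f = "\<lambda>d. ennreal (\<Phi> (d / \<sigma>) / \<sigma> powr \<nu>)"
  have f: "?f v \<le> ?f u" if "0 \<le> u" "u \<le> v" for u v
    using that \<sigma> by (intro ennreal_leI divide_right_mono \<Phi>_le) (auto intro: divide_right_mono)
  have "ennreal (\<sigma> powr \<nu> / \<Phi> 0 * (c\<^sub>0 / 2)) \<le> emeasure m (ball x r)" for x
  proof -
    have "ennreal c\<^sub>0 \<le> (\<integral>\<^sup>+y. ennreal (k t x y) \<partial>m)" by (rule mass_lower[OF t])
    also have "\<dots> \<le> (\<integral>\<^sup>+y. ?f 0 * indicator (ball x r) y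
        + (\<Sum>j. ?f (2^j * r) * indicator (ball x (2 * (2^j * r))) y) \<partial>m)"
    proof (rule nn_integral_mono)
      fix y
      have ky: "ennreal (k t x y) \<le> ?f (dist x y)"
        using kernel_upper[OF t, of x y] by (intro ennreal_leI) (simp add: pw)
      show "ennreal (k t x y) \<le> ?f 0 * indicator (ball x r) y
        + (\<Sum>j. ?f (2^j * r) * indicator (ball x (2 * (2^j * r))) y)"
      proof (cases "dist x y < r")
        case True
        have "ennreal (k t x y) \<le> ?f 0" using ky f[of 0 "dist x y"] by (rule order_trans) auto
        with True show ?thesis by (simp add: add_increasing2)
      next
        case False
        note ky
        also have "?f (dist x y) \<le> (\<Sum>j. ?f (2^j * r) * indicator {..<2 * (2^j * r)} (dist x y))"
          using False by (intro le_dyadic_sum[where f = ?f] f r) auto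
        also have "\<dots> = (\<Sum>j. ?f (2^j * r) * indicator (ball x (2 * (2^j * r))) y)"
          by (simp add: indicator_def)
        finally show ?thesis by (simp add: add_increasing)
      qed
    qed
    also have "\<dots> = (\<integral>\<^sup>+y\<in>ball x r. ?f 0 \<partial>m) + (\<Sum>j. ?f (2^j * r) * emeasure m (ball x (2 * (2^j * r))))"
      by (rule nn_integral_ball_series) simp_all
    also have "(\<integral>\<^sup>+y\<in>ball x r. ?f 0 \<partial>m) = ?f 0 * emeasure m (ball x r)"
      by (rule nn_integral_cmult_indicator) simp
    also have "?f 0 * emeasure m (ball x r) + (\<Sum>j. ?f (2^j * r) * emeasure m (ball x (2 * (2^j * r))))
      \<le> ?f 0 * emeasure m (ball x r) + (\<Sum>j. ennreal (\<Phi> (2^j * r / \<sigma>) / \<sigma> powr \<nu> * V (2 * (2^j * r))))"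
    proof (rule add_left_mono, rule suminf_le)
      fix j
      have "?f (2^j * r) * emeasure m (ball x (2 * (2^j * r))) \<le> ?f (2^j * r) * ennreal (V (2 * (2^j * r)))"
        using r by (intro mult_left_mono volume_upper) simp_all
      also have "\<dots> = ennreal (\<Phi> (2^j * r / \<sigma>) / \<sigma> powr \<nu> * V (2 * (2^j * r)))"
        using r \<sigma> \<Phi>_nonneg[of "2^j * r / \<sigma>"] by (intro ennreal_mult'[symmetric]) simp
      finally show "?f (2^j * r) * emeasure m (ball x (2 * (2^j * r)))
        \<le> ennreal (\<Phi> (2^j * r / \<sigma>) / \<sigma> powr \<nu> * V (2 * (2^j * r)))" .
    qed simp_all
    also have "\<dots> \<le> ?f 0 * emeasure m (ball x r) + ennreal (c\<^sub>0 / 2)"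
      using far by (rule add_left_mono)
    finally have le: "ennreal c\<^sub>0 \<le> ?f 0 * emeasure m (ball x r) + ennreal (c\<^sub>0 / 2)" .
    show ?thesis
    proof (cases "emeasure m (ball x r)")
      case (real v)
      have \<Phi>0: "0 < \<Phi> 0" by (rule \<Phi>_pos) simp
      have "?f 0 * emeasure m (ball x r) + ennreal (c\<^sub>0 / 2) = ennreal (\<Phi> 0 / \<sigma> powr \<nu> * v + c\<^sub>0 / 2)"
        unfolding real(2) using real(1) \<Phi>0 c\<^sub>0
        by (subst ennreal_plus) (simp_all add: ennreal_mult'[symmetric])
      then have "c\<^sub>0 \<le> \<Phi> 0 / \<sigma> powr \<nu> * v + c\<^sub>0 / 2"
        using le real \<Phi>0 c\<^sub>0 by (simp del: ennreal_plus)
      then have "c\<^sub>0 / 2 \<le> \<Phi> 0 / \<sigma> powr \<nu> * v" by linarith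
      then have "\<sigma> powr \<nu> / \<Phi> 0 * (c\<^sub>0 / 2) \<le> \<sigma> powr \<nu> / \<Phi> 0 * (\<Phi> 0 / \<sigma> powr \<nu> * v)"
        using \<Phi>0 by (intro mult_left_mono) auto
      also have "\<dots> = v" using \<Phi>0 \<sigma> by simp
      finally show ?thesis using real by (simp add: ennreal_leI)
    qed simp
  qed
  moreover have "0 < \<sigma> powr \<nu> / \<Phi> 0 * (c\<^sub>0 / 2)" using \<sigma> \<Phi>_pos[of 0] c\<^sub>0 by simp
  ultimately show ?thesis by (intro that)
qed

text \<open>
  Packing with the volume bounds of \<open>m\<close>; since \<open>R + r/2 \<le> 2 * R\<close>, the volume of a ball of radius
  \<open>2 * R\<close> bounds the number of balls in the covering.
\<close>

lemma ball_growth: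
  fixes \<mu> :: "'a measure"
  assumes \<mu>: "sets \<mu> = sets borel" and r: "0 < r" and Q: "\<And>x. emeasure \<mu> (ball x r) \<le> ennreal Q"
  obtains A where "0 < A" "\<And>x R. r \<le> R \<Longrightarrow> emeasure \<mu> (ball x R) \<le> ennreal (A * V (2 * R))"
proof -
  obtain c where c: "0 < c" "\<And>x. ennreal c \<le> emeasure m (ball x (r/2))"
    using volume_lower[of "r/2"] r by auto
  \<comment> \<open>The maximum only serves to make \<open>A\<close> positive.\<close>
  define A where "A = max Q 1 / c"
  have "emeasure \<mu> (ball x R) \<le> ennreal (A * V (2 * R))" if "r \<le> R" for x R
  proof -
    have V: "0 \<le> V (2 * R)" using V_pos[of "2 * R"] r that by simp
    have "emeasure m (ball x (R + r/2)) \<le> emeasure m (ball x (2 * R))"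
      using that r by (intro emeasure_mono subset_ball) auto
    also have "\<dots> \<le> ennreal (V (2 * R))" using that r by (intro volume_upper) simp
    finally have "emeasure m (ball x (R + r/2)) \<le> ennreal (V (2 * R))" .
    moreover have "emeasure \<mu> (ball y r) \<le> ennreal (max Q 1)" for y
      using Q[of y] by (rule order_trans) (simp add: ennreal_leI)
    ultimately have "emeasure \<mu> (ball x R) \<le> ennreal (V (2 * R) / c) * ennreal (max Q 1)"
      by (intro ball_measure_le_packing[OF sets_m \<mu> r c(1) V c(2)])
    also have "\<dots> = ennreal (A * V (2 * R))"
      using V c by (subst ennreal_mult'[symmetric]) (simp_all add: A_def mult.commute)
    finally show ?thesis .
  qed
  moreover have "0 < A" unfolding A_def using c by simp
  ultimately show ?thesis by (intro that)
qed

lemma uniformly_finite_on_balls_if_one_radius: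
  fixes \<mu> :: "'a measure"
  assumes "sets \<mu> = sets borel" "0 < r" "\<And>x. emeasure \<mu> (ball x r) \<le> ennreal Q"
  shows "uniformly_finite_on_balls \<mu>"
proof -
  obtain A where A: "\<And>x R. r \<le> R \<Longrightarrow> emeasure \<mu> (ball x R) \<le> ennreal (A * V (2 * R))"
    using ball_growth[OF assms] by blast
  show ?thesis
    unfolding uniformly_finite_on_balls_def
  proof (intro allI impI)
    fix R :: real
    have "emeasure \<mu> (ball x R) \<le> ennreal (A * V (2 * max r R))" for x
    proof -
      have "emeasure \<mu> (ball x R) \<le> emeasure \<mu> (ball x (max r R))"
        using assms(1) by (intro emeasure_mono subset_ball) auto
      also have "\<dots> \<le> ennreal (A * V (2 * max r R))" by (rule A) simp
      finally show ?thesis .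
    qed
    then have "(SUP x. emeasure \<mu> (ball x R)) \<le> ennreal (A * V (2 * max r R))" by (rule SUP_least)
    then show "(SUP x. emeasure \<mu> (ball x R)) < \<infinity>" by (rule order.strict_trans1) simp
  qed
qed

lemma kernel_potential_le:
  assumes "t \<le> T"
  shows "kernel_potential k t x y \<le> h t (dist x y)"
  unfolding kernel_potential_def radial_potential_def
  using assms by (intro nn_integral_mono) (auto split: split_indicator intro!: ennreal_leI kernel_upper)

lemma le_kernel_potential:
  assumes "t \<le> T"
  shows "radial_potential \<Psi> \<nu> \<beta> t (dist x y) \<le> kernel_potential k t x y"
  unfolding kernel_potential_def radial_potential_def
  using assms by (intro nn_integral_mono) (auto split: split_indicator intro!: ennreal_leI kernel_lower)

text \<open>
  Outside the ball the potential is at most 1, so that its \<open>p\<close>-th power is at most itself and the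
  estimate of the far part applies; inside, any measurable bound \<open>F\<close> may be used. The upper bound
  for the integrand is a series of indicators of balls, which makes it measurable.
\<close>

lemma potential_integral_le:
  fixes \<mu> :: "'a measure"
  assumes \<mu> [measurable_cong, simp]: "sets \<mu> = sets borel" and r: "0 < r"
    and Q: "\<And>x. emeasure \<mu> (ball x r) \<le> ennreal Q" and p: "1 \<le> p"
  obtains B t\<^sub>1 where "0 < B" "0 < t\<^sub>1" "t\<^sub>1 \<le> T"
    "\<And>t x F. 0 < t \<Longrightarrow> t < t\<^sub>1 \<Longrightarrow> F \<in> borel_measurable borel
       \<Longrightarrow> (\<And>y. y \<in> ball x r \<Longrightarrow> ennpowr (h t (dist x y)) p \<le> F y)
       \<Longrightarrow> (\<integral>\<^sup>+y. ennpowr (kernel_potential k t x y) p \<partial>\<mu>) \<le> (\<integral>\<^sup>+y\<in>ball x r. F y \<partial>\<mu>) + ennreal (B * t)"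
proof -
  obtain A where A: "0 < A" "\<And>x R. r \<le> R \<Longrightarrow> emeasure \<mu> (ball x R) \<le> ennreal (A * V (2 * R))"
    using ball_growth[OF \<mu> r Q] by blast
  obtain B t\<^sub>1 where B: "0 < B" "0 < t\<^sub>1"
    "\<And>t. 0 < t \<Longrightarrow> t < t\<^sub>1 \<Longrightarrow> (\<Sum>j. h t (2^j * r) * ennreal (V (4 * (2^j * r)))) \<le> ennreal (B * t)"
    "\<And>t. 0 < t \<Longrightarrow> t < t\<^sub>1 \<Longrightarrow> h t r \<le> 1"
    using radial_potential_far[of 4 r] r by auto
  show ?thesis
  proof (rule that[of "A * B" "min t\<^sub>1 T"])
    fix t :: real and x :: 'a and F
    assume t: "0 < t" "t < min t\<^sub>1 T" and F [measurable]: "F \<in> borel_measurable borel"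
      and near: "\<And>y. y \<in> ball x r \<Longrightarrow> ennpowr (h t (dist x y)) p \<le> F y"
    have h: "h t v \<le> h t u" if "0 \<le> u" "u \<le> v" for u v
      by (rule radial_potential_antimono[OF \<Phi>_antimono that])
    have "(\<integral>\<^sup>+y. ennpowr (kernel_potential k t x y) p \<partial>\<mu>)
      \<le> (\<integral>\<^sup>+y. F y * indicator (ball x r) y + (\<Sum>j. h t (2^j * r) * indicator (ball x (2 * (2^j * r))) y) \<partial>\<mu>)"
    proof (rule nn_integral_mono)
      fix y
      have le: "ennpowr (kernel_potential k t x y) p \<le> ennpowr (h t (dist x y)) p"
        using t p by (intro ennpowr_mono kernel_potential_le) auto
      show "ennpowr (kernel_potential k t x y) p
        \<le> F y * indicator (ball x r) y + (\<Sum>j. h t (2^j * r) * indicator (ball x (2 * (2^j * r))) y)"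
      proof (cases "dist x y < r")
        case True
        then have "y \<in> ball x r" by simp
        from le near[OF this] have "ennpowr (kernel_potential k t x y) p \<le> F y" by (rule order_trans)
        with True show ?thesis by (simp add: add_increasing2)
      next
        case False
        note le
        also have "ennpowr (h t (dist x y)) p \<le> h t (dist x y)"
        proof (rule ennpowr_le_self[OF _ p])
          have "h t (dist x y) \<le> h t r" using False r by (intro h) auto
          also have "\<dots> \<le> 1" using t by (intro B(4)) auto
          finally show "h t (dist x y) \<le> 1" .
        qed
        also have "\<dots> \<le> (\<Sum>j. h t (2^j * r) * indicator {..<2 * (2^j * r)} (dist x y))"
          using False by (intro le_dyadic_sum h r) auto
        also have "\<dots> = (\<Sum>j. h t (2^j * r) * indicator (ball x (2 * (2^j * r))) y)"
          by (simp add: indicator_def)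
        finally show ?thesis by (simp add: add_increasing)
      qed
    qed
    also have "\<dots> = (\<integral>\<^sup>+y\<in>ball x r. F y \<partial>\<mu>) + (\<Sum>j. h t (2^j * r) * emeasure \<mu> (ball x (2 * (2^j * r))))"
      by (rule nn_integral_ball_series[OF \<mu> F])
    finally have le: "(\<integral>\<^sup>+y. ennpowr (kernel_potential k t x y) p \<partial>\<mu>)
      \<le> (\<integral>\<^sup>+y\<in>ball x r. F y \<partial>\<mu>) + (\<Sum>j. h t (2^j * r) * emeasure \<mu> (ball x (2 * (2^j * r))))" .
    have "(\<Sum>j. h t (2^j * r) * emeasure \<mu> (ball x (2 * (2^j * r))))
      \<le> (\<Sum>j. ennreal A * (h t (2^j * r) * ennreal (V (4 * (2^j * r)))))"
    proof (rule suminf_le)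
      fix j :: nat
      have "(1::real) \<le> 2^j" by simp
      then have "(1::real) \<le> 2 * 2^j" by linarith
      then have "1 * r \<le> 2 * 2^j * r" using r by (intro mult_right_mono) simp_all
      then have "r \<le> 2 * (2^j * r)" by (simp only: mult_1_left mult.assoc)
      then have "emeasure \<mu> (ball x (2 * (2^j * r))) \<le> ennreal (A * V (2 * (2 * (2^j * r))))" by (rule A(2))
      also have "\<dots> = ennreal A * ennreal (V (4 * (2^j * r)))" using A(1) by (simp add: ennreal_mult')
      finally have "h t (2^j * r) * emeasure \<mu> (ball x (2 * (2^j * r)))
          \<le> h t (2^j * r) * (ennreal A * ennreal (V (4 * (2^j * r))))" by (rule mult_left_mono) simp
      then show "h t (2^j * r) * emeasure \<mu> (ball x (2 * (2^j * r)))
          \<le> ennreal A * (h t (2^j * r) * ennreal (V (4 * (2^j * r))))" by (simp add: mult_ac)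
    qed simp_all
    also have "\<dots> = ennreal A * (\<Sum>j. h t (2^j * r) * ennreal (V (4 * (2^j * r))))"
      by (rule ennreal_suminf_cmult)
    also have "\<dots> \<le> ennreal A * ennreal (B * t)" using t by (intro mult_left_mono B(3)) auto
    also have "\<dots> = ennreal (A * B * t)" using A(1) by (simp add: mult.assoc ennreal_mult')
    finally show "(\<integral>\<^sup>+y. ennpowr (kernel_potential k t x y) p \<partial>\<mu>)
      \<le> (\<integral>\<^sup>+y\<in>ball x r. F y \<partial>\<mu>) + ennreal (A * B * t)"
      by (intro order_trans[OF le] add_left_mono)
  qed (use A B T in simp_all)
qed

end

section \<open>Elementary relations between the classes\<close>

text \<open>
  Finiteness of these suprema for some argument, or convergence to 0 at 0, defines the classes; the
  first one is relevant for \<open>\<nu> \<ge> \<beta>\<close>.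
\<close>

abbreviation sup_G_ball :: "real \<Rightarrow> real \<Rightarrow> real \<Rightarrow> 'a::metric_space measure \<Rightarrow> real \<Rightarrow> ennreal" where
  "sup_G_ball \<nu> \<beta> p \<mu> r \<equiv> (SUP x. \<integral>\<^sup>+y\<in>ball x r. ennpowr (G \<nu> \<beta> (dist x y)) p \<partial>\<mu>)"

abbreviation sup_potential :: "(real \<Rightarrow> 'a \<Rightarrow> 'a \<Rightarrow> real) \<Rightarrow> real \<Rightarrow> 'a measure \<Rightarrow> real \<Rightarrow> ennreal" where
  "sup_potential k p \<mu> t \<equiv> (SUP x. \<integral>\<^sup>+y. ennpowr (kernel_potential k t x y) p \<partial>\<mu>)"

lemma sets_if_D_class: "\<mu> \<in> D_class \<nu> \<beta> p \<Longrightarrow> sets \<mu> = sets borel"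
  by (simp add: D_class_def)

lemma measurable_G_dist [measurable]:
  "(\<lambda>y::'a::{metric_space, second_countable_topology}. G \<nu> \<beta> (dist x y)) \<in> borel_measurable borel"
  unfolding G_def by measurable

lemma K_class_eq_D_class: "\<nu> < \<beta> \<Longrightarrow> K_class \<nu> \<beta> p = D_class \<nu> \<beta> p"
  by (simp add: K_class_def D_class_def)

lemma K_class_subset_D_class: "K_class \<nu> \<beta> p \<subseteq> D_class \<nu> \<beta> p"
proof (cases "\<nu> < \<beta>")
  case True
  then show ?thesis by (simp add: K_class_eq_D_class)
next
  case False
  show ?thesis
  proof
    fix \<mu> :: "'a measure" assume \<mu>: "\<mu> \<in> K_class \<nu> \<beta> p"
    let ?S = "sup_G_ball \<nu> \<beta> p \<mu>"
    have "(?S \<longlongrightarrow> 0) (at_right 0)" using \<mu> False by (simp add: K_class_def)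
    then have "eventually (\<lambda>r. ?S r < \<infinity>) (at_right 0)" by (rule order_tendstoD(2)) simp
    then obtain r where "0 < r" "r < 1" "?S r < \<infinity>"
      by (rule eventually_at_right_0D[of _ 1]) simp_all
    then show "\<mu> \<in> D_class \<nu> \<beta> p"
      using \<mu> False by (auto simp: K_class_def D_class_def)
  qed
qed

lemma S_K_subset_S_D: "S_K k p \<subseteq> S_D k p"
proof
  fix \<mu> assume \<mu>: "\<mu> \<in> S_K k p"
  let ?S = "sup_potential k p \<mu>"
  have "(?S \<longlongrightarrow> 0) (at_right 0)" using \<mu> by (simp add: S_K_def)
  then have "eventually (\<lambda>t. ?S t < \<infinity>) (at_right 0)" by (rule order_tendstoD(2)) simp
  then obtain t where "0 < t" "t < 1" "?S t < \<infinity>"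
    by (rule eventually_at_right_0D[of _ 1]) simp_all
  then show "\<mu> \<in> S_D k p" using \<mu> by (auto simp: S_K_def S_D_def)
qed

lemma SUP_potential_mono:
  assumes "t \<le> t'" "0 < p"
  shows "sup_potential k p \<mu> t
    \<le> sup_potential k p \<mu> t'"
proof (rule SUP_mono')
  fix x
  have "kernel_potential k t x y \<le> kernel_potential k t' x y" for y
    unfolding kernel_potential_def using assms by (intro nn_integral_mono) (auto split: split_indicator)
  then show "(\<integral>\<^sup>+y. ennpowr (kernel_potential k t x y) p \<partial>\<mu>) \<le> (\<integral>\<^sup>+y. ennpowr (kernel_potential k t' x y) p \<partial>\<mu>)"
    using assms by (intro nn_integral_mono ennpowr_mono)
qed

lemma SUP_G_ball_mono:
  assumes "r \<le> r'"
  shows "sup_G_ball \<nu> \<beta> p \<mu> r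
    \<le> sup_G_ball \<nu> \<beta> p \<mu> r'"
  using assms by (intro SUP_mono' nn_integral_mono) (auto split: split_indicator)

text \<open>
  For \<open>\<nu> \<ge> \<beta>\<close> the integrand on the ball is at least the value at the radius \<open>r\<close>, which is positive; for \<open>\<nu> = \<beta>\<close>
  this is why \<open>r < 1\<close> is demanded in the definition.
\<close>

lemma D_class_ball_bound:
  fixes \<mu> :: "'a::{metric_space, second_countable_topology} measure"
  assumes \<mu>: "\<mu> \<in> D_class \<nu> \<beta> p" and p: "1 \<le> p"
  obtains r Q where "0 < r" "\<And>x. emeasure \<mu> (ball x r) \<le> ennreal Q"
proof (cases "\<nu> < \<beta>")
  case True
  then have fin: "(SUP x. emeasure \<mu> (cball x 1)) < \<infinity>" using \<mu> by (simp add: D_class_def)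
  then obtain Q where Q: "(SUP x. emeasure \<mu> (cball x 1)) = ennreal Q"
    by (cases "SUP x. emeasure \<mu> (cball x 1)") auto
  have "emeasure \<mu> (ball x 1) \<le> ennreal Q" for x
  proof -
    have "emeasure \<mu> (ball x 1) \<le> emeasure \<mu> (cball x 1)"
      using sets_if_D_class[OF \<mu>] by (intro emeasure_mono) auto
    also have "\<dots> \<le> ennreal Q" unfolding Q[symmetric] by (rule SUP_upper) simp
    finally show ?thesis .
  qed
  then show ?thesis by (intro that[of 1]) auto
next
  case False
  let ?S = "sup_G_ball \<nu> \<beta> p \<mu>"
  obtain r where r: "0 < r" "\<nu> = \<beta> \<longrightarrow> r < 1" "?S r < \<infinity>"
    using \<mu> False by (auto simp: D_class_def)
  obtain M where M: "?S r = ennreal M" "0 \<le> M" using r(3) by (cases "?S r") auto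
  define g where "g = (if \<beta> < \<nu> then r powr (\<beta> - \<nu>) else ln (1 / r))"
  have g: "0 < g" "G \<nu> \<beta> r = ennreal g" using r False by (auto simp: g_def G_def)
  have "emeasure \<mu> (ball x r) \<le> ennreal (1 / g powr p * M)" for x
  proof -
    have "ennreal (g powr p) * emeasure \<mu> (ball x r) = (\<integral>\<^sup>+y\<in>ball x r. ennreal (g powr p) \<partial>\<mu>)"
      using sets_if_D_class[OF \<mu>] by (intro nn_integral_cmult_indicator[symmetric]) simp
    also have "\<dots> \<le> (\<integral>\<^sup>+y\<in>ball x r. ennpowr (G \<nu> \<beta> (dist x y)) p \<partial>\<mu>)"
    proof (rule nn_integral_mono)
      fix y
      have "ennreal (g powr p) \<le> ennpowr (G \<nu> \<beta> (dist x y)) p" if "dist x y < r"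
        using G_antimono[of \<beta> \<nu> "dist x y" r] ennpowr_mono[of "ennreal g" "G \<nu> \<beta> (dist x y)" p] g that False p
        by (simp add: ennpowr_ennreal)
      then show "ennreal (g powr p) * indicator (ball x r) y \<le> ennpowr (G \<nu> \<beta> (dist x y)) p * indicator (ball x r) y"
        by (auto split: split_indicator)
    qed
    also have "\<dots> \<le> ennreal M" unfolding M(1)[symmetric] by (rule SUP_upper) simp
    finally have "ennreal (1 / g powr p) * (ennreal (g powr p) * emeasure \<mu> (ball x r)) \<le> ennreal (1 / g powr p) * ennreal M"
      by (rule mult_left_mono) simp
    moreover have "ennreal (1 / g powr p) * (ennreal (g powr p) * emeasure \<mu> (ball x r)) = emeasure \<mu> (ball x r)"
      using g by (simp flip: mult.assoc ennreal_mult')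
    moreover have "ennreal (1 / g powr p) * ennreal M = ennreal (1 / g powr p * M)"
      by (intro ennreal_mult'[symmetric]) simp
    ultimately show ?thesis by simp
  qed
  with r(1) show ?thesis by (rule that)
qed

section \<open>Comparison of the classes under heat kernel bounds\<close>

context heat_kernel_bounds
begin

lemma D_class_uniformly_finite:
  assumes "(\<mu> :: 'a measure) \<in> D_class \<nu> \<beta> p" "1 \<le> p"
  shows "uniformly_finite_on_balls \<mu>"
proof -
  obtain r Q where "0 < r" "\<And>x. emeasure \<mu> (ball x r) \<le> ennreal Q"
    using D_class_ball_bound[OF assms] by blast
  then show ?thesis
    by (rule uniformly_finite_on_balls_if_one_radius[OF sets_if_D_class[OF assms(1)]])
qed

lemma D_class_radon:
  assumes "(\<mu> :: 'a measure) \<in> D_class \<nu> \<beta> p" "1 \<le> p"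
  shows "radon_measure \<mu>"
proof (rule radon_measure_if_finite_on_balls[OF lc sets_if_D_class[OF assms(1)]])
  fix x :: 'a and R :: real assume "0 < R"
  have "emeasure \<mu> (ball x R) \<le> (SUP x. emeasure \<mu> (ball x R))" by (rule SUP_upper) simp
  also have "\<dots> < \<infinity>"
    using D_class_uniformly_finite[OF assms] \<open>0 < R\<close> by (simp add: uniformly_finite_on_balls_def)
  finally show "emeasure \<mu> (ball x R) < \<infinity>" .
qed

text \<open>
  \<open>C\<close> is fixed before \<open>t\<close>, so that the bound passes to the limit \<open>t \<rightarrow> 0\<close>.
\<close>

lemma G_ball_integral_le:
  assumes \<beta>\<nu>: "\<beta> \<le> \<nu>" and p: "1 \<le> p"
  obtains C where "0 < C"
    "\<And>t (\<mu> :: 'a measure). 0 < t \<Longrightarrow> t < T \<Longrightarrow> sets \<mu> = sets borel \<Longrightarrow>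
      \<exists>\<rho>>0. \<forall>r\<le>\<rho>. sup_G_ball \<nu> \<beta> p \<mu> r
        \<le> ennreal C * sup_potential k p \<mu> t"
proof -
  obtain c where c: "0 < c"
    "\<And>t. 0 < t \<Longrightarrow> t < 1 \<Longrightarrow> \<exists>\<rho>>0. \<forall>d. 0 \<le> d \<and> d < \<rho> \<longrightarrow> ennreal c * G \<nu> \<beta> d \<le> radial_potential \<Psi> \<nu> \<beta> t d"
    using G_le_radial_potential[OF \<beta> \<beta>\<nu> \<Psi>_pos \<Psi>_antimono] by blast
  have cp: "0 < c powr p" using c by simp
  show ?thesis
  proof (rule that[of "1 / c powr p"])
    fix t :: real and \<mu> :: "'a measure"
    assume t: "0 < t" "t < T" and [measurable_cong]: "sets \<mu> = sets borel"
    then obtain \<rho> where \<rho>: "0 < \<rho>" "\<And>d. 0 \<le> d \<Longrightarrow> d < \<rho> \<Longrightarrow> ennreal c * G \<nu> \<beta> d \<le> radial_potential \<Psi> \<nu> \<beta> t d"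
      using c(2)[of t] T by auto
    have "(\<integral>\<^sup>+y\<in>ball x r. ennpowr (G \<nu> \<beta> (dist x y)) p \<partial>\<mu>)
      \<le> ennreal (1 / c powr p) * (\<integral>\<^sup>+y. ennpowr (kernel_potential k t x y) p \<partial>\<mu>)" if "r \<le> \<rho>" for x r
    proof -
      have [measurable]: "ball x r \<in> sets borel" by simp
      have "(\<integral>\<^sup>+y\<in>ball x r. ennpowr (G \<nu> \<beta> (dist x y)) p \<partial>\<mu>)
        = ennreal (1 / c powr p) * ennreal (c powr p) * (\<integral>\<^sup>+y\<in>ball x r. ennpowr (G \<nu> \<beta> (dist x y)) p \<partial>\<mu>)"
        using c by (simp flip: ennreal_mult')
      also have "\<dots> = ennreal (1 / c powr p) * (\<integral>\<^sup>+y. ennreal (c powr p) * (ennpowr (G \<nu> \<beta> (dist x y)) p * indicator (ball x r) y) \<partial>\<mu>)"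
        unfolding mult.assoc by (subst nn_integral_cmult) measurable
      also have "\<dots> \<le> ennreal (1 / c powr p) * (\<integral>\<^sup>+y. ennpowr (kernel_potential k t x y) p \<partial>\<mu>)"
      proof (intro mult_left_mono nn_integral_mono)
        fix y
        show "ennreal (c powr p) * (ennpowr (G \<nu> \<beta> (dist x y)) p * indicator (ball x r) y)
          \<le> ennpowr (kernel_potential k t x y) p"
        proof (cases "dist x y < r")
          case True
          have "ennreal (c powr p) * ennpowr (G \<nu> \<beta> (dist x y)) p = ennpowr (ennreal c * G \<nu> \<beta> (dist x y)) p"
            by (rule ennpowr_cmult[OF c(1), symmetric])
          also have "\<dots> \<le> ennpowr (kernel_potential k t x y) p"
          proof (rule ennpowr_mono)
            have "ennreal c * G \<nu> \<beta> (dist x y) \<le> radial_potential \<Psi> \<nu> \<beta> t (dist x y)"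
              using True that by (intro \<rho>(2)) auto
            also have "\<dots> \<le> kernel_potential k t x y" using t by (intro le_kernel_potential) simp
            finally show "ennreal c * G \<nu> \<beta> (dist x y) \<le> kernel_potential k t x y" .
          qed (use p in simp)
          finally show ?thesis using True by simp
        qed simp
      qed simp
      finally show ?thesis .
    qed
    moreover have "ennreal (1 / c powr p) * (\<integral>\<^sup>+y. ennpowr (kernel_potential k t x y) p \<partial>\<mu>)
      \<le> ennreal (1 / c powr p) * sup_potential k p \<mu> t" for x
      by (intro mult_left_mono SUP_upper) simp_all
    ultimately have "\<forall>r\<le>\<rho>. sup_G_ball \<nu> \<beta> p \<mu> r
        \<le> ennreal (1 / c powr p) * sup_potential k p \<mu> t"
      by (intro allI impI SUP_least) (rule order_trans)
    with \<rho>(1) show "\<exists>\<rho>>0. \<forall>r\<le>\<rho>. sup_G_ball \<nu> \<beta> p \<mu> r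
        \<le> ennreal (1 / c powr p) * sup_potential k p \<mu> t"
      by (intro exI[of _ \<rho>] conjI)
  qed (use cp in simp)
qed

text \<open>
  \<open>C\<close> is fixed before the radius \<open>r\<close>. For the Kato class one first makes the integral over the ball
  small by the choice of \<open>r\<close> and then the far part by the choice of \<open>t\<close>.
\<close>

lemma potential_SUP_le_G_SUP:
  assumes \<beta>\<nu>: "\<beta> \<le> \<nu>" and p: "1 \<le> p"
  obtains C where "0 < C"
    "\<And>(\<mu> :: 'a measure) r Q. sets \<mu> = sets borel \<Longrightarrow> 0 < r \<Longrightarrow> r \<le> 1/2 \<Longrightarrow> \<forall>x. emeasure \<mu> (ball x r) \<le> ennreal Q \<Longrightarrow>
      \<exists>B>0. \<exists>t\<^sub>1>0. \<forall>t. 0 < t \<and> t < t\<^sub>1 \<longrightarrow>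
        sup_potential k p \<mu> t
        \<le> ennreal C * sup_G_ball \<nu> \<beta> p \<mu> r + ennreal (B * t)"
proof -
  obtain C where C: "0 < C"
    "\<And>t d. 0 < t \<Longrightarrow> t \<le> 1 \<Longrightarrow> 0 \<le> d \<Longrightarrow> d \<le> 1/2 \<Longrightarrow> h t d \<le> ennreal C * G \<nu> \<beta> d"
    using radial_potential_le_G[OF \<beta>\<nu>] by blast
  show ?thesis
  proof (rule that[of "C powr p"])
    fix \<mu> :: "'a measure" and r Q :: real
    assume \<mu> [measurable_cong]: "sets \<mu> = sets borel" and r: "0 < r" "r \<le> 1/2"
      and "\<forall>x. emeasure \<mu> (ball x r) \<le> ennreal Q"
    then have Q: "\<And>x. emeasure \<mu> (ball x r) \<le> ennreal Q" by simp
    obtain B t\<^sub>1 where B: "0 < B" "0 < t\<^sub>1" "t\<^sub>1 \<le> T"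
      "\<And>t x F. 0 < t \<Longrightarrow> t < t\<^sub>1 \<Longrightarrow> F \<in> borel_measurable borel
       \<Longrightarrow> (\<And>y. y \<in> ball x r \<Longrightarrow> ennpowr (h t (dist x y)) p \<le> F y)
       \<Longrightarrow> (\<integral>\<^sup>+y. ennpowr (kernel_potential k t x y) p \<partial>\<mu>) \<le> (\<integral>\<^sup>+y\<in>ball x r. F y \<partial>\<mu>) + ennreal (B * t)"
      using potential_integral_le[OF \<mu> r(1) Q p] by blast
    let ?S = "sup_G_ball \<nu> \<beta> p \<mu> r"
    have "(\<integral>\<^sup>+y. ennpowr (kernel_potential k t x y) p \<partial>\<mu>) \<le> ennreal (C powr p) * ?S + ennreal (B * t)"
      if t: "0 < t" "t < t\<^sub>1" for t x
    proof -
      have [measurable]: "ball x r \<in> sets borel" by simp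
      have "(\<integral>\<^sup>+y. ennpowr (kernel_potential k t x y) p \<partial>\<mu>)
        \<le> (\<integral>\<^sup>+y\<in>ball x r. (ennreal (C powr p) * ennpowr (G \<nu> \<beta> (dist x y)) p) \<partial>\<mu>) + ennreal (B * t)"
      proof (rule B(4)[OF t])
        fix y assume "y \<in> ball x r"
        then have "h t (dist x y) \<le> ennreal C * G \<nu> \<beta> (dist x y)"
          using t B(3) T r by (intro C(2)) auto
        then have "ennpowr (h t (dist x y)) p \<le> ennpowr (ennreal C * G \<nu> \<beta> (dist x y)) p"
          using p by (intro ennpowr_mono) auto
        then show "ennpowr (h t (dist x y)) p \<le> ennreal (C powr p) * ennpowr (G \<nu> \<beta> (dist x y)) p"
          by (simp add: ennpowr_cmult[OF C(1)])
      qed measurable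
      also have "(\<integral>\<^sup>+y\<in>ball x r. (ennreal (C powr p) * ennpowr (G \<nu> \<beta> (dist x y)) p) \<partial>\<mu>)
        = ennreal (C powr p) * (\<integral>\<^sup>+y\<in>ball x r. ennpowr (G \<nu> \<beta> (dist x y)) p \<partial>\<mu>)"
        unfolding mult.assoc by (rule nn_integral_cmult) measurable
      also have "\<dots> + ennreal (B * t) \<le> ennreal (C powr p) * ?S + ennreal (B * t)"
        by (intro add_right_mono mult_left_mono SUP_upper) simp_all
      finally show ?thesis .
    qed
    then have "\<forall>t. 0 < t \<and> t < t\<^sub>1 \<longrightarrow> sup_potential k p \<mu> t
        \<le> ennreal (C powr p) * ?S + ennreal (B * t)"
      by (intro allI impI SUP_least) simp
    with B(1,2) show "\<exists>B>0. \<exists>t\<^sub>1>0. \<forall>t. 0 < t \<and> t < t\<^sub>1 \<longrightarrow>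
        sup_potential k p \<mu> t \<le> ennreal (C powr p) * ?S + ennreal (B * t)"
      by (intro exI[of _ B] exI[of _ t\<^sub>1] conjI)
  qed (use C in simp)
qed

lemma S_D_subset_D_class:
  assumes \<beta>\<nu>: "\<beta> \<le> \<nu>" and p: "1 \<le> p"
  shows "(S_D k p :: 'a measure set) \<subseteq> D_class \<nu> \<beta> p"
proof
  fix \<mu> :: "'a measure" assume \<mu>: "\<mu> \<in> S_D k p"
  then have sets: "sets \<mu> = sets borel" by (simp add: S_D_def radon_measure_def)
  let ?S = "sup_potential k p \<mu>"
  obtain t where t: "0 < t" "?S t < \<infinity>" using \<mu> by (auto simp: S_D_def)
  define s where "s = min t (T/2)"
  have s: "0 < s" "s < T" "s \<le> t" using t T by (auto simp: s_def)
  obtain C where "0 < C" and C: "\<And>t (\<mu> :: 'a measure). 0 < t \<Longrightarrow> t < T \<Longrightarrow> sets \<mu> = sets borel \<Longrightarrow>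
      \<exists>\<rho>>0. \<forall>r\<le>\<rho>. sup_G_ball \<nu> \<beta> p \<mu> r
        \<le> ennreal C * sup_potential k p \<mu> t"
    by (rule G_ball_integral_le[OF \<beta>\<nu> p]) (rule that)
  let ?K = "sup_G_ball \<nu> \<beta> p \<mu>"
  obtain \<rho> where "0 < \<rho> \<and> (\<forall>r\<le>\<rho>. ?K r \<le> ennreal C * ?S s)"
    using C[OF s(1,2) sets] ..
  then have \<rho>: "0 < \<rho>" "\<And>r. r \<le> \<rho> \<Longrightarrow> ?K r \<le> ennreal C * ?S s" by simp_all
  have "?S s < \<infinity>"
    using SUP_potential_mono[OF s(3), where p = p and k = k and \<mu> = \<mu>] p t(2) by (simp add: order.strict_trans1)
  then have "ennreal C * ?S s < \<infinity>" by (simp add: ennreal_mult_less_top)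
  moreover have "?K (min \<rho> (1/2)) \<le> ennreal C * ?S s" by (rule \<rho>(2)) simp
  ultimately have "?K (min \<rho> (1/2)) < \<infinity>" by (rule order.strict_trans1[rotated])
  moreover have "0 < min \<rho> (1/2)" "min \<rho> (1/2) < 1" using \<rho>(1) by simp_all
  ultimately have "\<exists>r>0. (\<nu> = \<beta> \<longrightarrow> r < 1) \<and> ?K r < \<infinity>" by (intro exI[of _ "min \<rho> (1/2)"] conjI impI)
  with sets \<beta>\<nu> show "\<mu> \<in> D_class \<nu> \<beta> p" by (simp add: D_class_def)
qed

lemma S_K_subset_K_class:
  assumes \<beta>\<nu>: "\<beta> \<le> \<nu>" and p: "1 \<le> p"
  shows "(S_K k p :: 'a measure set) \<subseteq> K_class \<nu> \<beta> p"
proof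
  fix \<mu> :: "'a measure" assume \<mu>: "\<mu> \<in> S_K k p"
  then have sets: "sets \<mu> = sets borel" by (simp add: S_K_def radon_measure_def)
  let ?S = "sup_potential k p \<mu>"
  let ?K = "sup_G_ball \<nu> \<beta> p \<mu>"
  obtain C where "0 < C" and C: "\<And>t (\<mu> :: 'a measure). 0 < t \<Longrightarrow> t < T \<Longrightarrow> sets \<mu> = sets borel \<Longrightarrow>
      \<exists>\<rho>>0. \<forall>r\<le>\<rho>. sup_G_ball \<nu> \<beta> p \<mu> r
        \<le> ennreal C * sup_potential k p \<mu> t"
    by (rule G_ball_integral_le[OF \<beta>\<nu> p]) (rule that)
  have "(?S \<longlongrightarrow> 0) (at_right 0)" using \<mu> by (simp add: S_K_def)
  then have "((\<lambda>t. ennreal C * ?S t) \<longlongrightarrow> ennreal C * 0) (at_right 0)"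
    by (intro ennreal_tendsto_cmult) simp_all
  then have lim: "((\<lambda>t. ennreal C * ?S t) \<longlongrightarrow> 0) (at_right 0)" by simp
  have "(?K \<longlongrightarrow> 0) (at_right 0)"
  proof (rule order_tendstoI)
    fix a :: ennreal assume "0 < a"
    with lim have "eventually (\<lambda>t. ennreal C * ?S t < a) (at_right 0)" by (rule order_tendstoD(2))
    then obtain t where t: "0 < t" "t < T" "ennreal C * ?S t < a"
      using T(1) by (rule eventually_at_right_0D)
    obtain \<rho> where "0 < \<rho> \<and> (\<forall>r\<le>\<rho>. ?K r \<le> ennreal C * ?S t)"
      using C[OF t(1,2) sets] ..
    then have \<rho>: "0 < \<rho>" "\<And>r. r \<le> \<rho> \<Longrightarrow> ?K r \<le> ennreal C * ?S t" by simp_all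
    have "eventually (\<lambda>r. r \<in> {0<..<\<rho>}) (at_right (0::real))"
      using \<rho>(1) by (rule eventually_at_right_real)
    then show "eventually (\<lambda>r. ?K r < a) (at_right 0)"
    proof eventually_elim
      case (elim r)
      then have "?K r \<le> ennreal C * ?S t" by (intro \<rho>(2)) simp
      then show ?case using t(3) by (rule order.strict_trans1)
    qed
  qed simp
  with sets \<beta>\<nu> show "\<mu> \<in> K_class \<nu> \<beta> p" by (simp add: K_class_def)
qed

lemma D_class_subset_S_D:
  assumes \<beta>\<nu>: "\<beta> \<le> \<nu>" and p: "1 \<le> p"
  shows "D_class \<nu> \<beta> p \<subseteq> (S_D k p :: 'a measure set)"
proof
  fix \<mu> :: "'a measure" assume \<mu>: "\<mu> \<in> D_class \<nu> \<beta> p"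
  note sets = sets_if_D_class[OF \<mu>]
  let ?K = "sup_G_ball \<nu> \<beta> p \<mu>"
  obtain r\<^sub>1 where r1: "0 < r\<^sub>1" "?K r\<^sub>1 < \<infinity>" using \<mu> \<beta>\<nu> by (auto simp: D_class_def)
  obtain r\<^sub>2 Q where r2: "0 < r\<^sub>2" "\<And>x. emeasure \<mu> (ball x r\<^sub>2) \<le> ennreal Q"
    using D_class_ball_bound[OF \<mu> p] by blast
  define r where "r = min (min r\<^sub>1 r\<^sub>2) (1/2)"
  have r: "0 < r" "r \<le> 1/2" "r \<le> r\<^sub>1" "r \<le> r\<^sub>2" using r1 r2 by (auto simp: r_def)
  have "emeasure \<mu> (ball x r) \<le> ennreal Q" for x
    using r(4) sets by (intro order_trans[OF emeasure_mono r2(2)[of x]]) auto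
  then have Q: "\<forall>x. emeasure \<mu> (ball x r) \<le> ennreal Q" ..
  obtain C where "0 < C" and C: "\<And>(\<mu> :: 'a measure) r Q. sets \<mu> = sets borel \<Longrightarrow> 0 < r \<Longrightarrow> r \<le> 1/2 \<Longrightarrow> \<forall>x. emeasure \<mu> (ball x r) \<le> ennreal Q \<Longrightarrow>
      \<exists>B>0. \<exists>t\<^sub>1>0. \<forall>t. 0 < t \<and> t < t\<^sub>1 \<longrightarrow>
        sup_potential k p \<mu> t
        \<le> ennreal C * sup_G_ball \<nu> \<beta> p \<mu> r + ennreal (B * t)"
    by (rule potential_SUP_le_G_SUP[OF \<beta>\<nu> p]) (rule that)
  let ?S = "sup_potential k p \<mu>"
  have "\<exists>B>0. \<exists>t\<^sub>1>0. \<forall>t. 0 < t \<and> t < t\<^sub>1 \<longrightarrow> ?S t \<le> ennreal C * ?K r + ennreal (B * t)"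
    by (rule C[OF sets r(1,2) Q])
  then obtain B where "0 < B \<and> (\<exists>t\<^sub>1>0. \<forall>t. 0 < t \<and> t < t\<^sub>1 \<longrightarrow> ?S t \<le> ennreal C * ?K r + ennreal (B * t))" ..
  then have "\<exists>t\<^sub>1>0. \<forall>t. 0 < t \<and> t < t\<^sub>1 \<longrightarrow> ?S t \<le> ennreal C * ?K r + ennreal (B * t)" ..
  then obtain t\<^sub>1 where "0 < t\<^sub>1 \<and> (\<forall>t. 0 < t \<and> t < t\<^sub>1 \<longrightarrow> ?S t \<le> ennreal C * ?K r + ennreal (B * t))" ..
  then have t1: "0 < t\<^sub>1" "\<And>t. 0 < t \<Longrightarrow> t < t\<^sub>1 \<Longrightarrow> ?S t \<le> ennreal C * ?K r + ennreal (B * t)"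
    by simp_all
  have "?S (t\<^sub>1/2) \<le> ennreal C * ?K r + ennreal (B * (t\<^sub>1/2))"
    using t1(1) by (intro t1(2)) auto
  moreover have "?K r < \<infinity>"
    using SUP_G_ball_mono[OF r(3)] r1(2) by (rule order.strict_trans1)
  then have "ennreal C * ?K r + ennreal (B * (t\<^sub>1/2)) < \<infinity>" by (simp add: ennreal_mult_less_top)
  ultimately have "?S (t\<^sub>1/2) < \<infinity>" by (rule order.strict_trans1)
  moreover have "0 < t\<^sub>1/2" using t1(1) by simp
  ultimately have "\<exists>t>0. ?S t < \<infinity>" by (intro exI[of _ "t\<^sub>1/2"] conjI)
  with D_class_radon[OF \<mu> p] show "\<mu> \<in> S_D k p" by (simp add: S_D_def)
qed

lemma K_class_subset_S_K:
  assumes \<beta>\<nu>: "\<beta> \<le> \<nu>" and p: "1 \<le> p"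
  shows "K_class \<nu> \<beta> p \<subseteq> (S_K k p :: 'a measure set)"
proof
  fix \<mu> :: "'a measure" assume \<mu>K: "\<mu> \<in> K_class \<nu> \<beta> p"
  then have \<mu>: "\<mu> \<in> D_class \<nu> \<beta> p" using K_class_subset_D_class by blast
  note sets = sets_if_D_class[OF \<mu>]
  let ?S = "sup_potential k p \<mu>"
  let ?K = "sup_G_ball \<nu> \<beta> p \<mu>"
  obtain r\<^sub>2 Q where r2: "0 < r\<^sub>2" "\<And>x. emeasure \<mu> (ball x r\<^sub>2) \<le> ennreal Q"
    using D_class_ball_bound[OF \<mu> p] by blast
  obtain C where "0 < C" and C: "\<And>(\<mu> :: 'a measure) r Q. sets \<mu> = sets borel \<Longrightarrow> 0 < r \<Longrightarrow> r \<le> 1/2 \<Longrightarrow> \<forall>x. emeasure \<mu> (ball x r) \<le> ennreal Q \<Longrightarrow>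
      \<exists>B>0. \<exists>t\<^sub>1>0. \<forall>t. 0 < t \<and> t < t\<^sub>1 \<longrightarrow>
        sup_potential k p \<mu> t
        \<le> ennreal C * sup_G_ball \<nu> \<beta> p \<mu> r + ennreal (B * t)"
    by (rule potential_SUP_le_G_SUP[OF \<beta>\<nu> p]) (rule that)
  have "(?K \<longlongrightarrow> 0) (at_right 0)" using \<mu>K \<beta>\<nu> by (simp add: K_class_def)
  then have "((\<lambda>r. ennreal C * ?K r) \<longlongrightarrow> ennreal C * 0) (at_right 0)"
    by (intro ennreal_tendsto_cmult) simp_all
  then have lim: "((\<lambda>r. ennreal C * ?K r) \<longlongrightarrow> 0) (at_right 0)" by simp
  have "(?S \<longlongrightarrow> 0) (at_right 0)"
  proof (rule order_tendstoI)
    fix a :: ennreal assume "0 < a"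
    then obtain b where "0 < b" "b < a" using dense by blast
    then obtain e where e: "0 < e" "ennreal e < a" by (cases b) auto
    have "0 < ennreal (e/2)" using e by simp
    with lim have "eventually (\<lambda>r. ennreal C * ?K r < ennreal (e/2)) (at_right 0)" by (rule order_tendstoD(2))
    then obtain r where r': "0 < r" "r < min r\<^sub>2 (1/2)" and rK: "ennreal C * ?K r < ennreal (e/2)"
      by (rule eventually_at_right_0D[of _ "min r\<^sub>2 (1/2)"]) (use r2(1) in simp_all)
    then have r: "0 < r" "r \<le> r\<^sub>2" "r \<le> 1/2" by simp_all
    have "emeasure \<mu> (ball x r) \<le> ennreal Q" for x
      using r(2) sets by (intro order_trans[OF emeasure_mono r2(2)[of x]]) auto
  then have Q: "\<forall>x. emeasure \<mu> (ball x r) \<le> ennreal Q" ..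
    have "\<exists>B>0. \<exists>t\<^sub>1>0. \<forall>t. 0 < t \<and> t < t\<^sub>1 \<longrightarrow> ?S t \<le> ennreal C * ?K r + ennreal (B * t)"
      by (rule C[OF sets r(1,3) Q])
    then obtain B where B: "0 < B \<and> (\<exists>t\<^sub>1>0. \<forall>t. 0 < t \<and> t < t\<^sub>1 \<longrightarrow> ?S t \<le> ennreal C * ?K r + ennreal (B * t))" ..
    then have "\<exists>t\<^sub>1>0. \<forall>t. 0 < t \<and> t < t\<^sub>1 \<longrightarrow> ?S t \<le> ennreal C * ?K r + ennreal (B * t)" ..
    then obtain t\<^sub>1 where "0 < t\<^sub>1 \<and> (\<forall>t. 0 < t \<and> t < t\<^sub>1 \<longrightarrow> ?S t \<le> ennreal C * ?K r + ennreal (B * t))" ..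
    with B have t1: "0 < B" "0 < t\<^sub>1" "\<And>t. 0 < t \<Longrightarrow> t < t\<^sub>1 \<Longrightarrow> ?S t \<le> ennreal C * ?K r + ennreal (B * t)"
      by simp_all
    have "eventually (\<lambda>t. t \<in> {0<..<min t\<^sub>1 (e / 2 / B)}) (at_right (0::real))"
      using t1(1,2) e by (intro eventually_at_right_real) simp
    then show "eventually (\<lambda>t. ?S t < a) (at_right 0)"
    proof eventually_elim
      case (elim t)
      then have "?S t \<le> ennreal C * ?K r + ennreal (B * t)" by (intro t1(3)) auto
      also have "\<dots> \<le> ennreal (e/2) + ennreal (e/2)"
        using elim rK t1(1) by (intro add_mono ennreal_leI) (auto simp: field_simps)
      also have "\<dots> = ennreal e" using e by (simp flip: ennreal_plus)
      finally show ?case using e(2) by (rule order.strict_trans1)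
    qed
  qed simp
  with D_class_radon[OF \<mu> p] show "\<mu> \<in> S_K k p" by (simp add: S_K_def)
qed

text \<open>
  For \<open>d \<le> 1\<close> the times between \<open>s/2\<close> and \<open>s\<close> contribute a fixed positive amount to the potential.
\<close>

lemma S_D_subset_D_class_subcritical:
  assumes \<nu>\<beta>: "\<nu> < \<beta>" and p: "1 \<le> p"
  shows "(S_D k p :: 'a measure set) \<subseteq> D_class \<nu> \<beta> p"
proof
  fix \<mu> :: "'a measure" assume \<mu>: "\<mu> \<in> S_D k p"
  then have sets: "sets \<mu> = sets borel" by (simp add: S_D_def radon_measure_def)
  let ?S = "sup_potential k p \<mu>"
  obtain t where t: "0 < t" "?S t < \<infinity>" using \<mu> by (auto simp: S_D_def)
  define s where "s = min t (T/2)"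
  have s: "0 < s" "s \<le> T" "s \<le> t" using t T by (auto simp: s_def)
  define c where "c = \<Psi> (1 / (s/2) powr (1/\<beta>)) / s powr (\<nu>/\<beta>)"
  have c: "0 < c" unfolding c_def using s \<Psi>_pos by simp
  have "ennreal (c * (s - s/2)) = (\<integral>\<^sup>+u\<in>{s/2<..<s}. ennreal c \<partial>lborel)"
    using c s by (intro nn_integral_const_Ioo[symmetric]) auto
  also have "\<dots> \<le> radial_potential \<Psi> \<nu> \<beta> s 1"
    unfolding radial_potential_def
  proof (rule nn_integral_mono)
    fix u :: real
    have "c \<le> \<Psi> (1 / u powr (1/\<beta>)) / u powr (\<nu>/\<beta>)" if u: "s/2 < u" "u < s"
    proof -
      have u0: "0 < u" using u s by linarith
      have "1 / u powr (1/\<beta>) \<le> 1 / (s/2) powr (1/\<beta>)"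
        using u s \<beta> by (intro divide_left_mono powr_mono2) auto
      then have "\<Psi> (1 / (s/2) powr (1/\<beta>)) \<le> \<Psi> (1 / u powr (1/\<beta>))"
        using \<Psi>_antimono by (auto simp: monotone_on_def)
      moreover have "u powr (\<nu>/\<beta>) \<le> s powr (\<nu>/\<beta>)"
        using u u0 \<nu> \<beta> by (intro powr_mono2) auto
      moreover have "0 < \<Psi> (1 / u powr (1/\<beta>))" by (rule \<Psi>_pos) simp
      ultimately show ?thesis unfolding c_def using u0 by (intro frac_le) auto
    qed
    then show "ennreal c * indicator {s/2<..<s} u
      \<le> ennreal (\<Psi> (1 / u powr (1/\<beta>)) / u powr (\<nu>/\<beta>)) * indicator {0<..<s} u"
      using s by (auto split: split_indicator intro!: ennreal_leI)
  qed
  finally have low: "ennreal (c * (s/2)) \<le> radial_potential \<Psi> \<nu> \<beta> s 1" by simp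
  define a where "a = (c * (s/2)) powr p"
  have a: "0 < a" unfolding a_def using c s by simp
  have "?S s < \<infinity>"
    using SUP_potential_mono[OF s(3), where p = p and k = k and \<mu> = \<mu>] p t(2) by (simp add: order.strict_trans1)
  then obtain M where M: "?S s = ennreal M" "0 \<le> M" by (cases "?S s") auto
  have "emeasure \<mu> (cball x 1) \<le> ennreal (1 / a * M)" for x
  proof -
    have "ennreal a * emeasure \<mu> (cball x 1) = (\<integral>\<^sup>+y\<in>cball x 1. ennreal a \<partial>\<mu>)"
      using sets by (intro nn_integral_cmult_indicator[symmetric]) simp
    also have "\<dots> \<le> (\<integral>\<^sup>+y. ennpowr (kernel_potential k s x y) p \<partial>\<mu>)"
    proof (rule nn_integral_mono)
      fix y
      have "ennreal a \<le> ennpowr (kernel_potential k s x y) p" if "dist x y \<le> 1"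
      proof -
        note low
        also have "radial_potential \<Psi> \<nu> \<beta> s 1 \<le> radial_potential \<Psi> \<nu> \<beta> s (dist x y)"
          using that by (intro radial_potential_antimono[OF \<Psi>_antimono]) auto
        also have "\<dots> \<le> kernel_potential k s x y" using s by (intro le_kernel_potential)
        finally have "ennpowr (ennreal (c * (s/2))) p \<le> ennpowr (kernel_potential k s x y) p"
          using p by (intro ennpowr_mono) auto
        then show ?thesis using c s by (simp add: a_def ennpowr_ennreal)
      qed
      then show "ennreal a * indicator (cball x 1) y \<le> ennpowr (kernel_potential k s x y) p"
        by (auto split: split_indicator)
    qed
    also have "\<dots> \<le> ennreal M" unfolding M(1)[symmetric] by (rule SUP_upper) simp
    finally have "ennreal (1 / a) * (ennreal a * emeasure \<mu> (cball x 1)) \<le> ennreal (1 / a) * ennreal M"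
      by (rule mult_left_mono) simp
    moreover have "ennreal (1 / a) * (ennreal a * emeasure \<mu> (cball x 1)) = emeasure \<mu> (cball x 1)"
      using a by (simp flip: mult.assoc ennreal_mult')
    moreover have "ennreal (1 / a) * ennreal M = ennreal (1 / a * M)"
      using a by (intro ennreal_mult'[symmetric]) simp
    ultimately show ?thesis by simp
  qed
  then have "(SUP x. emeasure \<mu> (cball x 1)) \<le> ennreal (1 / a * M)" by (rule SUP_least)
  then have "(SUP x. emeasure \<mu> (cball x 1)) < \<infinity>" by (rule order.strict_trans1) simp
  with sets \<nu>\<beta> show "\<mu> \<in> D_class \<nu> \<beta> p" by (simp add: D_class_def)
qed

text \<open>
  The near part is at most a multiple of \<open>t powr ((1 - \<nu>/\<beta>) * p)\<close> and tends to 0, so there is no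
  difference between finite and small potentials.
\<close>

lemma D_class_subset_S_K_subcritical:
  assumes \<nu>\<beta>: "\<nu> < \<beta>" and p: "1 \<le> p"
  shows "D_class \<nu> \<beta> p \<subseteq> (S_K k p :: 'a measure set)"
proof
  fix \<mu> :: "'a measure" assume \<mu>: "\<mu> \<in> D_class \<nu> \<beta> p"
  note sets = sets_if_D_class[OF \<mu>]
  let ?S = "sup_potential k p \<mu>"
  obtain r Q where r: "0 < r" "\<And>x. emeasure \<mu> (ball x r) \<le> ennreal Q"
    using D_class_ball_bound[OF \<mu> p] by blast
  obtain B t\<^sub>1 where B: "0 < B" "0 < t\<^sub>1" "t\<^sub>1 \<le> T"
    "\<And>t x F. 0 < t \<Longrightarrow> t < t\<^sub>1 \<Longrightarrow> F \<in> borel_measurable borel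
     \<Longrightarrow> (\<And>y. y \<in> ball x r \<Longrightarrow> ennpowr (h t (dist x y)) p \<le> F y)
     \<Longrightarrow> (\<integral>\<^sup>+y. ennpowr (kernel_potential k t x y) p \<partial>\<mu>) \<le> (\<integral>\<^sup>+y\<in>ball x r. F y \<partial>\<mu>) + ennreal (B * t)"
    using potential_integral_le[OF sets r p] by blast
  define C where "C = \<Phi> 0 / (1 - \<nu>/\<beta>)"
  define q where "q = 1 - \<nu>/\<beta>"
  have q: "0 < q" unfolding q_def using \<nu>\<beta> \<beta> by simp
  have C: "0 < C" unfolding C_def using \<Phi>_pos[of 0] \<nu>\<beta> \<beta> by simp
  have up: "?S t \<le> ennreal ((C * t powr q) powr p * max Q 0 + B * t)" if t: "0 < t" "t < t\<^sub>1" for t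
  proof (rule SUP_least)
    fix x
    have "(\<integral>\<^sup>+y. ennpowr (kernel_potential k t x y) p \<partial>\<mu>)
      \<le> (\<integral>\<^sup>+y\<in>ball x r. ennreal ((C * t powr q) powr p) \<partial>\<mu>) + ennreal (B * t)"
    proof (rule B(4)[OF t])
      fix y
      have "h t (dist x y) \<le> ennreal (C * t powr q)"
        using radial_potential_le_subcritical[OF \<nu>\<beta> t(1), of "dist x y"] by (simp add: C_def q_def)
      then have "ennpowr (h t (dist x y)) p \<le> ennpowr (ennreal (C * t powr q)) p"
        using p by (intro ennpowr_mono) auto
      also have "\<dots> = ennreal ((C * t powr q) powr p)" using C by (intro ennpowr_ennreal) simp
      finally show "ennpowr (h t (dist x y)) p \<le> ennreal ((C * t powr q) powr p)" .
    qed simp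
    also have "(\<integral>\<^sup>+y\<in>ball x r. ennreal ((C * t powr q) powr p) \<partial>\<mu>) = ennreal ((C * t powr q) powr p) * emeasure \<mu> (ball x r)"
      using sets by (intro nn_integral_cmult_indicator) simp
    also have "\<dots> + ennreal (B * t) \<le> ennreal ((C * t powr q) powr p) * ennreal (max Q 0) + ennreal (B * t)"
    proof (intro add_right_mono mult_left_mono)
      show "emeasure \<mu> (ball x r) \<le> ennreal (max Q 0)"
        using r(2)[of x] by (rule order_trans) (simp add: ennreal_leI)
    qed simp
    also have "\<dots> = ennreal ((C * t powr q) powr p * max Q 0 + B * t)"
      using B(1) t by (simp add: ennreal_mult')
    finally show "(\<integral>\<^sup>+y. ennpowr (kernel_potential k t x y) p \<partial>\<mu>) \<le> ennreal ((C * t powr q) powr p * max Q 0 + B * t)" .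
  qed
  have "((\<lambda>t. ennreal ((C * t powr q) powr p * max Q 0 + B * t)) \<longlongrightarrow> ennreal 0) (at_right 0)"
  proof (rule tendsto_ennrealI)
    have "((\<lambda>t::real. t powr (q * p)) \<longlongrightarrow> 0 powr (q * p)) (at_right 0)"
      using q p eventually_at_right_less[of "0::real"]
      by (intro tendsto_powr2 tendsto_ident_at tendsto_const) (auto elim: eventually_mono)
    then have "((\<lambda>t::real. t powr (q * p)) \<longlongrightarrow> 0) (at_right 0)" by simp
    then have "((\<lambda>t. C powr p * t powr (q * p) * max Q 0 + B * t) \<longlongrightarrow> C powr p * 0 * max Q 0 + B * 0) (at_right 0)"
      by (intro tendsto_intros)
    moreover have "eventually (\<lambda>t. C powr p * t powr (q * p) * max Q 0 + B * t = (C * t powr q) powr p * max Q 0 + B * t) (at_right (0::real))"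
      using eventually_at_right_less[of "0::real"] by eventually_elim (use C in \<open>simp add: powr_mult powr_powr\<close>)
    ultimately show "((\<lambda>t. (C * t powr q) powr p * max Q 0 + B * t) \<longlongrightarrow> 0) (at_right 0)"
      by (simp add: filterlim_cong)
  qed
  moreover have "eventually (\<lambda>t. ?S t \<le> ennreal ((C * t powr q) powr p * max Q 0 + B * t)) (at_right 0)"
    using eventually_at_right_real[OF B(2)] by eventually_elim (use up in auto)
  ultimately have "(?S \<longlongrightarrow> 0) (at_right 0)"
    by (intro tendsto_sandwich[of "\<lambda>_. 0" ?S]) simp_all
  with D_class_radon[OF \<mu> p] show "\<mu> \<in> S_K k p" by (simp add: S_K_def)
qed

lemma S_K_eq_K_class:
  assumes p: "1 \<le> p"
  shows "S_K k p = (K_class \<nu> \<beta> p :: 'a measure set)"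
proof (cases "\<nu> < \<beta>")
  case True
  then show ?thesis
    using S_K_subset_S_D[of k p] S_D_subset_D_class_subcritical[OF True p] D_class_subset_S_K_subcritical[OF True p]
    by (simp add: K_class_eq_D_class)
next
  case False
  then show ?thesis
    using S_K_subset_K_class[OF _ p] K_class_subset_S_K[OF _ p] by simp
qed

lemma S_D_eq_D_class:
  assumes p: "1 \<le> p"
  shows "S_D k p = (D_class \<nu> \<beta> p :: 'a measure set)"
proof (cases "\<nu> < \<beta>")
  case True
  then show ?thesis
    using S_K_subset_S_D[of k p] S_D_subset_D_class_subcritical[OF True p] D_class_subset_S_K_subcritical[OF True p]
    by blast
next
  case False
  then show ?thesis
    using S_D_subset_D_class[OF _ p] D_class_subset_S_D[OF _ p] by simp
qed

lemma K_class_iff_uniformly_finite: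
  assumes "\<nu> < \<beta>" "1 \<le> p" and sets: "sets (\<mu> :: 'a measure) = sets borel"
  shows "\<mu> \<in> K_class \<nu> \<beta> p \<longleftrightarrow> uniformly_finite_on_balls \<mu>"
proof
  assume "\<mu> \<in> K_class \<nu> \<beta> p"
  then show "uniformly_finite_on_balls \<mu>"
    using D_class_uniformly_finite[OF _ assms(2)] K_class_subset_D_class by blast
next
  assume "uniformly_finite_on_balls \<mu>"
  then have "(SUP x. emeasure \<mu> (ball x 2)) < \<infinity>" by (simp add: uniformly_finite_on_balls_def)
  moreover have "(SUP x. emeasure \<mu> (cball x 1)) \<le> (SUP x. emeasure \<mu> (ball x 2))"
    using sets by (intro SUP_mono' emeasure_mono) auto
  ultimately have "(SUP x. emeasure \<mu> (cball x 1)) < \<infinity>" by (simp add: order.strict_trans1)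
  with assms show "\<mu> \<in> K_class \<nu> \<beta> p" by (simp add: K_class_def)
qed

end

section \<open>The life time condition and the mass of the kernel\<close>

lemma cemetery_in_cemetery_borel: "{None} \<in> sets (cemetery_borel :: 'a::topological_space option measure)"
proof -
  let ?\<G> = "{U. openin (cemetery_top :: 'a option topology) U}"
  have "openin cemetery_top (Some ` (UNIV :: 'a set))"
    unfolding openin_Alexandroff_compactification by (intro disjI1 exI[of _ UNIV]) simp
  then have "UNIV - Some ` UNIV \<in> sigma_sets UNIV ?\<G>"
    by (intro sigma_sets.Compl sigma_sets.Basic) simp
  also have "UNIV - Some ` (UNIV :: 'a set) = {None}" using notin_range_Some by (auto simp: image_iff) 
  finally show ?thesis unfolding cemetery_borel_def by simp
qed

context hunt_process
begin

lemma lifetime_le_iff: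
  assumes "\<omega> \<in> space M"
  shows "lifetime X \<omega> \<le> t \<longleftrightarrow> X t \<omega> = None"
proof
  assume "X t \<omega> = None"
  then show "lifetime X \<omega> \<le> t" unfolding lifetime_def by (intro Inf_lower) simp
qed (use after_lifetime assms in blast)

text \<open>
  The event that the life time is at most \<open>t\<close> is, by \<open>lifetime_le_iff\<close>, the event of being at the
  cemetery at time \<open>t\<close>. Its measurability matters since the \<open>measure\<close> of a nonmeasurable set is 0 by
  convention, which would make the life time condition empty.
\<close>

lemma dead_event_measurable: "{\<omega> \<in> space M. X t \<omega> = None} \<in> sets M"
proof -
  have "X t -` {None} \<inter> space (\<F> t) \<in> sets (\<F> t)"
    using adapted cemetery_in_cemetery_borel by (rule measurable_sets)
  also have "X t -` {None} \<inter> space (\<F> t) = {\<omega> \<in> space M. X t \<omega> = None}" by (auto simp: space_F)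
  finally show ?thesis using sub_filtration by blast
qed

lemma transition_one:
  "transition X P t (\<lambda>_. 1) x = 1 - measure (P (Some x)) {\<omega> \<in> space M. lifetime X \<omega> \<le> ennreal t}"
proof -
  interpret prob_space "P (Some x)" by (rule prob_P)
  have sp: "space (P (Some x)) = space M" using sets_P by (rule sets_eq_imp_space_eq)
  let ?D = "{\<omega> \<in> space M. X (ennreal t) \<omega> = None}"
  have D: "?D \<in> sets (P (Some x))" using dead_event_measurable sets_P by simp
  have "transition X P t (\<lambda>_. 1) x = (\<integral>\<omega>. indicator (space M - ?D) \<omega> \<partial>P (Some x))"
    unfolding transition_def by (intro Bochner_Integration.integral_cong) (auto simp: sp split: option.split)
  also have "\<dots> = prob (space M - ?D)" by (simp add: sp Int_absorb2)
  also have "\<dots> = 1 - prob ?D" using prob_compl[OF D] by (simp add: sp)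
  also have "?D = {\<omega> \<in> space M. lifetime X \<omega> \<le> ennreal t}" using lifetime_le_iff by auto
  finally show ?thesis .
qed

text \<open>
  The integral of the kernel is the probability of being alive, and it is at least \<open>(1 - c) / 2\<close> as
  soon as the supremum in the life time condition is below \<open>(1 + c) / 2\<close>, where \<open>c < 1\<close> is its limit.
\<close>

lemma kernel_mass_lower:
  fixes m :: "'a measure"
  assumes life: "life_time_condition M X P" and ker: "semigroup_kernel m X P k"
  obtains c\<^sub>0 t\<^sub>1 where "0 < c\<^sub>0" "0 < t\<^sub>1"
    "\<And>t x. 0 < t \<Longrightarrow> t < t\<^sub>1 \<Longrightarrow> ennreal c\<^sub>0 \<le> (\<integral>\<^sup>+y. ennreal (k t x y) \<partial>m)"
proof -
  have half: "1 - (1 + c) / 2 = (1 - c) / 2" for c :: real by (simp add: field_simps)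
  let ?q = "\<lambda>t x. measure (P (Some x)) {\<omega> \<in> space M. lifetime X \<omega> \<le> ennreal t}"
  obtain c where c: "c \<in> {0..<1}" "((\<lambda>t. SUP x. ?q t x) \<longlongrightarrow> c) (at_right 0)"
    using life unfolding life_time_condition_def by (elim bexE)
  have "eventually (\<lambda>t. (SUP x. ?q t x) < (1 + c) / 2) (at_right 0)"
    using c by (intro order_tendstoD(2)[OF c(2)]) simp
  then have "\<exists>b>0. \<forall>t>0. t < b \<longrightarrow> (SUP x. ?q t x) < (1 + c) / 2"
    unfolding eventually_at_right_field .
  then obtain t\<^sub>1 where "0 < t\<^sub>1 \<and> (\<forall>t>0. t < t\<^sub>1 \<longrightarrow> (SUP x. ?q t x) < (1 + c) / 2)" ..
  then have t1: "0 < t\<^sub>1" "\<And>t. 0 < t \<Longrightarrow> t < t\<^sub>1 \<Longrightarrow> (SUP x. ?q t x) < (1 + c) / 2" by simp_all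
  show ?thesis
  proof (rule that[of "(1 - c) / 2" t\<^sub>1])
    fix t x assume t: "0 < t" "t < t\<^sub>1"
    have "?q t x \<le> (SUP x. ?q t x)"
      by (intro cSUP_upper bdd_aboveI[of _ 1]) (auto intro: prob_space.prob_le_1[OF prob_P])
    also have "\<dots> < (1 + c) / 2" by (rule t1(2)[OF t])
    finally have "1 - (1 + c) / 2 \<le> 1 - ?q t x" by (intro diff_left_mono less_imp_le)
    then have "(1 - c) / 2 \<le> transition X P t (\<lambda>_. 1) x"
      unfolding half transition_one .
    also have "\<dots> = (\<integral>y. k t x y * 1 \<partial>m)"
    proof -
      have "\<forall>t>0. \<forall>x. \<forall>u\<in>borel_measurable borel. bounded (range u) \<longrightarrow>
          transition X P t u x = (\<integral>y. k t x y * u y \<partial>m)"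
        using ker unfolding semigroup_kernel_def by (elim conjE)
      from this[rule_format, OF t(1), of "\<lambda>_. 1" x] show ?thesis by (simp add: image_constant_conv)
    qed
    finally have le: "(1 - c) / 2 \<le> (\<integral>y. k t x y \<partial>m)" by simp
    \<comment> \<open>The integral of a function that is not integrable is 0 by convention.\<close>
    have int: "integrable m (k t x)"
    proof (rule ccontr)
      assume "\<not> integrable m (k t x)"
      then have "(\<integral>y. k t x y \<partial>m) = 0" by (rule not_integrable_integral_eq)
      with le c(1) show False by simp
    qed
    have "(\<integral>\<^sup>+y. ennreal (k t x y) \<partial>m) = ennreal (\<integral>y. k t x y \<partial>m)"
    proof (rule nn_integral_eq_integral[OF int])
      show "AE y in m. 0 \<le> k t x y" using ker t(1) by (simp add: semigroup_kernel_def)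
    qed
    with le show "ennreal ((1 - c) / 2) \<le> (\<integral>\<^sup>+y. ennreal (k t x y) \<partial>m)" by (simp add: ennreal_leI)
  qed (use c t1 in auto)
qed

end

section \<open>Coincidence of the Kato and Dynkin classes\<close>

theorem theorem3p1:
  fixes m :: "'a::{metric_space, second_countable_topology} measure"
    and D :: "('a \<Rightarrow> real) set"
    and \<E> :: "('a \<Rightarrow> real) \<Rightarrow> ('a \<Rightarrow> real) \<Rightarrow> real"
    and M :: "'w measure"
    and \<F> :: "ennreal \<Rightarrow> 'w measure"
    and X :: "ennreal \<Rightarrow> 'w \<Rightarrow> 'a option"
    and P :: "'a option \<Rightarrow> 'w measure"
    and k :: "real \<Rightarrow> 'a \<Rightarrow> 'a \<Rightarrow> real"
    and V :: "real \<Rightarrow> real"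
    and p \<nu> \<beta> :: real
    and t\<^sub>0 :: ennreal
  assumes "locally_compact_space (euclidean :: 'a topology)"
    and "radon_measure m" and "full_support m"
    and "regular_dirichlet_form m D \<E>"
    and "hunt_process M \<F> X P"
    and "associated m D \<E> X P"
    and "semigroup_kernel m X P k"
    and "1 \<le> p" and "0 < \<nu>" and "0 < \<beta>" and "0 < t\<^sub>0"
    and "mono_on {0<..} V" and "\<forall>r>0. 0 < V r"
    and "life_time_condition M X P"
    and "bishop_inequality m \<nu> V"
    and "heat_kernel_estimates \<nu> \<beta> t\<^sub>0 V k"
  shows "S_K k p = K_class \<nu> \<beta> p \<and>
    S_D k p = D_class \<nu> \<beta> p \<and>
    (\<forall>\<mu>\<in>(K_class \<nu> \<beta> p :: 'a measure set). uniformly_finite_on_balls \<mu>) \<and>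
    (\<nu> < \<beta> \<longrightarrow>
       S_D k p = K_class \<nu> \<beta> p \<and> K_class \<nu> \<beta> p = S_D k 1 \<and> S_D k 1 = K_class \<nu> \<beta> 1 \<and>
       (\<forall>\<mu> :: 'a measure. sets \<mu> = sets borel \<longrightarrow> (\<mu> \<in> K_class \<nu> \<beta> p \<longleftrightarrow> uniformly_finite_on_balls \<mu>)))"
proof -
  have sets_m: "sets m = sets borel" using \<open>radon_measure m\<close> by (simp add: radon_measure_def)
  obtain c\<^sub>0 t\<^sub>1 where c0: "0 < c\<^sub>0" and t1: "0 < t\<^sub>1"
    and mass: "\<And>t x. 0 < t \<Longrightarrow> t < t\<^sub>1 \<Longrightarrow> ennreal c\<^sub>0 \<le> (\<integral>\<^sup>+y. ennreal (k t x y) \<partial>m)"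
    by (rule hunt_process.kernel_mass_lower[OF \<open>hunt_process M \<F> X P\<close> \<open>life_time_condition M X P\<close>
          \<open>semigroup_kernel m X P k\<close>]) (rule that)
  obtain \<Phi>\<^sub>1 \<Phi>\<^sub>2 :: "real \<Rightarrow> real" where
    \<Phi>1: "\<forall>s\<ge>0. 0 < \<Phi>\<^sub>1 s" "antimono_on {0..} \<Phi>\<^sub>1" and
    \<Phi>2: "\<forall>s\<ge>0. 0 < \<Phi>\<^sub>2 s" "antimono_on {0..} \<Phi>\<^sub>2" and
    int: "(\<integral>\<^sup>+t\<in>{1..}. ennreal (max (V t) (t powr \<nu>) * \<Phi>\<^sub>2 t / t) \<partial>lborel) < \<infinity>" and
    est: "\<forall>x y t. 0 < t \<and> ennreal t < t\<^sub>0 \<longrightarrow>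
           1 / t powr (\<nu> / \<beta>) * \<Phi>\<^sub>1 (dist x y / t powr (1 / \<beta>)) \<le> k t x y \<and>
           k t x y \<le> 1 / t powr (\<nu> / \<beta>) * \<Phi>\<^sub>2 (dist x y / t powr (1 / \<beta>))"
    using \<open>heat_kernel_estimates \<nu> \<beta> t\<^sub>0 V k\<close> unfolding heat_kernel_estimates_def by (elim exE conjE) (rule that)
  obtain \<tau> where \<tau>: "0 < \<tau>" "\<And>t. t < \<tau> \<Longrightarrow> ennreal t < t\<^sub>0"
  proof (cases t\<^sub>0)
    case (real s)
    then show ?thesis using \<open>0 < t\<^sub>0\<close> by (intro that[of s]) (auto simp: ennreal_lessI)
  next
    case top
    then show ?thesis by (intro that[of 1]) auto
  qed
  define T where "T = min 1 (min \<tau> t\<^sub>1)"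
  interpret heat_kernel_bounds \<nu> \<beta> V \<Phi>\<^sub>2 m k \<Phi>\<^sub>1 T c\<^sub>0
  proof
    show "mono_on {0<..} (\<lambda>r. V r / r powr \<nu>) \<or> bounded ((\<lambda>r. V r / r powr \<nu>) ` {0<..})"
      using \<open>bishop_inequality m \<nu> V\<close> by (simp add: bishop_inequality_def)
    show "emeasure m (ball x r) \<le> ennreal (V r)" if "0 < r" for x r
    proof -
      have "emeasure m (ball x r) \<le> (SUP x. emeasure m (ball x r))" by (rule SUP_upper) simp
      also have "\<dots> \<le> ennreal (V r)"
        using \<open>bishop_inequality m \<nu> V\<close> that by (simp add: bishop_inequality_def)
      finally show ?thesis .
    qed
    show "\<Phi>\<^sub>1 (dist x y / t powr (1/\<beta>)) / t powr (\<nu>/\<beta>) \<le> k t x y" if "0 < t" "t < T" for t x y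
      using est \<tau>(2)[of t] that by (simp add: T_def)
    show "k t x y \<le> \<Phi>\<^sub>2 (dist x y / t powr (1/\<beta>)) / t powr (\<nu>/\<beta>)" if "0 < t" "t < T" for t x y
      using est \<tau>(2)[of t] that by (simp add: T_def)
    show "ennreal c\<^sub>0 \<le> (\<integral>\<^sup>+y. ennreal (k t x y) \<partial>m)" if "0 < t" "t < T" for t x
      using that by (intro mass) (simp_all add: T_def)
  qed (use assms sets_m \<Phi>1 \<Phi>2 int c0 t1 \<tau>(1) in \<open>simp_all add: T_def\<close>)
  have K: "S_K k p = (K_class \<nu> \<beta> p :: 'a measure set)" by (rule S_K_eq_K_class[OF \<open>1 \<le> p\<close>])
  have D: "S_D k p = (D_class \<nu> \<beta> p :: 'a measure set)" by (rule S_D_eq_D_class[OF \<open>1 \<le> p\<close>])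
  have D1: "S_D k 1 = (D_class \<nu> \<beta> 1 :: 'a measure set)" by (rule S_D_eq_D_class) simp
  have sub: "D_class \<nu> \<beta> q = (K_class \<nu> \<beta> p :: 'a measure set)" if "\<nu> < \<beta>" for q
    using that by (simp add: D_class_def K_class_def)
  have fin: "uniformly_finite_on_balls \<mu>" if "\<mu> \<in> K_class \<nu> \<beta> p" for \<mu> :: "'a measure"
    using that K_class_subset_D_class D_class_uniformly_finite[OF _ \<open>1 \<le> p\<close>] by blast
  have K1: "K_class \<nu> \<beta> 1 = (K_class \<nu> \<beta> p :: 'a measure set)" if "\<nu> < \<beta>"
    using that by (simp add: K_class_def)
  show ?thesis
    using K D D1 sub fin K1 K_class_iff_uniformly_finite[OF _ \<open>1 \<le> p\<close>] by simp
qed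

end
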